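(* Let $(M,\langle\cdot,\cdot\rangle^* )$ be a subriemannian manifold of dimension $m+1$ ($m\ge1$) with a background volume form $dv_M$, and let $\phi,\psi$ be ($C^\infty$) defining functions of hypersurfaces $\Sigma_1=\{\phi=0\}$ and $\Sigma_2=\{\psi=0\}$ which are tangent to each other at a point $p_0$, where $|d\phi|_*\neq0$ and $|d\psi|_*\ne0$. Assume $\dim\xi$ is constant, equal to $m+1-l$, near $p_0$. Let $p\ge0$ and assume that near $p_0$ $$H_{\psi,p}+b(x,\psi,D\psi)\le H_{\phi,p}+b(x,\phi,D\phi),$$ where $b=b(x,z,\cdot)$ is a $C^\infty$ function of all values of its arguments with $\frac{\partial b}{\partial z}\le0$. Moreover assume $\psi\ge\phi$ near $p_0$ and $\psi=\phi=0$ at $p_0$. Then: (a) If the rank condition $$\operatorname{rank}\mathcal{L}(X_1,\dots,X_{m-l})\ge m\quad\text{for any local sections }X_1,\dots,X_{m-l}\text{ of }\xi\text{ that are linearly independent wherever defined}$$ holds near $p_0$, then $\psi=\phi=0$ on $\Sigma_1$ near $p_0$; i.e., $\Sigma_2$ coincides with $\Sigma_1$ near $p_0$. (b) If $p>0$ and $\operatorname{rank}\mathcal{L}(\xi)=m+1$, then $\psi=\phi$ near $p_0$.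
   Context: A subriemannian manifold is a $C^\infty$ manifold $M$ with a (smooth) nonnegative definite inner product $\langle\cdot,\cdot\rangle^*$ on $T^*M$ (possibly degenerate); $|\omega|_*:=(\langle\omega,\omega\rangle^* )^{1/2}$. A background volume form $dv_M$ is a given nowhere vanishing $(m+1)$-form. For a 1-form $\omega$, $\omega\lrcorner dv_M$ is the $m$-form with $\eta\wedge(\omega\lrcorner dv_M)=\langle\eta,\omega\rangle^*dv_M$ for all 1-forms $\eta$. A defining function is a function $\phi$ with $d\phi\ne0$. Where $|d\phi|_*\ne0$, for $p\ge0$ the function $H_{\phi,p}$ is defined by $$d\Big(\frac{d\phi}{|d\phi|_*^{1-p}}\lrcorner dv_M\Big)=H_{\phi,p}\,dv_M .$$ $G:T^*M\to TM$ is defined by $\omega(G(\eta))=\langle\omega,\eta\rangle^*$, and $\xi:=\operatorname{Range}(G)\subset TM$. $D\phi$ denotes the first derivatives of $\phi$ (in local coordinates near $p_0$). For $C^\infty$ vector fields $X_1,\dots,X_r$, $\mathcal{L}(X_1,\dots,X_r)$ is the smallest $C^\infty$-module of vector fields containing $X_1,\dots,X_r$ and closed under Lie bracket; its rank at a point $q$ is the dimension of the span of $\{Z(q):Z\in\mathcal{L}(X_1,\dots,X_r)\}$. $\mathcal{L}(\xi):=\mathcal{L}(X_1,\dots,X_{m+1-l})$ for any basis $X_1,\dots,X_{m+1-l}$ of local sections of $\xi$ near $p_0$ (it is independent of the basis). *)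

theory Defs
  imports "HOL-Analysis.Analysis"
begin

subsection \<open>Smooth maps between normed spaces\<close>

fun Ck_on :: "nat \<Rightarrow> 'a::real_normed_vector set \<Rightarrow> ('a \<Rightarrow> 'b::real_normed_vector) \<Rightarrow> bool" where
  "Ck_on 0 S f \<longleftrightarrow> continuous_on S f"
| "Ck_on (Suc k) S f \<longleftrightarrow> (\<forall>x\<in>S. f differentiable (at x)) \<and>
     (\<forall>v. Ck_on k S (\<lambda>x. frechet_derivative f (at x) v))"

text \<open>Only used for open \<open>S\<close>.\<close>
definition smooth_on :: "'a::real_normed_vector set \<Rightarrow> ('a \<Rightarrow> 'b::real_normed_vector) \<Rightarrow> bool" where
  "smooth_on S f \<longleftrightarrow> (\<forall>k. Ck_on k S f)"


subsection \<open>Smooth manifolds\<close>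

text \<open>A chart is a pair of its domain and its coordinate map. The dimension is \<open>CARD('n)\<close>.
  The atlas need not be maximal; a maximal one is allowed.\<close>

type_synonym ('a, 'n) chart = "'a set \<times> ('a \<Rightarrow> real^'n)"

abbreviation chart_dom :: "('a, 'n::finite) chart \<Rightarrow> 'a set" where
  "chart_dom c \<equiv> fst c"

abbreviation coord :: "('a, 'n::finite) chart \<Rightarrow> 'a \<Rightarrow> real^'n" where
  "coord c \<equiv> snd c"

definition chart_inv :: "('a, 'n::finite) chart \<Rightarrow> real^'n \<Rightarrow> 'a" where
  "chart_inv c = inv_into (chart_dom c) (coord c)"

definition is_chart :: "'a topology \<Rightarrow> ('a, 'n::finite) chart \<Rightarrow> bool" where
  "is_chart M c \<longleftrightarrow> openin M (chart_dom c) \<and> open (coord c ` chart_dom c) \<and>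
     homeomorphic_map (subtopology M (chart_dom c)) (top_of_set (coord c ` chart_dom c)) (coord c)"

definition transition :: "('a, 'n::finite) chart \<Rightarrow> ('a, 'n) chart \<Rightarrow> real^'n \<Rightarrow> real^'n" where
  "transition c d = coord d \<circ> chart_inv c"

definition smooth_manifold :: "'a topology \<Rightarrow> ('a, 'n::finite) chart set \<Rightarrow> bool" where
  "smooth_manifold M A \<longleftrightarrow>
     Hausdorff_space M \<and> second_countable M \<and>
     (\<forall>c\<in>A. is_chart M c) \<and> topspace M = (\<Union>c\<in>A. chart_dom c) \<and>
     (\<forall>c\<in>A. \<forall>d\<in>A. smooth_on (coord c ` (chart_dom c \<inter> chart_dom d)) (transition c d))"

text \<open>A function on a manifold, expressed in the coordinates of a chart.\<close>
definition in_chart :: "('a, 'n::finite) chart \<Rightarrow> ('a \<Rightarrow> real) \<Rightarrow> real^'n \<Rightarrow> real" where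
  "in_chart c f = f \<circ> chart_inv c"

definition smooth_function :: "('a, 'n::finite) chart set \<Rightarrow> 'a set \<Rightarrow> ('a \<Rightarrow> real) \<Rightarrow> bool" where
  "smooth_function A U f \<longleftrightarrow> (\<forall>c\<in>A. smooth_on (coord c ` (chart_dom c \<inter> U)) (in_chart c f))"


subsection \<open>Tensors in coordinates\<close>

text \<open>In a chart, tangent vectors and covectors are both represented by their components in
  \<open>real^'n\<close>; a covector \<open>\<omega>\<close> acts on a tangent vector \<open>v\<close> by \<open>\<omega> \<bullet> v\<close>. The vector
  \<open>differential f x\<close> consists of the first partial derivatives of \<open>f\<close>, that is, of the
  components of \<open>df\<close>.\<close>

definition differential :: "(real^'n::finite \<Rightarrow> real) \<Rightarrow> real^'n \<Rightarrow> real^'n" where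
  "differential f x = (\<chi> i. frechet_derivative f (at x) (axis i 1))"

text \<open>A possibly degenerate inner product on covectors is given by a symmetric positive
  semidefinite matrix \<open>G\<close>.\<close>

definition coinner :: "real^'n::finite^'n \<Rightarrow> real^'n \<Rightarrow> real^'n \<Rightarrow> real" where
  "coinner G \<omega> \<eta> = \<omega> \<bullet> (G *v \<eta>)"

definition conorm :: "real^'n::finite^'n \<Rightarrow> real^'n \<Rightarrow> real" where
  "conorm G \<omega> = sqrt (coinner G \<omega> \<omega>)"

definition sharp :: "real^'n::finite^'n \<Rightarrow> real^'n \<Rightarrow> real^'n" where
  "sharp G \<eta> = G *v \<eta>"

lemma sharp_unique: "(\<forall>\<omega>. \<omega> \<bullet> v = coinner G \<omega> \<eta>) \<longleftrightarrow> v = sharp G \<eta>"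
  unfolding coinner_def sharp_def by (metis vector_eq_rdot inner_commute)

definition horizontal :: "real^'n::finite^'n \<Rightarrow> (real^'n) set" where
  "horizontal G = range (sharp G)"

text \<open>Alternating \<open>k\<close>-forms at a point: functions of lists of \<open>k\<close> tangent vectors, extended by
  zero to lists of other lengths.\<close>

definition alternating_form :: "nat \<Rightarrow> ((real^'n::finite) list \<Rightarrow> real) \<Rightarrow> bool" where
  "alternating_form k \<alpha> \<longleftrightarrow>
     (\<forall>vs. length vs \<noteq> k \<longrightarrow> \<alpha> vs = 0) \<and>
     (\<forall>vs i. length vs = k \<and> i < k \<longrightarrow> linear (\<lambda>v. \<alpha> (vs[i := v]))) \<and>
     (\<forall>vs i j. length vs = k \<and> i < j \<and> j < k \<and> vs ! i = vs ! j \<longrightarrow> \<alpha> vs = 0)"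

definition omit :: "nat \<Rightarrow> 'b list \<Rightarrow> 'b list" where
  "omit i vs = take i vs @ drop (Suc i) vs"

text \<open>The wedge product \<open>\<eta> \<and> \<alpha>\<close> of a covector \<open>\<eta>\<close> with a form \<open>\<alpha>\<close>.\<close>
definition wedge1 :: "real^'n::finite \<Rightarrow> ((real^'n) list \<Rightarrow> real) \<Rightarrow> (real^'n) list \<Rightarrow> real" where
  "wedge1 \<eta> \<alpha> vs = (\<Sum>i<length vs. (-1) ^ i * (\<eta> \<bullet> vs ! i) * \<alpha> (omit i vs))"

text \<open>The exterior derivative, evaluated on constant coordinate vector fields, so that the
  Lie bracket terms of the invariant formula vanish. It is normalised like \<^const>\<open>wedge1\<close>:
  \<open>d (f \<alpha>) = df \<and> \<alpha>\<close> for constant \<open>\<alpha>\<close>.\<close>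
definition ext_deriv ::
  "(real^'n::finite \<Rightarrow> (real^'n) list \<Rightarrow> real) \<Rightarrow> real^'n \<Rightarrow> (real^'n) list \<Rightarrow> real" where
  "ext_deriv \<alpha> x vs =
     (\<Sum>i<length vs. (-1) ^ i * frechet_derivative (\<lambda>y. \<alpha> y (omit i vs)) (at x) (vs ! i))"

text \<open>\<open>\<omega> \<lrcorner> dv\<close> for a top-degree form \<open>dv\<close>; it equals \<open>\<lambda>vs. dv (sharp G \<omega> # vs)\<close>.\<close>
definition contraction ::
  "real^'n::finite^'n \<Rightarrow> real^'n \<Rightarrow> ((real^'n) list \<Rightarrow> real) \<Rightarrow> (real^'n) list \<Rightarrow> real" where
  "contraction G \<omega> dv = (THE \<alpha>. alternating_form (CARD('n) - 1) \<alpha> \<and>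
     (\<forall>\<eta> vs. length vs = CARD('n) \<longrightarrow> wedge1 \<eta> \<alpha> vs = coinner G \<eta> \<omega> * dv vs))"


subsection \<open>Subriemannian structure and volume form\<close>

text \<open>Tensor fields on the manifold are families of component functions, one for each chart of
  the atlas, related by the transformation laws of a contravariant 2-tensor and of a
  differential form, respectively.\<close>

definition subriemannian_metric ::
  "('a, 'n::finite) chart set \<Rightarrow> (('a, 'n) chart \<Rightarrow> real^'n \<Rightarrow> real^'n^'n) \<Rightarrow> bool" where
  "subriemannian_metric A g \<longleftrightarrow>
     (\<forall>c\<in>A. smooth_on (coord c ` chart_dom c) (g c) \<and>
        (\<forall>x\<in>coord c ` chart_dom c. transpose (g c x) = g c x \<and> (\<forall>\<omega>. 0 \<le> coinner (g c x) \<omega> \<omega>))) \<and>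
     (\<forall>c\<in>A. \<forall>d\<in>A. \<forall>x\<in>coord c ` (chart_dom c \<inter> chart_dom d).
        let J = jacobian (transition c d) (at x)
        in g d (transition c d x) = J ** g c x ** transpose J)"

definition volume_form ::
  "('a, 'n::finite) chart set \<Rightarrow> (('a, 'n) chart \<Rightarrow> real^'n \<Rightarrow> (real^'n) list \<Rightarrow> real) \<Rightarrow> bool" where
  "volume_form A dv \<longleftrightarrow>
     (\<forall>c\<in>A. (\<forall>vs. smooth_on (coord c ` chart_dom c) (\<lambda>x. dv c x vs)) \<and>
        (\<forall>x\<in>coord c ` chart_dom c. alternating_form CARD('n) (dv c x) \<and> (\<exists>vs. dv c x vs \<noteq> 0))) \<and>
     (\<forall>c\<in>A. \<forall>d\<in>A. \<forall>x\<in>coord c ` (chart_dom c \<inter> chart_dom d). \<forall>vs.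
        dv c x vs =
        dv d (transition c d x) (map (frechet_derivative (transition c d) (at x)) vs))"


subsection \<open>Hypersurfaces\<close>

definition defining_function ::
  "('a, 'n::finite) chart set \<Rightarrow> 'a set \<Rightarrow> ('a \<Rightarrow> real) \<Rightarrow> bool" where
  "defining_function A U f \<longleftrightarrow> smooth_function A U f \<and>
     (\<forall>c\<in>A. \<forall>q\<in>chart_dom c \<inter> U. differential (in_chart c f) (coord c q) \<noteq> 0)"

definition hypersurface :: "'a set \<Rightarrow> ('a \<Rightarrow> real) \<Rightarrow> 'a set" where
  "hypersurface U f = {q \<in> U. f q = 0}"

text \<open>The tangent space of a hypersurface \<open>{f = 0}\<close> at a point with coordinates \<open>x\<close>.\<close>
definition hypersurface_tangent_space :: "(real^'n::finite \<Rightarrow> real) \<Rightarrow> real^'n \<Rightarrow> (real^'n) set" where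
  "hypersurface_tangent_space f x = {v. differential f x \<bullet> v = 0}"

text \<open>The function \<open>H\<^bsub>f,p\<^esub>\<close> in coordinates. All ingredients are natural under changes of
  coordinates, so its value at a point of the manifold does not depend on the chart.\<close>
definition mean_curvature ::
  "(real^'n::finite \<Rightarrow> real^'n^'n) \<Rightarrow> (real^'n \<Rightarrow> (real^'n) list \<Rightarrow> real) \<Rightarrow> real \<Rightarrow>
     (real^'n \<Rightarrow> real) \<Rightarrow> real^'n \<Rightarrow> real" where
  "mean_curvature G dv p f x = (THE h. \<forall>vs. length vs = CARD('n) \<longrightarrow>
     ext_deriv (\<lambda>y. contraction (G y)
         ((1 / conorm (G y) (differential f y) powr (1 - p)) *\<^sub>R differential f y) (dv y)) x vs
     = h * dv x vs)"


subsection \<open>Lie brackets and rank\<close>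

definition lie_bracket ::
  "(real^'n::finite \<Rightarrow> real^'n) \<Rightarrow> (real^'n \<Rightarrow> real^'n) \<Rightarrow> real^'n \<Rightarrow> real^'n" where
  "lie_bracket X Y x = frechet_derivative Y (at x) (X x) - frechet_derivative X (at x) (Y x)"

text \<open>\<open>lie_module V F\<close> is the smallest module over the smooth functions on \<open>V\<close> that contains
  \<open>F\<close> and is closed under Lie brackets. A family \<open>X\<^sub>1, \<dots>, X\<^sub>r\<close> of vector fields is indexed
  from zero: \<open>X 0, \<dots>, X (r - 1)\<close>.\<close>

inductive_set lie_module ::
  "(real^'n::finite) set \<Rightarrow> (real^'n \<Rightarrow> real^'n) set \<Rightarrow> (real^'n \<Rightarrow> real^'n) set"
  for V F where
  generator: "X \<in> F \<Longrightarrow> X \<in> lie_module V F"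
| zero: "(\<lambda>_. 0) \<in> lie_module V F"
| add: "\<lbrakk>X \<in> lie_module V F; Y \<in> lie_module V F\<rbrakk> \<Longrightarrow> (\<lambda>x. X x + Y x) \<in> lie_module V F"
| scale: "\<lbrakk>smooth_on V f; X \<in> lie_module V F\<rbrakk> \<Longrightarrow> (\<lambda>x. f x *\<^sub>R X x) \<in> lie_module V F"
| bracket: "\<lbrakk>X \<in> lie_module V F; Y \<in> lie_module V F\<rbrakk> \<Longrightarrow> lie_bracket X Y \<in> lie_module V F"

definition lie_rank ::
  "(real^'n::finite) set \<Rightarrow> nat \<Rightarrow> (nat \<Rightarrow> real^'n \<Rightarrow> real^'n) \<Rightarrow> real^'n \<Rightarrow> nat" where
  "lie_rank V r X x = dim {Z x | Z. Z \<in> lie_module V (X ` {..<r})}"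

definition independent_sections ::
  "(real^'n::finite \<Rightarrow> real^'n^'n) \<Rightarrow> (real^'n) set \<Rightarrow> nat \<Rightarrow>
     (nat \<Rightarrow> real^'n \<Rightarrow> real^'n) \<Rightarrow> bool" where
  "independent_sections G V r X \<longleftrightarrow>
     (\<forall>i<r. smooth_on V (X i) \<and> (\<forall>x\<in>V. X i x \<in> horizontal (G x))) \<and>
     (\<forall>x\<in>V. inj_on (\<lambda>i. X i x) {..<r} \<and> independent ((\<lambda>i. X i x) ` {..<r}))"

definition basis_sections ::
  "(real^'n::finite \<Rightarrow> real^'n^'n) \<Rightarrow> (real^'n) set \<Rightarrow> nat \<Rightarrow>
     (nat \<Rightarrow> real^'n \<Rightarrow> real^'n) \<Rightarrow> bool" where
  "basis_sections G V r X \<longleftrightarrow> independent_sections G V r X \<and>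
     (\<forall>x\<in>V. span ((\<lambda>i. X i x) ` {..<r}) = horizontal (G x))"

end

theory Submission
  imports Defs
begin

text \<open>The function \<open>u = \<psi> - \<phi>\<close> is nonnegative, vanishes at \<open>p\<^sub>0\<close> and satisfies near \<open>p\<^sub>0\<close> a linear
  differential inequality whose second-order coefficients \<open>a\<close> form the derivative of
  \<open>|\<omega>|\<^sub>*\<^sup>p\<^sup>-\<^sup>1 G \<omega>\<close> with respect to \<open>\<omega>\<close> at \<open>\<omega> = d\<phi>\<close>. Hopf's barrier shows that \<open>a\<close> annihilates every exterior
  normal (in the sense of Bony) of the closed set \<open>{u = 0}\<close>. Hence sections of \<open>\<xi>\<close> (if \<open>p > 0\<close>), or of
  \<open>\<xi> \<inter> ker d\<phi>\<close> (if \<open>p \<ge> 0\<close>), are tangent to \<open>{u = 0}\<close>. Tangency to a closed set is inherited by Lie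
  brackets. Under the rank condition in (b) there is then no nonzero exterior normal, so
  \<open>{u = 0}\<close> is a neighbourhood of \<open>p\<^sub>0\<close>; under the one in (a) all exterior normals are multiples of
  \<open>d\<phi>\<close>, so \<open>{u = 0}\<close> contains the level set of \<open>\<phi>\<close> through \<open>p\<^sub>0\<close>.\<close>


subsection \<open>Calculus of smooth maps\<close>

text \<open>The coefficients are frozen at d\<phi>. Their discrepancy with those at d\<psi> is
  Lipschitz in d\<psi> - d\<phi> and multiplies second derivatives of \<psi>, which are locally
  bounded, so it joins the first-order terms. With N the squared norm of \<omega>, the form of
  \<open>a\<close> at w is a positive factor times N <G w, w> + (p - 1) <\<omega>, G w>^2. By
  Cauchy-Schwarz it is nonnegative for p >= 0. Its kernel is that of G when p > 0, but for p = 0 it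
  also contains \<omega>; this is why only sections annihilated by d\<phi> are available in (a). The
  obstacle in (a) is to keep iterated brackets inside the kernel of d\<phi>. The level sets of
  \<phi> are therefore treated as closed sets in their own right: the same sections are tangent to
  them, brackets inherit this, and the rank condition makes the module fill the kernel of d\<phi> at
  each point. The set {u = 0} has no regularity, so the distance to it is only ever estimated
  through nearest points.\<close>

lemma Ck_on_SucI:
  fixes f :: "'a::real_normed_vector \<Rightarrow> 'b::real_normed_vector"
  assumes "open S" "\<And>x. x \<in> S \<Longrightarrow> (f has_derivative f' x) (at x)"
    and "\<And>v. Ck_on k S (\<lambda>x. f' x v)"
    and cong: "\<And>f g :: 'a \<Rightarrow> 'b. (\<And>x. x \<in> S \<Longrightarrow> f x = g x) \<Longrightarrow> Ck_on k S f \<Longrightarrow> Ck_on k S g"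
  shows "Ck_on (Suc k) S f"
proof -
  have "frechet_derivative f (at x) = f' x" if "x \<in> S" for x
    using frechet_derivative_at[OF assms(2)[OF that]] by simp
  then have "Ck_on k S (\<lambda>x. frechet_derivative f (at x) v)" for v
    by (intro cong[OF _ assms(3)[of v]]) auto
  moreover have "f differentiable (at x)" if "x \<in> S" for x
    using assms(2)[OF that] differentiable_def by blast
  ultimately show ?thesis by simp
qed

text \<open>\<open>Ck_on_SucI\<close> takes congruence at level \<open>k\<close> as an assumption
  because this induction is what supplies it, level by level; afterwards \<open>Ck_onI_deriv\<close>
  is the rule to use. Openness of \<open>S\<close> lets derivatives at points of \<open>S\<close>
  ignore the values outside.\<close>

lemma Ck_on_cong:
  assumes "open S" "\<And>x. x \<in> S \<Longrightarrow> f x = g x" "Ck_on k S f"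
  shows "Ck_on k S g"
  using assms(2,3)
proof (induction k arbitrary: f g)
  case 0
  then show ?case using continuous_on_cong[of S S f g] by simp
next
  case (Suc k)
  show ?case
  proof (rule Ck_on_SucI[where f' = "\<lambda>x. frechet_derivative f (at x)"])
    fix x assume x: "x \<in> S"
    then have "(f has_derivative frechet_derivative f (at x)) (at x)"
      using Suc.prems(2) frechet_derivative_works by auto
    then show "(g has_derivative frechet_derivative f (at x)) (at x)"
      using has_derivative_transform_within_open[OF _ assms(1) x] Suc.prems(1) by blast
  next
    show "Ck_on k S (\<lambda>x. frechet_derivative f (at x) v)" for v
      using Suc.prems(2) by simp
  qed (use Suc assms in \<open>blast+\<close>)
qed

lemma Ck_onI_deriv:
  assumes "open S" "\<And>x. x \<in> S \<Longrightarrow> (f has_derivative f' x) (at x)"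
    and "\<And>v. Ck_on k S (\<lambda>x. f' x v)"
  shows "Ck_on (Suc k) S f"
  using Ck_on_SucI[OF assms] Ck_on_cong[OF assms(1)] by blast

lemma Ck_on_has_derivative:
  "Ck_on (Suc k) S f \<Longrightarrow> x \<in> S \<Longrightarrow> (f has_derivative frechet_derivative f (at x)) (at x)"
  using frechet_derivative_works by auto

lemma Ck_on_Suc_lower: "Ck_on (Suc k) S f \<Longrightarrow> Ck_on k S f"
proof (induction k arbitrary: f)
  case 0
  then have "\<forall>x\<in>S. f differentiable (at x)" by simp
  then show ?case
    by (auto intro!: continuous_at_imp_continuous_on differentiable_imp_continuous_within)
next
  case (Suc k)
  then show ?case by (metis Ck_on.simps(2))
qed

lemma Ck_on_subset: "Ck_on k S f \<Longrightarrow> T \<subseteq> S \<Longrightarrow> Ck_on k T f"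
proof (induction k arbitrary: f)
  case (Suc k)
  then show ?case by (meson Ck_on.simps(2) subsetD)
qed (auto intro: continuous_on_subset)

lemma Ck_on_const: "open S \<Longrightarrow> Ck_on k S (\<lambda>x. c)"
proof (induction k arbitrary: c)
  case (Suc k)
  then show ?case by (intro Ck_onI_deriv[where f' = "\<lambda>x v. 0"]) auto
qed auto

lemma Ck_on_add:
  assumes "open S"
  shows "Ck_on k S f \<Longrightarrow> Ck_on k S g \<Longrightarrow> Ck_on k S (\<lambda>x. f x + g x)"
proof (induction k arbitrary: f g)
  case (Suc k)
  show ?case
  proof (rule Ck_onI_deriv[OF assms, where f' = "\<lambda>x v. frechet_derivative f (at x) v + frechet_derivative g (at x) v"])
    show "Ck_on k S (\<lambda>x. frechet_derivative f (at x) v + frechet_derivative g (at x) v)" for v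
      using Suc by simp
  qed (use Suc.prems Ck_on_has_derivative has_derivative_add in blast)
qed (auto intro: continuous_on_add)

lemma Ck_on_bilinear:
  assumes "open S" and P: "bounded_bilinear P"
  shows "Ck_on k S f \<Longrightarrow> Ck_on k S g \<Longrightarrow> Ck_on k S (\<lambda>x. P (f x) (g x))"
proof (induction k arbitrary: f g)
  case 0
  then show ?case using bounded_bilinear.continuous_on[OF P] by simp
next
  case (Suc k)
  show ?case
  proof (rule Ck_onI_deriv[OF assms(1), where f' = "\<lambda>x v. P (f x) (frechet_derivative g (at x) v) +
        P (frechet_derivative f (at x) v) (g x)"])
    show "Ck_on k S (\<lambda>x. P (f x) (frechet_derivative g (at x) v) +
        P (frechet_derivative f (at x) v) (g x))" for v
      using Suc.prems
      by (intro Ck_on_add[OF assms(1)] Suc.IH) (auto dest: Ck_on_Suc_lower simp del: Ck_on.simps,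
          auto)
    show "((\<lambda>x. P (f x) (g x)) has_derivative
        (\<lambda>v. P (f x) (frechet_derivative g (at x) v) + P (frechet_derivative f (at x) v) (g x))) (at x)"
      if "x \<in> S" for x
      using Suc.prems that by (intro bounded_bilinear.FDERIV[OF P] Ck_on_has_derivative)
  qed
qed

lemma Ck_on_bounded_linear:
  assumes "open S" and L: "bounded_linear L"
  shows "Ck_on k S f \<Longrightarrow> Ck_on k S (\<lambda>x. L (f x))"
proof (induction k arbitrary: f)
  case 0
  then show ?case using bounded_linear.continuous_on[OF L] by simp
next
  case (Suc k)
  show ?case
  proof (rule Ck_onI_deriv[OF assms(1), where f' = "\<lambda>x v. L (frechet_derivative f (at x) v)"])
    show "Ck_on k S (\<lambda>x. L (frechet_derivative f (at x) v))" for v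
      using Suc by simp
  qed (use Suc.prems Ck_on_has_derivative bounded_linear.has_derivative[OF L] in blast)
qed

lemma Ck_on_compose_linear:
  assumes "open S" "open T" and L: "bounded_linear L" and ST: "L ` S \<subseteq> T"
  shows "Ck_on k T f \<Longrightarrow> Ck_on k S (\<lambda>x. f (L x))"
proof (induction k arbitrary: f)
  case 0
  then show ?case
    using ST linear_continuous_on[OF L, of S]
    by (auto intro: continuous_on_compose2[of T f S L])
next
  case (Suc k)
  show ?case
  proof (rule Ck_onI_deriv[OF assms(1), where f' = "\<lambda>x v. frechet_derivative f (at (L x)) (L v)"])
    fix x assume "x \<in> S"
    then have "(f has_derivative frechet_derivative f (at (L x))) (at (L x))"
      using ST Suc.prems Ck_on_has_derivative by blast
    then show "((\<lambda>x. f (L x)) has_derivative (\<lambda>v. frechet_derivative f (at (L x)) (L v))) (at x)"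
      using has_derivative_compose[OF bounded_linear.has_derivative[OF L has_derivative_ident]]
      by fast
  next
    show "Ck_on k S (\<lambda>x. frechet_derivative f (at (L x)) (L v))" for v
      using Suc.IH[of "\<lambda>y. frechet_derivative f (at y) (L v)"] Suc.prems by simp
  qed
qed

lemma Ck_on_powr:
  fixes f :: "'a::real_normed_vector \<Rightarrow> real"
  assumes "open S"
  shows "Ck_on k S f \<Longrightarrow> (\<And>x. x \<in> S \<Longrightarrow> f x > 0) \<Longrightarrow> Ck_on k S (\<lambda>x. f x powr q)"
proof (induction k arbitrary: q)
  case 0
  then show ?case by (force intro!: continuous_on_powr continuous_on_const)
next
  case (Suc k)
  show ?case
  proof (rule Ck_onI_deriv[OF assms])
    fix x assume x: "x \<in> S"
    have "(f has_derivative frechet_derivative f (at x)) (at x)"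
      using Suc.prems x Ck_on_has_derivative by blast
    from has_derivative_powr[OF this has_derivative_const, of q] Suc.prems(2)[OF x]
    show "((\<lambda>x. f x powr q) has_derivative
        (\<lambda>v. q * (f x powr (q - 1) * frechet_derivative f (at x) v))) (at x)"
      by (simp add: field_simps powr_diff)
  next
    show "Ck_on k S (\<lambda>x. q * (f x powr (q - 1) * frechet_derivative f (at x) v))" for v
      by (intro Ck_on_bilinear[OF assms bounded_bilinear_mult] Ck_on_const assms Suc.IH)
        (use Suc.prems in \<open>auto dest: Ck_on_Suc_lower simp del: Ck_on.simps\<close>, auto)
  qed
qed

section \<open>Closure properties of smooth maps\<close>

lemma smooth_on_cong: "open S \<Longrightarrow> (\<And>x. x \<in> S \<Longrightarrow> f x = g x) \<Longrightarrow> smooth_on S f \<Longrightarrow> smooth_on S g"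
  unfolding smooth_on_def using Ck_on_cong by blast

lemma smooth_on_subset: "smooth_on S f \<Longrightarrow> T \<subseteq> S \<Longrightarrow> smooth_on T f"
  unfolding smooth_on_def using Ck_on_subset by blast

lemma smooth_on_const: "open S \<Longrightarrow> smooth_on S (\<lambda>x. c)"
  unfolding smooth_on_def using Ck_on_const by blast

lemma smooth_on_add: "open S \<Longrightarrow> smooth_on S f \<Longrightarrow> smooth_on S g \<Longrightarrow> smooth_on S (\<lambda>x. f x + g x)"
  unfolding smooth_on_def using Ck_on_add by blast

lemma smooth_on_bilinear:
  "bounded_bilinear P \<Longrightarrow> open S \<Longrightarrow> smooth_on S f \<Longrightarrow> smooth_on S g \<Longrightarrow> smooth_on S (\<lambda>x. P (f x) (g x))"
  unfolding smooth_on_def using Ck_on_bilinear by blast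

lemmas smooth_on_scaleR = smooth_on_bilinear[OF bounded_bilinear_scaleR]
lemmas smooth_on_mult = smooth_on_bilinear[OF bounded_bilinear_mult]
lemmas smooth_on_inner = smooth_on_bilinear[OF bounded_bilinear_inner]

lemma smooth_on_bounded_linear:
  "bounded_linear L \<Longrightarrow> open S \<Longrightarrow> smooth_on S f \<Longrightarrow> smooth_on S (\<lambda>x. L (f x))"
  unfolding smooth_on_def using Ck_on_bounded_linear by blast

lemma smooth_on_compose_linear:
  "bounded_linear L \<Longrightarrow> open S \<Longrightarrow> open T \<Longrightarrow> L ` S \<subseteq> T \<Longrightarrow> smooth_on T f \<Longrightarrow> smooth_on S (\<lambda>x. f (L x))"
  unfolding smooth_on_def using Ck_on_compose_linear by blast

lemma smooth_on_powr:
  fixes f :: "'a::real_normed_vector \<Rightarrow> real"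
  shows "open S \<Longrightarrow> smooth_on S f \<Longrightarrow> (\<And>x. x \<in> S \<Longrightarrow> f x > 0) \<Longrightarrow> smooth_on S (\<lambda>x. f x powr q)"
  unfolding smooth_on_def using Ck_on_powr by blast

lemma smooth_on_ident: "open S \<Longrightarrow> smooth_on S (\<lambda>x. x)"
proof -
  assume S: "open S"
  have "Ck_on k S (\<lambda>x. x)" for k
    by (cases k) (auto intro!: Ck_onI_deriv[where f' = "\<lambda>x v. v"] Ck_on_const S simp del: Ck_on.simps(2))
  then show ?thesis by (simp add: smooth_on_def)
qed

lemma smooth_on_diff:
  "open S \<Longrightarrow> smooth_on S f \<Longrightarrow> smooth_on S g \<Longrightarrow> smooth_on S (\<lambda>x. f x - g x)"
  using smooth_on_add[of S f "\<lambda>x. - g x"]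
    smooth_on_bounded_linear[OF bounded_linear_minus[OF bounded_linear_ident], of S g]
  by simp

lemma smooth_on_sum:
  "open S \<Longrightarrow> (\<And>i. i \<in> I \<Longrightarrow> smooth_on S (f i)) \<Longrightarrow> smooth_on S (\<lambda>x. \<Sum>i\<in>I. f i x)"
  by (induction I rule: infinite_finite_induct) (auto intro: smooth_on_const smooth_on_add)

lemma smooth_on_has_derivative:
  "smooth_on S f \<Longrightarrow> x \<in> S \<Longrightarrow> (f has_derivative frechet_derivative f (at x)) (at x)"
  unfolding smooth_on_def using Ck_on_has_derivative by blast

lemma smooth_on_frechet_derivative: "smooth_on S f \<Longrightarrow> smooth_on S (\<lambda>x. frechet_derivative f (at x) v)"
  unfolding smooth_on_def using Ck_on.simps(2) by blast

lemma smooth_on_continuous: "smooth_on S f \<Longrightarrow> continuous_on S f"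
  unfolding smooth_on_def by (meson Ck_on.simps(1))

lemma smooth_on_linear_frechet: "smooth_on S f \<Longrightarrow> x \<in> S \<Longrightarrow> linear (frechet_derivative f (at x))"
  using smooth_on_has_derivative has_derivative_linear by blast

section \<open>Lipschitz and Taylor estimates on compact convex sets\<close>

lemma linear_norm_le_sum_Basis:
  fixes h :: "'a::euclidean_space \<Rightarrow> 'b::real_normed_vector"
  assumes "linear h"
  shows "norm (h v) \<le> (\<Sum>i\<in>Basis. norm (h i)) * norm v"
proof -
  have "h v = h (\<Sum>i\<in>Basis. (v \<bullet> i) *\<^sub>R i)" by (simp add: euclidean_representation)
  also have "\<dots> = (\<Sum>i\<in>Basis. (v \<bullet> i) *\<^sub>R h i)"
    using assms by (simp add: linear_sum linear_cmul)
  also have "norm \<dots> \<le> (\<Sum>i\<in>Basis. norm (h i) * norm v)"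
    by (intro sum_norm_le) (simp add: mult.commute[of "norm (h _)"] Basis_le_norm mult_right_mono)
  finally show ?thesis by (simp add: sum_distrib_right)
qed

text \<open>\<open>smooth_on\<close> controls directional derivatives, so the operator norm is
  dominated by the sum of their norms over a basis. That sum is continuous, hence bounded on the
  compact set, and convexity admits the mean value inequality.\<close>

lemma smooth_on_lipschitz:
  fixes f :: "'a::euclidean_space \<Rightarrow> 'b::real_normed_vector"
  assumes f: "smooth_on S f" and K: "compact K" "convex K" "K \<subseteq> S"
  obtains L where "L \<ge> 0" "\<And>x y. x \<in> K \<Longrightarrow> y \<in> K \<Longrightarrow> norm (f x - f y) \<le> L * norm (x - y)"
proof -
  let ?h = "\<lambda>x. \<Sum>i\<in>Basis. norm (frechet_derivative f (at x) i)"
  have "continuous_on K ?h"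
    by (intro continuous_intros continuous_on_subset[OF smooth_on_continuous[OF smooth_on_frechet_derivative[OF f]] K(3)])
  then have "bounded (?h ` K)"
    using K compact_continuous_image compact_imp_bounded by blast
  then obtain L where "\<forall>r\<in>?h ` K. norm r \<le> L" unfolding bounded_iff by (rule exE)
  then have L: "?h x \<le> L" if "x \<in> K" for x
    using that abs_le_D1 by auto
  have "norm (f x - f y) \<le> max L 0 * norm (x - y)" if "x \<in> K" "y \<in> K" for x y
  proof (rule differentiable_bound[OF K(2) _ _ that])
    fix z assume z: "z \<in> K"
    then show "(f has_derivative frechet_derivative f (at z)) (at z within K)"
      using smooth_on_has_derivative[OF f] K(3) has_derivative_at_withinI by blast
    have "linear (frechet_derivative f (at z))"
      using z K(3) smooth_on_linear_frechet[OF f] by blast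
    then have "norm (frechet_derivative f (at z) v) \<le> ?h z * norm v" for v
      by (rule linear_norm_le_sum_Basis)
    also have "?h z * norm v \<le> max L 0 * norm v" for v :: 'a
      using L[OF z] by (intro mult_right_mono) auto
    finally show "onorm (frechet_derivative f (at z)) \<le> max L 0"
      by (rule onorm_le)
  qed
  then show ?thesis using that[of "max L 0"] by simp
qed

text \<open>The mean value inequality is applied to \<open>f\<close> minus its linear part at
  \<open>z\<close>. On the segment the derivative of this difference is at most
  \<open>Q * norm (y - z)\<close>, because first derivatives are Lipschitz.\<close>

lemma smooth_on_taylor2:
  fixes f :: "'a::euclidean_space \<Rightarrow> 'b::real_normed_vector"
  assumes f: "smooth_on S f" and K: "compact K" "convex K" "K \<subseteq> S" and z: "z \<in> K"
  obtains Q where "Q \<ge> 0"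
    "\<And>y. y \<in> K \<Longrightarrow> norm (f y - f z - frechet_derivative f (at z) (y - z)) \<le> Q * (norm (y - z))\<^sup>2"
proof -
  let ?D = "\<lambda>x. frechet_derivative f (at x)"
  have "\<exists>L\<ge>0. \<forall>x\<in>K. norm (?D x i - ?D z i) \<le> L * norm (x - z)" for i
    using smooth_on_lipschitz[OF smooth_on_frechet_derivative[OF f] K, of i] z by metis
  then obtain L where L: "\<And>i. L i \<ge> 0" "\<And>i x. x \<in> K \<Longrightarrow> norm (?D x i - ?D z i) \<le> L i * norm (x - z)"
    by metis
  define Q where "Q = (\<Sum>i\<in>Basis. L i)"
  have Q: "Q \<ge> 0" unfolding Q_def using L by (simp add: sum_nonneg)
  have lin: "linear (?D x)" if "x \<in> K" for x
    using that K(3) smooth_on_linear_frechet[OF f] by blast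
  have "norm (f y - f z - ?D z (y - z)) \<le> Q * (norm (y - z))\<^sup>2" if y: "y \<in> K" for y
  proof -
    let ?S = "closed_segment z y"
    have sub: "?S \<subseteq> K" using K(2) z y by (simp add: closed_segment_subset)
    have "norm ((f y - ?D z y) - (f z - ?D z z)) \<le> (Q * norm (y - z)) * norm (y - z)"
    proof (rule differentiable_bound[where f' = "\<lambda>x v. ?D x v - ?D z v" and S = ?S])
      fix x assume x: "x \<in> ?S"
      then have xK: "x \<in> K" using sub by blast
      have "(f has_derivative ?D x) (at x within ?S)"
        using smooth_on_has_derivative[OF f] K(3) xK has_derivative_at_withinI by blast
      moreover have "(?D z has_derivative ?D z) (at x within ?S)"
        using lin[OF z] by (simp add: linear_imp_has_derivative)
      ultimately show "((\<lambda>y. f y - ?D z y) has_derivative (\<lambda>v. ?D x v - ?D z v)) (at x within ?S)"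
        by (rule has_derivative_diff)
      have "norm (x - z) \<le> norm (y - z)"
        using segment_bound(1)[OF x] by (simp add: norm_minus_commute)
      then have i: "norm (?D x i - ?D z i) \<le> L i * norm (y - z)" for i
        by (meson L(1,2) mult_left_mono order_trans xK)
      have "linear (\<lambda>v. ?D x v - ?D z v)"
        using lin[OF z] lin[OF xK] by (rule linear_compose_sub[rotated])
      then have "norm (?D x v - ?D z v) \<le> (\<Sum>i\<in>Basis. norm (?D x i - ?D z i)) * norm v" for v
        by (rule linear_norm_le_sum_Basis)
      also have "(\<Sum>i\<in>Basis. norm (?D x i - ?D z i)) * norm v \<le> Q * norm (y - z) * norm v" for v :: 'a
        unfolding Q_def sum_distrib_right[of _ _ "norm (y - z)"]
        by (intro mult_right_mono sum_mono i) auto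
      finally show "onorm (\<lambda>v. ?D x v - ?D z v) \<le> Q * norm (y - z)"
        by (rule onorm_le)
    qed auto
    then show ?thesis
      unfolding linear_diff[OF lin[OF z], of y z] by (simp add: power2_eq_square algebra_simps)
  qed
  then show ?thesis using that Q by blast
qed


subsection \<open>Mean curvature as a divergence\<close>

lemma length_omit [simp]: "i < length vs \<Longrightarrow> length (omit i vs) = length vs - 1"
  by (simp add: omit_def)

lemma nth_omit: "i < length vs \<Longrightarrow> j < length vs - 1 \<Longrightarrow> omit i vs ! j = (if j < i then vs ! j else vs ! Suc j)"
  by (auto simp: omit_def nth_append min_def)

lemma omit_update_same: "i < length vs \<Longrightarrow> omit i (vs[i := v]) = omit i vs"
  by (simp add: omit_def)

lemma omit_update:
  assumes "i < length vs" "j < length vs" "i \<noteq> j"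
  shows "omit i (vs[j := v]) = (omit i vs)[(if j < i then j else j - 1) := v]"
  using assms by (intro nth_equalityI) (auto simp: nth_omit nth_list_update)

lemma alternating_linear: "alternating_form k \<alpha> \<Longrightarrow> length vs = k \<Longrightarrow> i < k \<Longrightarrow> linear (\<lambda>v. \<alpha> (vs[i := v]))"
  by (simp add: alternating_form_def)

lemma alternating_repeat:
  "alternating_form k \<alpha> \<Longrightarrow> length vs = k \<Longrightarrow> i < k \<Longrightarrow> j < k \<Longrightarrow> i \<noteq> j \<Longrightarrow> vs ! i = vs ! j \<Longrightarrow> \<alpha> vs = 0"
  unfolding alternating_form_def by (metis linorder_neqE_nat)

text \<open>Polarisation: expand the vanishing value that has the sum of the two entries in both
  places. Vanishing is assumed for this one pair of places, so that the lemma applies before the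
  form is known to be alternating.\<close>

lemma multilinear_swap:
  fixes \<alpha> :: "'a::real_vector list \<Rightarrow> real"
  assumes lin: "\<And>vs i. length vs = k \<Longrightarrow> i < k \<Longrightarrow> linear (\<lambda>v. \<alpha> (vs[i := v]))"
    and ij: "i < k" "j < k" "i \<noteq> j" "length vs = k"
    and rep: "\<And>vs. length vs = k \<Longrightarrow> vs ! i = vs ! j \<Longrightarrow> \<alpha> vs = 0"
  shows "\<alpha> (vs[i := vs ! j, j := vs ! i]) = - \<alpha> vs"
proof -
  define \<beta> where "\<beta> = (\<lambda>x y. \<alpha> (vs[i := x, j := y]))"
  have z: "\<beta> x x = 0" for x
    unfolding \<beta>_def using ij by (intro rep) auto
  have l2: "\<beta> x (y + z) = \<beta> x y + \<beta> x z" for x y z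
    unfolding \<beta>_def using linear_add[OF lin[of "vs[i := x]" j]] ij by simp
  have l1: "\<beta> (x + y) z = \<beta> x z + \<beta> y z" for x y z
    unfolding \<beta>_def using linear_add[OF lin[of "vs[j := z]" i]] ij by (simp add: list_update_swap)
  have "\<beta> (vs ! i + vs ! j) (vs ! i + vs ! j) = 0" by (rule z)
  then have "\<beta> (vs ! j) (vs ! i) = - \<beta> (vs ! i) (vs ! j)"
    using z[of "vs ! i"] z[of "vs ! j"] unfolding l1 l2 by simp
  then show ?thesis unfolding \<beta>_def using ij by simp
qed

lemma alternating_swap:
  assumes "alternating_form k \<alpha>" "i < k" "j < k" "i \<noteq> j" "length vs = k"
  shows "\<alpha> (vs[i := vs ! j, j := vs ! i]) = - \<alpha> vs"
  using assms(2-) alternating_linear[OF assms(1)] alternating_repeat[OF assms(1) _ assms(2-4)]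
  by (intro multilinear_swap) auto

text \<open>Equal entries at distance \<open>d + 1\<close> are brought together by exchanging
  neighbours, each exchange costing only a sign.\<close>

lemma alternating_formI_adjacent:
  assumes len: "\<And>vs. length vs \<noteq> k \<Longrightarrow> \<alpha> vs = 0"
    and lin: "\<And>vs i. length vs = k \<Longrightarrow> i < k \<Longrightarrow> linear (\<lambda>v. \<alpha> (vs[i := v]))"
    and adj: "\<And>vs i. length vs = k \<Longrightarrow> Suc i < k \<Longrightarrow> vs ! i = vs ! Suc i \<Longrightarrow> \<alpha> vs = 0"
  shows "alternating_form k \<alpha>"
proof -
  have "\<alpha> vs = 0" if "length vs = k" "i + d + 1 < k" "vs ! i = vs ! (i + d + 1)" for vs i d
    using that
  proof (induction d arbitrary: vs)
    case 0
    then show ?case using adj by simp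
  next
    case (Suc d)
    define j where "j = i + d + 1"
    let ?ws = "vs[j := vs ! Suc j, Suc j := vs ! j]"
    have "\<alpha> ?ws = - \<alpha> vs"
      using Suc.prems by (intro multilinear_swap[where k = k] lin adj) (auto simp: j_def)
    moreover have "\<alpha> ?ws = 0"
      using Suc.prems by (intro Suc.IH) (auto simp: j_def nth_list_update)
    ultimately show ?case by simp
  qed
  then have "\<alpha> vs = 0" if "length vs = k" "i < j" "j < k" "vs ! i = vs ! j" for vs i j
    using that by (metis Suc_eq_plus1 add_Suc_right less_iff_Suc_add)
  then show ?thesis using len lin by (auto simp: alternating_form_def)
qed

text \<open>Shared core of \<open>wedge1\<close> and \<open>ext_deriv\<close>. If the entries
  \<open>j\<close> and \<open>Suc j\<close> agree, every term that omits neither still contains the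
  repetition, and the two remaining terms differ only in sign.\<close>

lemma alternating_antisymmetrization:
  fixes B :: "real^'n::finite \<Rightarrow> (real^'n) list \<Rightarrow> real"
  assumes alt: "\<And>v. alternating_form (k - 1) (B v)"
    and lin: "\<And>ws. length ws = k - 1 \<Longrightarrow> linear (\<lambda>v. B v ws)"
  shows "alternating_form k (\<lambda>vs. if length vs = k then \<Sum>i<k. (-1) ^ i * B (vs ! i) (omit i vs) else 0)"
proof (rule alternating_formI_adjacent)
  fix vs :: "(real^'n) list" and j assume *: "length vs = k" "j < k"
  have "linear (\<lambda>v. (-1) ^ i * B (vs[j := v] ! i) (omit i (vs[j := v])))" if "i < k" for i
  proof (cases "i = j")
    case True
    then show ?thesis
      using * linear_compose_scale_right[OF lin, of "omit i vs" "(-1) ^ i"] 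
      by (simp add: omit_update_same)
  next
    case False
    then show ?thesis
      using * that linear_compose_scale_right[OF alternating_linear[OF alt], of "omit i vs" "if j < i then j else j - 1" "(-1) ^ i" "vs ! i"]
      by (auto simp: omit_update)
  qed
  then have "linear (\<lambda>v. \<Sum>i<k. (-1) ^ i * B (vs[j := v] ! i) (omit i (vs[j := v])))"
    by (intro linear_compose_sum) auto
  then show "linear (\<lambda>v. if length (vs[j := v]) = k
      then \<Sum>i<k. (-1) ^ i * B (vs[j := v] ! i) (omit i (vs[j := v])) else 0)"
    using * by simp
next
  fix vs :: "(real^'n) list" and j assume *: "length vs = k" "Suc j < k" "vs ! j = vs ! Suc j"
  have z: "B (vs ! i) (omit i vs) = 0" if "i < k" "i \<noteq> j" "i \<noteq> Suc j" for i
  proof (rule alternating_repeat[OF alt, where i = "if j < i then j else j - 1" and j = "if j < i then Suc j else j"])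
  qed (use * that in \<open>auto simp: nth_omit\<close>)
  have eq: "omit j vs = omit (Suc j) vs"
    using * by (intro nth_equalityI) (auto simp: nth_omit less_Suc_eq)
  have "(\<Sum>i<k. (-1) ^ i * B (vs ! i) (omit i vs)) = (\<Sum>i\<in>{j, Suc j}. (-1) ^ i * B (vs ! i) (omit i vs))"
    using * z by (intro sum.mono_neutral_right) auto
  also have "\<dots> = 0" using * eq by simp
  finally show "(if length vs = k then \<Sum>i<k. (-1) ^ i * B (vs ! i) (omit i vs) else 0) = 0" by simp
qed simp

text \<open>Three stages: rearrangements of the basis list are reduced to \<open>e\<close> by
  transpositions, basis lists with a repetition give zero, and linearity frees the arguments one at
  a time.\<close>

lemma alternating_eq_0:
  fixes \<alpha> :: "(real^'n::finite) list \<Rightarrow> real"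
  assumes \<alpha>: "alternating_form CARD('n) \<alpha>" and e: "distinct e" "set e = Basis" and z: "\<alpha> e = 0"
  shows "\<alpha> vs = 0"
proof -
  have le: "length e = CARD('n)" using e distinct_card[of e] by simp
  \<comment> \<open>Backward induction on the length \<open>k\<close> of a prefix shared with
    \<open>e\<close>: at full length \<open>vs\<close> is \<open>e\<close> itself, and one
    transposition lengthens the prefix by one.\<close>
  have perm: "\<alpha> vs = 0" if "distinct vs" "set vs = Basis" "k \<le> CARD('n)" "take k vs = take k e" for vs k
    using that(3,1,2,4)
  proof (induction k arbitrary: vs rule: inc_induct)
    case base
    then have "length vs = CARD('n)" using distinct_card[of vs] by simp
    then show ?case using base le z by simp
  next
    case (step k)
    have lv: "length vs = CARD('n)" using step.prems distinct_card[of vs] by simp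
    have "e ! k \<in> set vs" using step.hyps step.prems(2) e le nth_mem by metis
    then obtain j where j: "j < CARD('n)" "vs ! j = e ! k" using lv by (metis in_set_conv_nth)
    have eq: "vs ! i = e ! i" if "i < k" for i
      using step.prems(3) that by (metis nth_take)
    have "\<not> j < k"
    proof
      assume "j < k"
      then have "e ! j = e ! k" using eq j by simp
      then show False using \<open>j < k\<close> e(1) le step.hyps by (simp add: nth_eq_iff_index_eq)
    qed
    let ?ws = "vs[k := vs ! j, j := vs ! k]"
    have "?ws ! i = e ! i" if "i < Suc k" for i
      using that j eq \<open>\<not> j < k\<close> lv step.hyps by (auto simp: nth_list_update less_Suc_eq)
    then have "take (Suc k) ?ws = take (Suc k) e"
      using lv le step.hyps by (intro nth_equalityI) auto
    moreover have "distinct ?ws" "set ?ws = Basis"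
      using step.prems(1,2) distinct_swap[of k vs j] set_swap[of k vs j] j(1) lv step.hyps by simp_all
    ultimately have ws: "\<alpha> ?ws = 0" using step.IH by blast
    show ?case
    proof (cases "k = j")
      case True
      then show ?thesis using ws by simp
    next
      case False
      then show ?thesis using alternating_swap[OF \<alpha> _ j(1) False lv] ws step.hyps by simp
    qed
  qed
  have basis: "\<alpha> vs = 0" if "length vs = CARD('n)" "set vs \<subseteq> Basis" for vs
  proof (cases "distinct vs")
    case True
    then have "set vs = Basis" using that distinct_card[of vs] by (intro card_subset_eq) auto
    then show ?thesis using perm[of vs 0] True by simp
  next
    case False
    then show ?thesis using that alternating_repeat[OF \<alpha>] by (metis distinct_conv_nth)
  qed
  \<comment> \<open>The first \<open>k\<close> arguments are still arbitrary, the later ones are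
    basis vectors.\<close>
  have "\<alpha> vs = 0" if "length vs = CARD('n)" "k \<le> CARD('n)" "\<And>i. k \<le> i \<Longrightarrow> i < CARD('n) \<Longrightarrow> vs ! i \<in> Basis" for vs k
    using that
  proof (induction k arbitrary: vs)
    case 0
    then have "set vs \<subseteq> Basis" by (auto simp: in_set_conv_nth)
    then show ?case using basis 0 by blast
  next
    case (Suc k)
    have lin: "linear (\<lambda>v. \<alpha> (vs[k := v]))"
      using alternating_linear[OF \<alpha> Suc.prems(1)] Suc.prems(2) by simp
    have "\<alpha> (vs[k := v]) = 0" if "v \<in> Basis" for v
      using Suc.prems that by (intro Suc.IH) (auto simp: nth_list_update)
    then have "(\<lambda>v. \<alpha> (vs[k := v])) = (\<lambda>v. 0)"
      using lin linear_zero by (intro linear_eq_stdbasis) auto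
    then have "\<alpha> (vs[k := vs ! k]) = 0" by meson
    then show ?case by simp
  qed
  from this[of vs "CARD('n)"] show ?thesis
    using \<alpha> by (cases "length vs = CARD('n)") (auto simp: alternating_form_def)
qed

lemma linear_cmult:
  fixes f :: "'a::real_vector \<Rightarrow> real"
  shows "linear f \<Longrightarrow> linear (\<lambda>x. c * f x)"
  using linear_compose_scale_right[of f c] by simp

lemma alternating_cmult: "alternating_form k \<alpha> \<Longrightarrow> alternating_form k (\<lambda>vs. h * \<alpha> vs)"
  unfolding alternating_form_def by (auto intro!: linear_cmult)

lemma alternating_add_scaled:
  assumes "alternating_form k \<alpha>" "alternating_form k \<beta>"
  shows "alternating_form k (\<lambda>vs. \<alpha> vs - h * \<beta> vs)"
  using assms unfolding alternating_form_def
  by (auto intro!: linear_compose_sub linear_cmult)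

lemma exists_basis_list: "\<exists>e. distinct e \<and> set e = (Basis :: (real^'n::finite) set)"
  using finite_distinct_list[OF finite_Basis] by metis

text \<open>Top-degree forms make up a line, so proportionality is tested on a single basis
  list.\<close>

lemma alternating_eqI:
  fixes \<alpha> \<beta> :: "(real^'n::finite) list \<Rightarrow> real"
  assumes "alternating_form CARD('n) \<alpha>" "alternating_form CARD('n) \<beta>" "distinct e" "set e = Basis"
    and "\<alpha> e = h * \<beta> e"
  shows "\<alpha> vs = h * \<beta> vs"
  using alternating_eq_0[OF alternating_add_scaled[OF assms(1,2), of h] assms(3,4), of vs] assms(5) by simp

lemma alternating_Cons:
  assumes "alternating_form k \<alpha>" "k > 0"
  shows "alternating_form (k - 1) (\<lambda>vs. \<alpha> (w # vs))"
proof (rule alternating_formI_adjacent)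
  show "linear (\<lambda>v. \<alpha> (w # vs[i := v]))" if "length vs = k - 1" "i < k - 1" for vs i
    using alternating_linear[OF assms(1), of "w # vs" "Suc i"] that by simp
  show "\<alpha> (w # vs) = 0" if "length vs = k - 1" "Suc i < k - 1" "vs ! i = vs ! Suc i" for vs i
    using alternating_repeat[OF assms(1), of "w # vs" "Suc i" "Suc (Suc i)"] that by simp
  show "\<alpha> (w # vs) = 0" if "length vs \<noteq> k - 1" for vs
    using assms that unfolding alternating_form_def by simp
qed

text \<open>Passing from \<open>i\<close> to \<open>Suc i\<close> exchanges the front entry with the
  one at position \<open>Suc i\<close>, which contributes one sign.\<close>

lemma alternating_Cons_omit:
  assumes \<alpha>: "alternating_form k \<alpha>" "length vs = k"
  shows "i < k \<Longrightarrow> \<alpha> (vs ! i # omit i vs) = (-1) ^ i * \<alpha> vs"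
proof (induction i)
  case 0
  then show ?case using assms by (cases vs) (auto simp: omit_def)
next
  case (Suc i)
  let ?ws = "vs ! i # omit i vs"
  have "vs ! Suc i # omit (Suc i) vs = ?ws[0 := ?ws ! Suc i, Suc i := ?ws ! 0]"
    using Suc.prems assms(2)
    by (intro nth_equalityI) (auto simp: nth_omit nth_Cons nth_list_update split: nat.splits)
  then have "\<alpha> (vs ! Suc i # omit (Suc i) vs) = - \<alpha> ?ws"
    using Suc.prems assms alternating_swap[OF \<alpha>(1), of 0 "Suc i" ?ws] by simp
  then show ?case using Suc by simp
qed

lemma alternating_Cons_omit_other:
  assumes \<alpha>: "alternating_form k \<alpha>" "length vs = k" and "i < k" "j < k" "i \<noteq> j"
  shows "\<alpha> (vs ! j # omit i vs) = 0"
  by (rule alternating_repeat[OF \<alpha>(1), of _ 0 "if j < i then Suc j else j"])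
    (use assms in \<open>auto simp: nth_omit nth_Cons split: nat.splits\<close>)

lemma alternating_linear_Cons:
  assumes "alternating_form k \<alpha>" "length ws = k - 1" "k > 0"
  shows "linear (\<lambda>v. \<alpha> (v # ws))"
  using alternating_linear[OF assms(1), of "0 # ws" 0] assms by simp

text \<open>Both sides are linear in \<open>w\<close>. At a basis vector other than
  \<open>e ! i\<close> the list repeats an entry; at \<open>e ! i\<close> the sign rule of
  \<open>alternating_Cons_omit\<close> applies.\<close>

lemma alternating_Cons_basis:
  fixes \<alpha> :: "(real^'n::finite) list \<Rightarrow> real"
  assumes \<alpha>: "alternating_form CARD('n) \<alpha>" and e: "distinct e" "set e = Basis" and i: "i < CARD('n)"
  shows "\<alpha> (w # omit i e) = (-1) ^ i * (w \<bullet> e ! i) * \<alpha> e"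
proof -
  have le: "length e = CARD('n)" using e distinct_card[of e] by simp
  have lin: "linear (\<lambda>v. \<alpha> (v # omit i e))"
    using alternating_linear_Cons[OF \<alpha>] le i by simp
  have inj: "e ! i \<in> Basis" using e le i nth_mem by metis
  have *: "\<alpha> (b # omit i e) = (-1) ^ i * (b \<bullet> e ! i) * \<alpha> e" if "b \<in> Basis" for b
  proof -
    obtain j where j: "j < CARD('n)" "b = e ! j" using \<open>b \<in> Basis\<close> e le by (metis in_set_conv_nth)
    show ?thesis
    proof (cases "j = i")
      case True
      then show ?thesis using alternating_Cons_omit[OF \<alpha> le i] j inj by (simp add: inner_Basis)
    next
      case False
      then have "b \<noteq> e ! i" using j e(1) i le by (simp add: nth_eq_iff_index_eq)
      then show ?thesis
        using alternating_Cons_omit_other[OF \<alpha> le i j(1)] False j that inj by (simp add: inner_Basis)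
    qed
  qed
  have "linear (\<lambda>w. (-1) ^ i * (w \<bullet> e ! i) * \<alpha> e)"
    by (rule linearI) (auto simp: inner_add_left algebra_simps)
  from linear_eq_stdbasis[OF lin this *] show ?thesis by meson
qed

section \<open>Contraction and exterior derivative\<close>

lemma sum_basis_list:
  fixes e :: "(real^'n::finite) list"
  assumes "distinct e" "set e = Basis"
  shows "(\<Sum>i<CARD('n). f (e ! i)) = (\<Sum>b\<in>Basis. f b)"
proof -
  have "length e = CARD('n)" using assms distinct_card[of e] by simp
  then have "bij_betw ((!) e) {..<CARD('n)} Basis"
    using bij_betw_nth[OF assms(1), of "{..<CARD('n)}" Basis] assms(2) by auto
  then show ?thesis by (rule sum.reindex_bij_betw)
qed

text \<open>Existence: wedging the candidate with \<open>\<eta>\<close> gives a top-degree form,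
  which is compared with \<open>dv\<close> on a basis list through the coordinate expansion of the
  inner product. Uniqueness: a suitable covector isolates each value of the form.\<close>

lemma contraction_eq:
  fixes dv :: "(real^'n::finite) list \<Rightarrow> real"
  assumes dv: "alternating_form CARD('n) dv"
  shows "contraction G \<omega> dv = (\<lambda>vs. dv (sharp G \<omega> # vs))"
proof -
  let ?n = "CARD('n)"
  let ?\<alpha> = "\<lambda>vs. dv (sharp G \<omega> # vs)"
  have n: "?n > 0" by simp
  obtain e where e: "distinct e" "set e = (Basis :: (real^'n) set)" using exists_basis_list by blast
  have le: "length e = ?n" using e distinct_card[of e] by simp
  have alt: "alternating_form (?n - 1) ?\<alpha>" by (rule alternating_Cons[OF dv n])
  have wedge: "wedge1 \<eta> ?\<alpha> vs = coinner G \<eta> \<omega> * dv vs" if vs: "length vs = ?n" for \<eta> vs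
  proof -
    let ?w = "\<lambda>vs. if length vs = ?n then \<Sum>i<?n. (-1) ^ i * ((\<eta> \<bullet> vs ! i) * ?\<alpha> (omit i vs)) else 0"
    have "alternating_form ?n ?w"
    proof (rule alternating_antisymmetrization)
      show "alternating_form (?n - 1) (\<lambda>vs. (\<eta> \<bullet> v) * ?\<alpha> vs)" for v
        using alt by (rule alternating_cmult)
      show "linear (\<lambda>v. (\<eta> \<bullet> v) * ?\<alpha> ws)" for ws
        by (rule linearI) (auto simp: inner_add_right algebra_simps)
    qed
    moreover have "?w e = coinner G \<eta> \<omega> * dv e"
    proof -
      have "?w e = (\<Sum>i<?n. (\<eta> \<bullet> e ! i) * (sharp G \<omega> \<bullet> e ! i) * dv e)"
        using le by (auto simp: alternating_Cons_basis[OF dv e] algebra_simps simp flip: power_add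
            intro!: sum.cong)
      also have "\<dots> = (\<Sum>b\<in>Basis. (\<eta> \<bullet> b) * (sharp G \<omega> \<bullet> b)) * dv e"
        unfolding sum_distrib_right by (rule sum_basis_list[OF e])
      also have "\<dots> = coinner G \<eta> \<omega> * dv e"
        by (simp add: coinner_def sharp_def flip: euclidean_inner)
      finally show ?thesis .
    qed
    ultimately have "?w vs = coinner G \<eta> \<omega> * dv vs"
      using dv e by (intro alternating_eqI)
    then show ?thesis using vs by (simp add: wedge1_def mult.assoc)
  qed
  show ?thesis
    unfolding contraction_def
  proof (rule the_equality, intro conjI allI impI)
    fix \<alpha> assume \<alpha>: "alternating_form (?n - 1) \<alpha> \<and>
      (\<forall>\<eta> vs. length vs = ?n \<longrightarrow> wedge1 \<eta> \<alpha> vs = coinner G \<eta> \<omega> * dv vs)"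
    show "\<alpha> = ?\<alpha>"
    proof
      fix ws show "\<alpha> ws = ?\<alpha> ws"
      proof (cases "length ws = ?n - 1")
        case True
        have "dim (set ws) < DIM(real^'n)"
          using dim_le_card'[OF finite_set, of ws] card_length[of ws] True zero_less_card_finite[where 'a = 'n]
          by (simp only: DIM_cart DIM_real mult_1_right)
        then have "span (set ws) \<noteq> UNIV" by (metis dim_UNIV dim_span less_irrefl)
        \<comment> \<open>One argument fewer than the dimension leaves a nonzero
          \<open>\<eta>\<close> orthogonal to all of \<open>ws\<close>. On
          \<open>\<eta> # ws\<close> only the first term of the wedge survives, and it returns the
          value on \<open>ws\<close>.\<close>
        then obtain \<eta> where \<eta>: "\<eta> \<noteq> 0" "\<And>w. w \<in> span (set ws) \<Longrightarrow> \<eta> \<bullet> w = 0"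
          using span_not_univ_subset_hyperplane[of "set ws"] by blast
        have first: "wedge1 \<eta> \<beta> (\<eta> # ws) = (\<eta> \<bullet> \<eta>) * \<beta> ws" for \<beta>
        proof -
          have "\<eta> \<bullet> ws ! i = 0" if "i < length ws" for i
            using \<eta>(2) that by (simp add: span_base)
          then have "wedge1 \<eta> \<beta> (\<eta> # ws) = (\<Sum>i\<in>{0}. (-1) ^ i * (\<eta> \<bullet> (\<eta> # ws) ! i) * \<beta> (omit i (\<eta> # ws)))"
            unfolding wedge1_def by (intro sum.mono_neutral_right) (auto simp: nth_Cons split: nat.splits)
          then show ?thesis by (simp add: omit_def)
        qed
        have "wedge1 \<eta> \<alpha> (\<eta> # ws) = wedge1 \<eta> ?\<alpha> (\<eta> # ws)"
          using \<alpha> wedge True n by simp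
        then show ?thesis using \<eta>(1) by (simp add: first)
      next
        case False
        then show ?thesis using \<alpha> alt by (simp add: alternating_form_def)
      qed
    qed
  qed (use alt wedge in auto)
qed

text \<open>For a basis list \<open>e\<close>, \<open>dv y e\<close> is the density of the volume form in the coordinates, so the
  coefficient on the right is the divergence of \<open>F\<close>.\<close>

lemma ext_deriv_Cons:
  fixes dv :: "real^'n::finite \<Rightarrow> (real^'n) list \<Rightarrow> real"
  assumes S: "open S" "x \<in> S" and alt: "\<And>y. y \<in> S \<Longrightarrow> alternating_form CARD('n) (dv y)"
    and dv: "\<And>vs. smooth_on S (\<lambda>y. dv y vs)" and F: "smooth_on S F"
    and e: "distinct e" "set e = Basis" and vs: "length vs = CARD('n)"
    and \<beta>: "\<And>y. y \<in> S \<Longrightarrow> \<beta> y = (\<lambda>vs. dv y (F y # vs))"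
    and nz: "dv x e \<noteq> 0"
  shows "ext_deriv \<beta> x vs =
    (\<Sum>b\<in>Basis. frechet_derivative (\<lambda>y. dv y e * (F y \<bullet> b)) (at x) b) / dv x e * dv x vs"
proof -
  let ?n = "CARD('n)"
  have n: "?n > 0" by simp
  have le: "length e = ?n" using e distinct_card[of e] by simp
  define \<gamma> where "\<gamma> = (\<lambda>vs y. dv y (F y # vs))"
  have \<gamma>alt: "alternating_form (?n - 1) (\<lambda>vs. \<gamma> vs y)" if "y \<in> S" for y
    unfolding \<gamma>_def by (rule alternating_Cons[OF alt[OF that] n])
  have expand: "\<gamma> ws y = (\<Sum>b\<in>Basis. (F y \<bullet> b) * dv y (b # ws))" if "y \<in> S" "length ws = ?n - 1" for ws y
  proof -
    have lin: "linear (\<lambda>v. dv y (v # ws))" by (rule alternating_linear_Cons[OF alt[OF that(1)] that(2) n])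
    have "dv y (F y # ws) = dv y ((\<Sum>b\<in>Basis. (F y \<bullet> b) *\<^sub>R b) # ws)" by (simp add: euclidean_representation)
    also have "\<dots> = (\<Sum>b\<in>Basis. (F y \<bullet> b) * dv y (b # ws))"
      using linear_sum[OF lin, of "\<lambda>b. (F y \<bullet> b) *\<^sub>R b" Basis] linear_cmul[OF lin] by simp
    finally show ?thesis by (simp add: \<gamma>_def)
  qed
  have diff: "(\<gamma> ws has_derivative frechet_derivative (\<gamma> ws) (at x)) (at x)" for ws
  proof (cases "length ws = ?n - 1")
    case True
    have "smooth_on S (\<lambda>y. \<Sum>b\<in>Basis. (F y \<bullet> b) * dv y (b # ws))"
      by (intro smooth_on_sum smooth_on_mult smooth_on_inner smooth_on_const S F dv)
    then have "smooth_on S (\<gamma> ws)"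
      using expand[OF _ True] by (intro smooth_on_cong[OF S(1), where g = "\<gamma> ws"]) auto
    then show ?thesis using S smooth_on_has_derivative by blast
  next
    case False
    have "(\<gamma> ws has_derivative (\<lambda>v. 0)) (at x)"
      using \<gamma>alt False by (intro has_derivative_transform_within_open[OF has_derivative_const[of 0] S])
        (auto simp: alternating_form_def)
    then show ?thesis using frechet_derivative_at by metis
  qed
  let ?B = "\<lambda>v ws. frechet_derivative (\<gamma> ws) (at x) v"
  \<comment> \<open>Identities between the functions \<open>\<gamma> ws\<close> on \<open>S\<close>
    pass to their derivatives at \<open>x\<close>; this is how \<open>?B v\<close> inherits being
    alternating.\<close>
  have uniq: "?B v ws = D v" if "(f has_derivative D) (at x)" "\<And>y. y \<in> S \<Longrightarrow> f y = \<gamma> ws y" for v ws f D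
    using has_derivative_transform_within_open[OF that(1) S that(2)] frechet_derivative_at by metis
  have linB: "linear (\<lambda>v. ?B v ws)" for ws
    using diff has_derivative_linear by blast
  have altB: "alternating_form (?n - 1) (?B v)" for v
    unfolding alternating_form_def
  proof (intro conjI allI impI)
    fix ws :: "(real^'n) list" assume "length ws \<noteq> ?n - 1"
    then show "?B v ws = 0"
      using \<gamma>alt by (intro uniq[OF has_derivative_const]) (auto simp: alternating_form_def)
  next
    fix ws :: "(real^'n) list" and i assume *: "length ws = ?n - 1 \<and> i < ?n - 1"
    have lin: "linear (\<lambda>v. \<gamma> (ws[i := v]) y)" if "y \<in> S" for y
      using alternating_linear[OF \<gamma>alt[OF that]] * by blast
    show "linear (\<lambda>w. ?B v (ws[i := w]))"
    proof (rule linearI)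
      show "?B v (ws[i := w + w']) = ?B v (ws[i := w]) + ?B v (ws[i := w'])" for w w'
        using lin by (intro uniq[OF has_derivative_add[OF diff diff]]) (simp add: linear_add[OF lin])
      show "?B v (ws[i := r *\<^sub>R w]) = r *\<^sub>R ?B v (ws[i := w])" for r w
        using lin by (intro uniq[OF has_derivative_scaleR_right[OF diff]]) (simp add: linear_cmul[OF lin])
    qed
  next
    fix ws :: "(real^'n) list" and i j assume *: "length ws = ?n - 1 \<and> i < j \<and> j < ?n - 1 \<and> ws ! i = ws ! j"
    then have "0 = \<gamma> ws y" if "y \<in> S" for y
      using alternating_repeat[OF \<gamma>alt[OF that], of ws i j] by simp
    then show "?B v ws = 0"
      by (rule uniq[OF has_derivative_const])
  qed
  let ?w = "\<lambda>vs. if length vs = ?n then \<Sum>i<?n. (-1) ^ i * ?B (vs ! i) (omit i vs) else 0"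
  have w: "alternating_form ?n ?w"
    by (rule alternating_antisymmetrization[where B = ?B, OF altB linB])
  let ?h = "(\<Sum>b\<in>Basis. frechet_derivative (\<lambda>y. dv y e * (F y \<bullet> b)) (at x) b) / dv x e"
  have "?B (e ! i) (omit i e) = (-1) ^ i * frechet_derivative (\<lambda>y. dv y e * (F y \<bullet> e ! i)) (at x) (e ! i)"
    if "i < ?n" for i
  proof (rule uniq[where f = "\<lambda>y. (-1) ^ i * (dv y e * (F y \<bullet> e ! i))" and
        D = "\<lambda>v. (-1) ^ i * frechet_derivative (\<lambda>y. dv y e * (F y \<bullet> e ! i)) (at x) v"])
    have "smooth_on S (\<lambda>y. dv y e * (F y \<bullet> e ! i))"
      by (intro smooth_on_mult smooth_on_inner smooth_on_const S F dv)
    then show "((\<lambda>y. (-1) ^ i * (dv y e * (F y \<bullet> e ! i))) has_derivative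
        (\<lambda>v. (-1) ^ i * frechet_derivative (\<lambda>y. dv y e * (F y \<bullet> e ! i)) (at x) v)) (at x)"
      using S smooth_on_has_derivative by (intro has_derivative_mult_right) blast
    show "(-1) ^ i * (dv y e * (F y \<bullet> e ! i)) = \<gamma> (omit i e) y" if "y \<in> S" for y
      unfolding \<gamma>_def using alternating_Cons_basis[OF alt[OF that] e \<open>i < ?n\<close>] by simp
  qed
  \<comment> \<open>The sign from inserting \<open>F\<close> into the basis list cancels the sign of
    the exterior derivative, leaving partial derivatives of density times component.\<close>
  then have "(-1) ^ i * ?B (e ! i) (omit i e) = frechet_derivative (\<lambda>y. dv y e * (F y \<bullet> e ! i)) (at x) (e ! i)"
    if "i < ?n" for i
    using that by simp
  then have "?w e = (\<Sum>i<?n. frechet_derivative (\<lambda>y. dv y e * (F y \<bullet> e ! i)) (at x) (e ! i))"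
    unfolding if_P[OF le] by (intro sum.cong) auto
  also have "\<dots> = ?h * dv x e"
    using nz by (simp add: sum_basis_list[OF e, of "\<lambda>b. frechet_derivative (\<lambda>y. dv y e * (F y \<bullet> b)) (at x) b"])
  finally have "?w vs = ?h * dv x vs"
    by (rule alternating_eqI[OF w alt[OF S(2)] e])
  moreover have "frechet_derivative (\<lambda>y. \<beta> y ws) (at x) v = ?B v ws" for v ws
  proof -
    have "((\<lambda>y. \<beta> y ws) has_derivative frechet_derivative (\<gamma> ws) (at x)) (at x)"
      by (rule has_derivative_transform_within_open[OF diff S]) (simp add: \<beta> \<gamma>_def)
    from frechet_derivative_at[OF this] show ?thesis by simp
  qed
  ultimately show ?thesis using vs by (simp add: ext_deriv_def)
qed

text \<open>The density \<open>dv x e\<close> is nonzero, so comparing values on the list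
  \<open>e\<close> pins down the number selected by the definition.\<close>

lemma mean_curvature_eq:
  fixes dv :: "real^'n::finite \<Rightarrow> (real^'n) list \<Rightarrow> real"
  assumes S: "open S" "x \<in> S" and alt: "\<And>y. y \<in> S \<Longrightarrow> alternating_form CARD('n) (dv y)"
    and dv: "\<And>vs. smooth_on S (\<lambda>y. dv y vs)"
    and F: "smooth_on S (\<lambda>y. (1 / conorm (G y) (differential f y) powr (1 - p)) *\<^sub>R sharp (G y) (differential f y))"
      (is "smooth_on S ?F")
    and e: "distinct e" "set e = Basis" and nz: "dv x e \<noteq> 0"
  shows "mean_curvature G dv p f x =
    (\<Sum>b\<in>Basis. frechet_derivative (\<lambda>y. dv y e *
      ((1 / conorm (G y) (differential f y) powr (1 - p)) *\<^sub>R sharp (G y) (differential f y) \<bullet> b)) (at x) b) / dv x e"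
proof -
  have le: "length e = CARD('n)" using e distinct_card[of e] by simp
  have *: "ext_deriv (\<lambda>y. contraction (G y)
         ((1 / conorm (G y) (differential f y) powr (1 - p)) *\<^sub>R differential f y) (dv y)) x vs =
    (\<Sum>b\<in>Basis. frechet_derivative (\<lambda>y. dv y e * (?F y \<bullet> b)) (at x) b) / dv x e * dv x vs"
    if "length vs = CARD('n)" for vs
  proof (rule ext_deriv_Cons[OF S alt dv F e that _ nz])
    fix y assume "y \<in> S"
    then show "contraction (G y) ((1 / conorm (G y) (differential f y) powr (1 - p)) *\<^sub>R differential f y) (dv y) =
        (\<lambda>vs. dv y (?F y # vs))"
      unfolding contraction_eq[OF alt[OF \<open>y \<in> S\<close>]]
      by (simp add: sharp_def matrix_vector_mult_scaleR)
  qed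
  show ?thesis
    unfolding mean_curvature_def
  proof (rule the_equality)
    fix h assume "\<forall>vs. length vs = CARD('n) \<longrightarrow> ext_deriv (\<lambda>y. contraction (G y)
         ((1 / conorm (G y) (differential f y) powr (1 - p)) *\<^sub>R differential f y) (dv y)) x vs = h * dv x vs"
    then show "h = (\<Sum>b\<in>Basis. frechet_derivative (\<lambda>y. dv y e * (?F y \<bullet> b)) (at x) b) / dv x e"
      using * nz le by force
  qed (use * in blast)
qed


subsection \<open>Tangency to closed sets and Lie brackets\<close>

text \<open>A vector \<open>\<nu>\<close> with \<open>ball (z + \<nu>) (norm \<nu>) \<inter> F = {}\<close> is an exterior normal of \<open>F\<close> at \<open>z\<close> in the
  sense of Bony.\<close>

definition tangent_field :: "'a::real_inner set \<Rightarrow> 'a set \<Rightarrow> ('a \<Rightarrow> 'a) \<Rightarrow> bool" where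
  "tangent_field F S X \<longleftrightarrow> (\<forall>z\<in>F \<inter> S. \<forall>\<nu>. ball (z + \<nu>) (norm \<nu>) \<inter> F = {} \<longrightarrow> X z \<bullet> \<nu> = 0)"

section \<open>Distance to a closed set along approximate integral curves\<close>

lemma norm_scaleR_mono: "0 \<le> a \<Longrightarrow> a \<le> b \<Longrightarrow> norm (a *\<^sub>R v) \<le> b * norm v"
  by (simp add: mult_right_mono)

text \<open>At a nearest point \<open>z\<close> of \<open>F\<close> the vector
  \<open>c s - z\<close> is an exterior normal, so \<open>X z\<close> does not change the distance
  \<delta>; formally \<delta>' <= K \<delta> + M. Since \<delta> need not be differentiable, it is
  compared with affine functions, and \<open>K * t \<le> 1 / 2\<close> puts the factor 2 in the
  place of Gronwall's exponential.\<close>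

lemma infdist_approx_integral_curve:
  fixes c :: "real \<Rightarrow> 'a::euclidean_space"
  assumes F: "closed F" and X: "tangent_field F S X"
    and t: "0 \<le> t" "K * t \<le> 1 / 2" and K: "K \<ge> 0" and M: "M \<ge> 0" and c0: "c 0 \<in> F"
    and c: "\<And>s. (c has_vector_derivative c' s) (at s)"
    and near: "\<And>s z. 0 \<le> s \<Longrightarrow> s \<le> t \<Longrightarrow> z \<in> F \<Longrightarrow> dist (c s) z = infdist (c s) F \<Longrightarrow>
      z \<in> S \<and> norm (X (c s) - X z) \<le> K * norm (c s - z)"
    and c': "\<And>s. 0 \<le> s \<Longrightarrow> s \<le> t \<Longrightarrow> norm (c' s - X (c s)) \<le> M"
  shows "infdist (c t) F \<le> 2 * M * t"
proof -
  define \<delta> where "\<delta> = (\<lambda>s. infdist (c s) F)"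
  have "isCont c s" for s using c has_vector_derivative_continuous by blast
  then have cont: "isCont \<delta> s" for s unfolding \<delta>_def by (intro continuous_intros)
  have bound: "\<delta> t \<le> \<epsilon> + (2 * M + (2 * K + 1) * \<epsilon>) * t" if \<epsilon>: "\<epsilon> > 0" for \<epsilon>
  proof -
    \<comment> \<open>\<open>L / 2 = M + (K + 1 / 2) * \<epsilon>\<close>; together with
      \<open>K * s \<le> 1 / 2\<close> this makes \<open>M + K * g s\<close> strictly smaller than
      the slope \<open>L\<close> of \<open>g\<close>.\<close>
    define L where "L = 2 * M + (2 * K + 1) * \<epsilon>"
    define g where "g = (\<lambda>s. \<epsilon> + L * s)"
    have L: "L > 0" unfolding L_def using M K \<epsilon> by (simp add: add_nonneg_pos)
    have gpos: "g s > 0" if "s \<ge> 0" for s unfolding g_def using \<epsilon> L that by (simp add: add_pos_nonneg)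
    have gcont: "isCont g s" for s unfolding g_def by (intro continuous_intros)
    have Lg: "M + K * g s < L" if "0 \<le> s" "s \<le> t" for s
    proof -
      have "K * s \<le> 1 / 2" using t K that by (meson mult_left_mono order_trans)
      then have "L * (K * s) \<le> L * (1 / 2)" using L by (intro mult_left_mono) auto
      then show ?thesis unfolding g_def using \<epsilon> L_def by (simp add: algebra_simps)
    qed
    \<comment> \<open>At a contact time the squared distance to one fixed nearest point is a
      differentiable upper bound of the squared distance to \<open>F\<close>, with equality at
      \<open>s\<close>; its derivative there is below that of the square of
      \<open>g\<close>.\<close>
    have right: "\<exists>d>0. \<forall>h. 0 < h \<and> h < d \<longrightarrow> \<delta> (s + h) < g (s + h)" if s: "0 \<le> s" "s \<le> t" "\<delta> s \<le> g s" for s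
    proof (cases "\<delta> s < g s")
      case True
      have "isCont (\<lambda>s. g s - \<delta> s) s" using cont gcont by (intro continuous_intros) auto
      then have "((\<lambda>s. g s - \<delta> s) \<longlongrightarrow> g s - \<delta> s) (at s)" by (simp add: isCont_def)
      then have "\<forall>\<^sub>F x in at s. g x - \<delta> x > 0" using True by (intro order_tendstoD) auto
      then obtain d where "d > 0" "\<And>x. x \<noteq> s \<Longrightarrow> dist x s < d \<Longrightarrow> g x - \<delta> x > 0"
        unfolding eventually_at by auto
      then show ?thesis by (intro exI[of _ d]) (auto simp: dist_real_def)
    next
      case False
      then have eq: "\<delta> s = g s" using s by simp
      have "F \<noteq> {}" using c0 by auto
      then obtain z where z: "z \<in> F" "\<delta> s = dist (c s) z"
        using infdist_attains_inf[OF F] unfolding \<delta>_def by metis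
      define \<nu> where "\<nu> = c s - z"
      have n\<nu>: "norm \<nu> = g s" using z eq by (simp add: \<nu>_def dist_norm)
      have "z \<in> S" and lip: "norm (X (c s) - X z) \<le> K * norm \<nu>"
        using near[OF s(1,2) z(1)] z(2) unfolding \<delta>_def \<nu>_def by auto
      have "ball (z + \<nu>) (norm \<nu>) \<inter> F = {}"
        using z(2) infdist_le[of _ F "c s"] unfolding \<delta>_def \<nu>_def
        by (force simp: dist_norm)
      then have 0: "X z \<bullet> \<nu> = 0" using X z(1) \<open>z \<in> S\<close> unfolding tangent_field_def by blast
      have "\<nu> \<bullet> c' s = \<nu> \<bullet> (c' s - X (c s)) + \<nu> \<bullet> (X (c s) - X z)"
        using 0 by (simp add: inner_diff_right inner_commute)
      also have "\<dots> \<le> norm \<nu> * M + norm \<nu> * (K * norm \<nu>)"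
        using lip c'[OF s(1,2)]
        by (intro add_mono order_trans[OF norm_cauchy_schwarz] mult_left_mono) auto
      also have "\<dots> = g s * (M + K * g s)" using n\<nu> by (simp add: algebra_simps)
      also have "\<dots> < g s * L" using Lg[OF s(1,2)] gpos[OF s(1)] by simp
      finally have neg: "2 * (\<nu> \<bullet> c' s) - 2 * (g s * L) < 0" by simp
      have "((\<lambda>x. (c x - z) \<bullet> (c x - z) - (g x)\<^sup>2) has_real_derivative
          2 * (\<nu> \<bullet> c' s) - 2 * (g s * L)) (at s)"
        unfolding g_def \<nu>_def has_real_derivative_iff_has_vector_derivative has_vector_derivative_def
        by (rule has_derivative_eq_rhs,
            (rule derivative_intros c[unfolded has_vector_derivative_def] | simp)+)
          (auto simp: algebra_simps inner_commute)
      from DERIV_neg_dec_right[OF this neg] obtain d where d: "d > 0"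
        "\<And>h. 0 < h \<Longrightarrow> h < d \<Longrightarrow> (c (s + h) - z) \<bullet> (c (s + h) - z) - (g (s + h))\<^sup>2 < \<nu> \<bullet> \<nu> - (g s)\<^sup>2"
        unfolding \<nu>_def by blast
      have "\<delta> (s + h) < g (s + h)" if "0 < h" "h < d" for h
      proof -
        have "(dist (c (s + h)) z)\<^sup>2 < (g (s + h))\<^sup>2"
          using d(2)[OF that] n\<nu> by (simp add: dist_norm power2_norm_eq_inner flip: power2_norm_eq_inner)
        then have "dist (c (s + h)) z < g (s + h)"
          by (rule power_less_imp_less_base) (use gpos[of "s + h"] s that in auto)
        then show ?thesis using infdist_le[OF z(1), of "c (s + h)"] by (simp add: \<delta>_def)
      qed
      then show ?thesis using d(1) by blast
    qed
    show ?thesis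
    proof (rule ccontr)
      assume "\<not> ?thesis"
      then have tB: "\<delta> t > g t" by (simp add: g_def L_def)
      \<comment> \<open>No first crossing time exists: at the infimum the bound holds by continuity
        or by the initial value, and \<open>right\<close> extends it beyond.\<close>
      define B where "B = {s\<in>{0..t}. \<delta> s > g s}"
      have B: "B \<noteq> {}" "bdd_below B" using tB t by (auto simp: B_def)
      define s where "s = Inf B"
      have s: "0 \<le> s" "s \<le> t"
        unfolding s_def using B tB t by (auto simp: B_def intro!: cInf_greatest cInf_lower)
      have below: "\<delta> r \<le> g r" if "0 \<le> r" "r < s" for r
        using cInf_lower[OF _ B(2), of r] that s unfolding s_def B_def by force
      have "\<delta> s \<le> g s"
      proof (cases "s = 0")
        case True
        then show ?thesis using c0 \<epsilon> by (simp add: \<delta>_def g_def)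
      next
        case False
        have "isCont (\<lambda>s. g s - \<delta> s) s" using cont gcont by (intro continuous_intros) auto
        then have "((\<lambda>s. g s - \<delta> s) \<longlongrightarrow> g s - \<delta> s) (at_left s)"
          by (simp add: isCont_def filterlim_at_split)
        moreover have "\<forall>\<^sub>F r in at_left s. g r - \<delta> r \<ge> 0"
          using False s below by (intro eventually_at_leftI[of 0]) auto
        ultimately have "g s - \<delta> s \<ge> 0"
          by (intro tendsto_lowerbound) auto
        then show ?thesis by simp
      qed
      then obtain d where d: "d > 0" "\<And>h. 0 < h \<Longrightarrow> h < d \<Longrightarrow> \<delta> (s + h) < g (s + h)"
        using right s by blast
      have "s + d \<le> r" if "r \<in> B" for r
      proof (rule ccontr)
        assume "\<not> s + d \<le> r"
        moreover have "s \<le> r" unfolding s_def using that B(2) by (rule cInf_lower)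
        moreover have "r \<noteq> s" using that \<open>\<delta> s \<le> g s\<close> by (auto simp: B_def)
        ultimately have "\<delta> r < g r" using d(2)[of "r - s"] by simp
        then show False using that by (simp add: B_def)
      qed
      then have "s + d \<le> s" unfolding s_def by (intro cInf_greatest B(1)) auto
      then show False using d by simp
    qed
  qed
  show ?thesis
  proof (rule field_le_epsilon)
    fix e :: real assume e: "e > 0"
    \<comment> \<open>\<open>N\<close> is the coefficient of \<open>\<epsilon>\<close> in
      \<open>bound\<close>, so \<open>\<epsilon> = e / N\<close> gives exactly the tolerance
      \<open>e\<close>.\<close>
    define N where "N = 1 + (2 * K + 1) * t"
    have N: "N > 0" unfolding N_def using K t by (simp add: add_pos_nonneg)
    have "\<epsilon> + (2 * M + (2 * K + 1) * \<epsilon>) * t = 2 * M * t + \<epsilon> * N" for \<epsilon>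
      by (simp add: N_def algebra_simps)
    then have "\<delta> t \<le> 2 * M * t + e / N * N"
      using bound[of "e / N"] e N by (metis divide_pos_pos)
    then show "infdist (c t) F \<le> 2 * M * t + e" using N by (simp add: \<delta>_def)
  qed
qed

text \<open>The points of \<open>F\<close> are picked separately for each \<open>t\<close>, without
  forming a curve in \<open>F\<close>. An error of order \<open>t ^ 3\<close> keeps the coefficient
  \<open>B\<close> meaningful, and \<open>B\<close> is where the Lie bracket appears.\<close>

definition reaches :: "'a::real_normed_vector set \<Rightarrow> 'a \<Rightarrow> 'a \<Rightarrow> 'a \<Rightarrow> bool" where
  "reaches F z A B \<longleftrightarrow> (\<exists>C \<tau>. 0 < \<tau> \<and> 0 \<le> C \<and>
    (\<forall>t. 0 < t \<and> t \<le> \<tau> \<longrightarrow> (\<exists>z'\<in>F. norm (z' - (z + t *\<^sub>R A + t\<^sup>2 *\<^sub>R B)) \<le> C * t ^ 3)))"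

text \<open>Following \<open>X\<close> for time \<open>t\<close> changes the second-order expansion as the exact flow of \<open>X\<close> does;
  no flow is needed, since a quadratic curve satisfies the differential equation up to
  \<open>O(t\<^sup>2)\<close>.\<close>

lemma reaches_step:
  fixes z :: "'a::euclidean_space"
  assumes F: "closed F" and z: "z \<in> F" "z \<in> S" and S: "open S"
    and X: "smooth_on S X" "tangent_field F S X" and AB: "reaches F z A B"
  defines "D \<equiv> frechet_derivative X (at z)"
  shows "reaches F z (A + X z) (B + D A + (1 / 2) *\<^sub>R D (X z))"
proof -
  obtain r where r: "r > 0" "cball z r \<subseteq> S" using S z(2) open_contains_cball by blast
  have zr: "z \<in> cball z r" using r by simp
  obtain K where K: "K \<ge> 0" "\<And>x y. x \<in> cball z r \<Longrightarrow> y \<in> cball z r \<Longrightarrow> norm (X x - X y) \<le> K * norm (x - y)"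
    using smooth_on_lipschitz[OF X(1) compact_cball convex_cball r(2)] by blast
  obtain Q where Q: "Q \<ge> 0" "\<And>y. y \<in> cball z r \<Longrightarrow> norm (X y - X z - D (y - z)) \<le> Q * (norm (y - z))\<^sup>2"
    using smooth_on_taylor2[OF X(1) compact_cball convex_cball r(2) zr] unfolding D_def by blast
  have lin: "linear D" unfolding D_def using X(1) z(2) by (rule smooth_on_linear_frechet)
  define N where "N = (\<Sum>i\<in>Basis. norm (D i))"
  have N: "N \<ge> 0" "norm (D v) \<le> N * norm v" for v
    unfolding N_def using linear_norm_le_sum_Basis[OF lin] by (auto intro: sum_nonneg)
  obtain C \<tau> where C: "0 < \<tau>" "0 \<le> C"
    and reach: "\<And>t. 0 < t \<Longrightarrow> t \<le> \<tau> \<Longrightarrow> \<exists>z'\<in>F. norm (z' - (z + t *\<^sub>R A + t\<^sup>2 *\<^sub>R B)) \<le> C * t ^ 3"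
    using AB unfolding reaches_def by blast
  define P where "P = norm A + norm B + C + norm (X z) + norm (D A) + norm (D (X z)) + 1"
  have P: "P > 0" unfolding P_def using C by (intro add_nonneg_pos add_nonneg_nonneg) auto
  \<comment> \<open>The four bounds provide, in turn: the points from the hypothesis,
    \<open>t ^ 3 \<le> t\<^sup>2\<close>, the smallness \<open>K * t \<le> 1 / 2\<close>, and
    nearest points within distance \<open>2 * (P * t) \<le> r\<close> of \<open>z\<close>.\<close>
  define \<sigma> where "\<sigma> = min (min \<tau> 1) (min (1 / (2 * (K + 1))) (r / (2 * P)))"
  have \<sigma>: "\<sigma> > 0" unfolding \<sigma>_def using C K P r by simp
  \<comment> \<open>The defect of the curve \<open>c\<close> below as an integral curve, in units of
    \<open>t\<^sup>2\<close>: the Taylor remainder of \<open>X\<close>, and \<open>D\<close> applied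
    to the second-order part of the displacement.\<close>
  define M where "M = Q * P\<^sup>2 + N * P"
  have M: "M \<ge> 0" unfolding M_def using Q N P by simp
  have "\<exists>w\<in>F. norm (w - (z + t *\<^sub>R (A + X z) + t\<^sup>2 *\<^sub>R (B + D A + (1 / 2) *\<^sub>R D (X z)))) \<le> (C + 2 * M) * t ^ 3"
    if t: "0 < t" "t \<le> \<sigma>" for t
  proof -
    have t': "t \<le> \<tau>" "t \<le> 1" "t \<le> 1 / (2 * (K + 1))" "t \<le> r / (2 * P)" using t by (auto simp: \<sigma>_def)
    have Kt: "K * t \<le> 1 / 2"
    proof -
      have "K * t \<le> (K + 1) * t" using t by simp
      also have "\<dots> \<le> (K + 1) * (1 / (2 * (K + 1)))" using t'(3) K by (intro mult_left_mono) auto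
      also have "\<dots> = 1 / 2" using K by simp
      finally show ?thesis .
    qed
    have Pt: "2 * (P * t) \<le> r" using t'(4) P by (simp add: field_simps)
    moreover have "0 < P * t" using P t by simp
    ultimately have Ptr: "P * t \<le> r" by linarith
    obtain z' where z': "z' \<in> F" "norm (z' - (z + t *\<^sub>R A + t\<^sup>2 *\<^sub>R B)) \<le> C * t ^ 3"
      using reach t t' by blast
    define e where "e = z' - (z + t *\<^sub>R A + t\<^sup>2 *\<^sub>R B)"
    have t3: "t ^ 3 \<le> t\<^sup>2" "t\<^sup>2 \<le> t" using t t' by (auto simp: power2_eq_square power3_eq_cube mult_left_le)
    have e: "norm e \<le> C * t\<^sup>2" "norm e \<le> C * t ^ 3"
      using z' t3 C unfolding e_def by (meson mult_left_mono order_trans, simp)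
    have z'e: "z' = z + t *\<^sub>R A + t\<^sup>2 *\<^sub>R B + e" by (simp add: e_def)
    \<comment> \<open>Its velocity at \<open>s\<close> is
      \<open>X z + D (t *\<^sub>R A + s *\<^sub>R X z)\<close>, which agrees with
      \<open>X (c s)\<close> up to order \<open>t\<^sup>2\<close>; at \<open>s = t\<close> the curve
      has the claimed expansion.\<close>
    define c where "c = (\<lambda>s. z' + s *\<^sub>R X z + (s * t) *\<^sub>R D A + (s\<^sup>2 / 2) *\<^sub>R D (X z))"
    have st: "s * t \<le> t\<^sup>2" "s\<^sup>2 / 2 \<le> t\<^sup>2" if s: "0 \<le> s" "s \<le> t" for s
    proof -
      show "s * t \<le> t\<^sup>2" using s t by (simp add: power2_eq_square mult_right_mono)
      have "s\<^sup>2 \<le> t\<^sup>2" using s by (intro power_mono)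
      then show "s\<^sup>2 / 2 \<le> t\<^sup>2" using zero_le_power2[of s] by linarith
    qed
    have rest: "norm (c s - z - t *\<^sub>R A - s *\<^sub>R X z) \<le> P * t\<^sup>2" if s: "0 \<le> s" "s \<le> t" for s
    proof -
      have "norm (t\<^sup>2 *\<^sub>R B + e + (s * t) *\<^sub>R D A + (s\<^sup>2 / 2) *\<^sub>R D (X z))
          \<le> t\<^sup>2 * norm B + C * t\<^sup>2 + t\<^sup>2 * norm (D A) + t\<^sup>2 * norm (D (X z))"
        using e(1) s t st[OF s] by (intro norm_triangle_mono norm_scaleR_mono) auto
      also have "\<dots> \<le> P * t\<^sup>2"
        unfolding P_def by (simp add: algebra_simps)
      finally show ?thesis by (simp add: c_def z'e algebra_simps)
    qed
    have cs: "norm (c s - z) \<le> P * t" if s: "0 \<le> s" "s \<le> t" for s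
    proof -
      have st: "s * t \<le> t" "s\<^sup>2 / 2 \<le> t"
        using st[OF s] t3(2) by linarith+
      have "norm (t *\<^sub>R A + t\<^sup>2 *\<^sub>R B + e + s *\<^sub>R X z + (s * t) *\<^sub>R D A + (s\<^sup>2 / 2) *\<^sub>R D (X z))
          \<le> t * norm A + t * norm B + C * t + t * norm (X z) + t * norm (D A) + t * norm (D (X z))"
        using s t st t3(2) order_trans[OF e(1) mult_left_mono[OF t3(2) C(2)]]
        by (intro norm_triangle_mono norm_scaleR_mono) auto
      also have "\<dots> \<le> P * t"
        unfolding P_def using t by (simp add: algebra_simps)
      finally show ?thesis by (simp add: c_def z'e algebra_simps)
    qed
    have "infdist (c t) F \<le> 2 * (M * t\<^sup>2) * t"
    proof (rule infdist_approx_integral_curve[OF F X(2) _ Kt K(1)])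
      show "(c has_vector_derivative (X z + t *\<^sub>R D A + s *\<^sub>R D (X z))) (at s)" for s
        unfolding c_def has_vector_derivative_def
        by (rule has_derivative_eq_rhs, (rule derivative_intros | simp)+)
          (auto simp: algebra_simps scaleR_add_left)
    next
      fix s w assume s: "0 \<le> s" "s \<le> t" and w: "w \<in> F" "dist (c s) w = infdist (c s) F"
      have 1: "dist (c s) w \<le> P * t"
        using infdist_le[OF z(1), of "c s"] cs[OF s] w by (simp add: dist_norm)
      then have "dist z w \<le> P * t + P * t"
        using dist_triangle[of z w "c s"] cs[OF s] by (simp add: dist_norm norm_minus_commute)
      then have "w \<in> cball z r" using Pt by simp
      moreover have "c s \<in> cball z r"
        using order_trans[OF cs[OF s] Ptr] by (simp add: dist_norm norm_minus_commute)
      ultimately show "w \<in> S \<and> norm (X (c s) - X w) \<le> K * norm (c s - w)"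
        using K r by blast
    next
      fix s assume s: "0 \<le> s" "s \<le> t"
      have "c s \<in> cball z r"
        using order_trans[OF cs[OF s] Ptr] by (simp add: dist_norm norm_minus_commute)
      then have "norm (X (c s) - X z - D (c s - z)) \<le> Q * (norm (c s - z))\<^sup>2" by (rule Q)
      also have "\<dots> \<le> Q * (P * t)\<^sup>2" using cs[OF s] Q by (intro mult_left_mono power_mono) auto
      finally have 1: "norm (X (c s) - X z - D (c s - z)) \<le> Q * P\<^sup>2 * t\<^sup>2"
        by (simp add: power_mult_distrib algebra_simps)
      have "norm (D (c s - z - t *\<^sub>R A - s *\<^sub>R X z)) \<le> N * (P * t\<^sup>2)"
        using N rest[OF s] by (meson mult_left_mono order_trans)
      then have 2: "norm (D (c s - z) - t *\<^sub>R D A - s *\<^sub>R D (X z)) \<le> N * P * t\<^sup>2"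
        by (simp add: linear_diff[OF lin] linear_cmul[OF lin])
      have "X z + t *\<^sub>R D A + s *\<^sub>R D (X z) - X (c s) =
        - ((X (c s) - X z - D (c s - z)) + (D (c s - z) - t *\<^sub>R D A - s *\<^sub>R D (X z)))"
        by simp
      then show "norm (X z + t *\<^sub>R D A + s *\<^sub>R D (X z) - X (c s)) \<le> M * t\<^sup>2"
        using norm_triangle_mono[OF 1 2] unfolding M_def by (metis norm_minus_cancel distrib_right)
    qed (use t M z' in \<open>auto simp: c_def\<close>)
    moreover obtain w where w: "w \<in> F" "infdist (c t) F = dist (c t) w"
      using infdist_attains_inf[OF F] z(1) by blast
    ultimately have "norm (w - c t) \<le> 2 * M * t ^ 3"
      by (simp add: dist_norm norm_minus_commute power2_eq_square power3_eq_cube algebra_simps)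
    then have "norm ((w - c t) + e) \<le> 2 * M * t ^ 3 + C * t ^ 3"
      using e(2) by (rule norm_triangle_mono)
    also have "\<dots> = (C + 2 * M) * t ^ 3" by (simp add: distrib_right)
    also have "(w - c t) + e = w - (z + t *\<^sub>R (A + X z) + t\<^sup>2 *\<^sub>R (B + D A + (1 / 2) *\<^sub>R D (X z)))"
      by (simp add: c_def z'e algebra_simps power2_eq_square)
    finally show ?thesis using w(1) by blast
  qed
  then show ?thesis unfolding reaches_def using \<sigma> C M
    by (intro exI[of _ "C + 2 * M"] exI[of _ \<sigma>]) auto
qed

text \<open>If \<open>B \<bullet> \<nu>\<close> were positive, the squared distance from
  \<open>z + \<nu>\<close> to the chosen point of \<open>F\<close> would be
  \<open>(norm \<nu>)\<^sup>2 - 2 * t\<^sup>2 * (B \<bullet> \<nu>)\<close> up to order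
  \<open>t ^ 3\<close>, and the point would enter the ball.\<close>

lemma reaches_normal:
  fixes z :: "'a::euclidean_space"
  assumes R: "reaches F z 0 B" and \<nu>: "ball (z + \<nu>) (norm \<nu>) \<inter> F = {}"
  shows "B \<bullet> \<nu> \<le> 0"
proof (rule ccontr)
  assume "\<not> B \<bullet> \<nu> \<le> 0"
  then have pos: "B \<bullet> \<nu> > 0" by simp
  obtain C \<tau> where C: "0 < \<tau>" "0 \<le> C"
    and reach: "\<And>t. 0 < t \<Longrightarrow> t \<le> \<tau> \<Longrightarrow> \<exists>z'\<in>F. norm (z' - (z + t\<^sup>2 *\<^sub>R B)) \<le> C * t ^ 3"
    using R unfolding reaches_def by auto
  \<comment> \<open>Coefficient of \<open>t ^ 3\<close> in the error: the square of the
    displacement, and the remainder paired with \<open>\<nu>\<close>. The choice of \<open>t\<close>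
    keeps this below the main term.\<close>
  define E where "E = (norm B + C)\<^sup>2 + 2 * C * norm \<nu>"
  have E: "E \<ge> 0" unfolding E_def using C by simp
  define t where "t = min (min \<tau> 1) (B \<bullet> \<nu> / (E + 1))"
  have t: "0 < t" "t \<le> \<tau>" "t \<le> 1" "t \<le> B \<bullet> \<nu> / (E + 1)" using C pos E by (auto simp: t_def)
  obtain z' where z': "z' \<in> F" "norm (z' - (z + t\<^sup>2 *\<^sub>R B)) \<le> C * t ^ 3" using reach t by blast
  define e where "e = z' - (z + t\<^sup>2 *\<^sub>R B)"
  define w where "w = t\<^sup>2 *\<^sub>R B + e"
  have e: "norm e \<le> C * t ^ 3" using z' by (simp add: e_def)
  have "t ^ 3 \<le> t\<^sup>2" using t by (simp add: power2_eq_square power3_eq_cube mult_left_le)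
  then have "norm e \<le> C * t\<^sup>2" using e C by (meson mult_left_mono order_trans)
  then have nw: "norm w \<le> t\<^sup>2 * norm B + C * t\<^sup>2" unfolding w_def by (intro norm_triangle_mono) auto
  have "z' \<notin> ball (z + \<nu>) (norm \<nu>)" using \<nu> z' by blast
  then have "norm \<nu> \<le> norm (w - \<nu>)"
    by (simp add: w_def e_def dist_norm norm_minus_commute algebra_simps)
  then have "(norm \<nu>)\<^sup>2 \<le> (norm (w - \<nu>))\<^sup>2" by (intro power_mono) auto
  then have "2 * (w \<bullet> \<nu>) \<le> (norm w)\<^sup>2"
    by (simp add: power2_norm_eq_inner inner_diff_left inner_diff_right inner_commute)
  also have "\<dots> \<le> (t\<^sup>2 * norm B + C * t\<^sup>2)\<^sup>2" using nw by (intro power_mono) auto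
  also have "\<dots> = t\<^sup>2 * (t\<^sup>2 * (norm B + C)\<^sup>2)" by (simp add: power2_eq_square algebra_simps)
  also have "\<dots> \<le> t\<^sup>2 * (t * (norm B + C)\<^sup>2)"
    using t by (intro mult_left_mono mult_right_mono) (auto simp: power2_eq_square mult_left_le)
  finally have 1: "2 * (w \<bullet> \<nu>) \<le> t\<^sup>2 * (t * (norm B + C)\<^sup>2)" .
  have "- (e \<bullet> \<nu>) \<le> norm e * norm \<nu>" using norm_cauchy_schwarz[of "- e" \<nu>] by simp
  also have "\<dots> \<le> C * t ^ 3 * norm \<nu>" using e by (intro mult_right_mono) auto
  finally have 2: "- (e \<bullet> \<nu>) \<le> t\<^sup>2 * (t * (C * norm \<nu>))"
    by (simp add: power2_eq_square power3_eq_cube algebra_simps)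
  have "2 * (w \<bullet> \<nu>) = t\<^sup>2 * (2 * (B \<bullet> \<nu>)) + 2 * (e \<bullet> \<nu>)" by (simp add: w_def inner_add_left)
  then have "t\<^sup>2 * (2 * (B \<bullet> \<nu>)) \<le> t\<^sup>2 * (t * E)" using 1 2 by (simp add: E_def algebra_simps)
  then have "2 * (B \<bullet> \<nu>) \<le> t * E" using t by (simp add: mult_le_cancel_left_pos)
  also have "\<dots> \<le> t * (E + 1)" using t by simp
  also have "\<dots> \<le> B \<bullet> \<nu>" using t(4) E by (simp add: field_simps)
  finally show False using pos by simp
qed

section \<open>Lie brackets and modules of tangent fields\<close>

lemma tangent_field_minus: "tangent_field F S X \<Longrightarrow> tangent_field F S (\<lambda>x. - X x)"
  by (simp add: tangent_field_def)

text \<open>Moving along \<open>X\<close>, \<open>Y\<close>, \<open>- X\<close>, \<open>- Y\<close>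
  in this order cancels the first-order term and leaves the bracket at second order. Exchanging
  \<open>X\<close> and \<open>Y\<close> later gives the reverse inequality.\<close>

lemma bracket_normal_le:
  fixes X Y :: "real^'n::finite \<Rightarrow> real^'n"
  assumes F: "closed F" and S: "open S" and X: "smooth_on S X" "tangent_field F S X"
    and Y: "smooth_on S Y" "tangent_field F S Y"
    and z: "z \<in> F" "z \<in> S" and \<nu>: "ball (z + \<nu>) (norm \<nu>) \<inter> F = {}"
  shows "lie_bracket X Y z \<bullet> \<nu> \<le> 0"
proof (rule reaches_normal[OF _ \<nu>])
  note step = reaches_step[OF F z S]
  have neg: "frechet_derivative (\<lambda>x. - X x) (at z) = (\<lambda>v. - frechet_derivative X (at z) v)"
    if "smooth_on S X" for X :: "real^'n \<Rightarrow> real^'n"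
    using frechet_derivative_at[OF has_derivative_minus[OF smooth_on_has_derivative[OF that z(2)]]] by simp
  have sm: "smooth_on S (\<lambda>x. - X x)" if "smooth_on S X" for X :: "real^'n \<Rightarrow> real^'n"
    using smooth_on_bounded_linear[OF bounded_linear_minus[OF bounded_linear_ident] S that] .
  let ?X = "frechet_derivative X (at z)" and ?Y = "frechet_derivative Y (at z)"
  have lX: "linear ?X" and lY: "linear ?Y" using X Y z smooth_on_linear_frechet by blast+
  have "reaches F z 0 0" unfolding reaches_def using z by (intro exI[of _ 0] exI[of _ 1]) (auto intro!: bexI[of _ z])
  from step[OF sm[OF Y(1)] tangent_field_minus[OF Y(2)]
      step[OF sm[OF X(1)] tangent_field_minus[OF X(2)] step[OF Y step[OF X this]]]]
  have "reaches F z 0 (- ?X (X z + Y z) + ?Y (X z) + ?X (X z) + ?Y (Y z) - ?Y (Y z))"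
    by (simp add: neg X(1) Y(1) linear_0[OF lX] linear_0[OF lY] linear_neg[OF lX] linear_neg[OF lY] algebra_simps flip: scaleR_add_left)
  then show "reaches F z 0 (lie_bracket X Y z)"
    by (simp add: lie_bracket_def linear_add[OF lX])
qed

lemma tangent_field_bracket:
  fixes X Y :: "real^'n::finite \<Rightarrow> real^'n"
  assumes "closed F" "open S" "smooth_on S X" "tangent_field F S X" "smooth_on S Y" "tangent_field F S Y"
  shows "tangent_field F S (lie_bracket X Y)"
proof -
  have "lie_bracket X Y z \<bullet> \<nu> = 0" if "z \<in> F" "z \<in> S" "ball (z + \<nu>) (norm \<nu>) \<inter> F = {}" for z \<nu>
    using bracket_normal_le[OF assms that] bracket_normal_le[OF assms(1,2,5,6,3,4) that]
    by (simp add: lie_bracket_def inner_diff_left)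
  then show ?thesis by (auto simp: tangent_field_def)
qed

lemma smooth_on_directional_derivative:
  fixes X :: "'a::real_normed_vector \<Rightarrow> 'b::euclidean_space" and f :: "'b \<Rightarrow> 'c::real_normed_vector"
  assumes "open S" "smooth_on S X" "\<And>v. smooth_on S (\<lambda>x. D x v)" "\<And>x. x \<in> S \<Longrightarrow> linear (D x)"
  shows "smooth_on S (\<lambda>x. D x (X x))"
proof -
  have "(\<Sum>i\<in>Basis. (X x \<bullet> i) *\<^sub>R D x i) = D x (X x)" if "x \<in> S" for x
  proof -
    have "D x (X x) = D x (\<Sum>i\<in>Basis. (X x \<bullet> i) *\<^sub>R i)" by (simp add: euclidean_representation)
    then show ?thesis
      using linear_sum[OF assms(4)[OF that], of "\<lambda>i. (X x \<bullet> i) *\<^sub>R i" Basis]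
        linear_cmul[OF assms(4)[OF that]] by simp
  qed
  then show ?thesis
    by (rule smooth_on_cong[OF assms(1)])
      (auto intro!: smooth_on_sum smooth_on_scaleR smooth_on_inner smooth_on_const assms)
qed

lemma smooth_on_lie_bracket:
  fixes X Y :: "real^'n::finite \<Rightarrow> real^'n"
  assumes "open S" "smooth_on S X" "smooth_on S Y"
  shows "smooth_on S (lie_bracket X Y)"
proof -
  have "smooth_on S (\<lambda>x. frechet_derivative f (at x) (g x))"
    if "smooth_on S f" "smooth_on S g" for f g :: "real^'n \<Rightarrow> real^'n"
    by (rule smooth_on_directional_derivative[where D = "\<lambda>x. frechet_derivative f (at x)",
          OF assms(1) that(2) smooth_on_frechet_derivative[OF that(1)] smooth_on_linear_frechet[OF that(1)]])
  from this[OF assms(3,2)] this[OF assms(2,3)] show ?thesis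
    unfolding lie_bracket_def[abs_def] by (intro smooth_on_diff assms(1))
qed

text \<open>Smoothness is carried through the induction because the bracket step needs it. The
  module is taken over \<open>V\<close>, whereas tangency may be known only on the smaller set
  \<open>S\<close>.\<close>

lemma lie_module_tangent:
  fixes X :: "real^'n::finite \<Rightarrow> real^'n"
  assumes F: "closed F" and V: "open V" and S: "open S" "S \<subseteq> V"
    and gen: "\<And>X. X \<in> G \<Longrightarrow> smooth_on V X \<and> tangent_field F S X"
    and X: "X \<in> lie_module V G"
  shows "smooth_on V X \<and> tangent_field F S X"
  using X
proof induction
  case (bracket X Y)
  then have "smooth_on S X" "smooth_on S Y" using S smooth_on_subset by blast+
  then show ?case using bracket V F S(1) by (auto intro: tangent_field_bracket smooth_on_lie_bracket)
next
  case (scale f X)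
  then show ?case using V by (auto intro!: smooth_on_scaleR simp: tangent_field_def)
next
  case (add X Y)
  then show ?case using V by (auto intro!: smooth_on_add simp: tangent_field_def inner_add_left)
next
  case zero
  then show ?case using V by (auto intro!: smooth_on_const simp: tangent_field_def)
qed (use gen in blast)


subsection \<open>Hopf's barrier argument\<close>

lemma sum_insert_square:
  fixes f :: "'i \<Rightarrow> 'i \<Rightarrow> real"
  assumes "finite I" "k \<notin> I"
  shows "(\<Sum>i\<in>insert k I. \<Sum>j\<in>insert k I. f i j) =
    f k k + (\<Sum>i\<in>I. f k i + f i k) + (\<Sum>i\<in>I. \<Sum>j\<in>I. f i j)"
  using assms by (simp add: sum.distrib)

text \<open>Symmetric elimination on \<open>a\<close>, one index at a time: the rank-one part
  through the pivot \<open>a k k\<close> pairs with \<open>b\<close> to a value of the form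
  \<open>b\<close> divided by the pivot, and the remainder is the Schur complement on
  \<open>I\<close>. A zero pivot forces its whole row to vanish.\<close>

lemma trace_mult_psd_nonneg:
  fixes a b :: "'i \<Rightarrow> 'i \<Rightarrow> real"
  assumes "finite I"
    and "\<And>i j. i \<in> I \<Longrightarrow> j \<in> I \<Longrightarrow> a i j = a j i"
    and "\<And>c. (\<Sum>i\<in>I. \<Sum>j\<in>I. a i j * c i * c j) \<ge> 0"
    and "\<And>c. (\<Sum>i\<in>I. \<Sum>j\<in>I. b i j * c i * c j) \<ge> 0"
  shows "(\<Sum>i\<in>I. \<Sum>j\<in>I. a i j * b i j) \<ge> 0"
  using assms
proof (induction I arbitrary: a rule: finite_induct)
  case (insert k I)
  note split = sum_insert_square[OF insert.hyps(1,2)]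
  have sym: "a i j = a j i" if "i \<in> insert k I" "j \<in> insert k I" for i j
    using insert.prems(1) that by blast
  have restrict: "(\<Sum>i\<in>I. \<Sum>j\<in>I. h i j * c i * c j) \<ge> 0"
    if "\<And>c. (\<Sum>i\<in>insert k I. \<Sum>j\<in>insert k I. h i j * c i * c j) \<ge> 0" for h :: "'i \<Rightarrow> 'i \<Rightarrow> real" and c
  proof -
    have "(\<Sum>i\<in>I. \<Sum>j\<in>I. h i j * (c(k := 0)) i * (c(k := 0)) j) = (\<Sum>i\<in>I. \<Sum>j\<in>I. h i j * c i * c j)"
      using insert.hyps by (intro sum.cong) auto
    then show ?thesis using that[of "c(k := 0)"] unfolding split by simp
  qed
  have b: "(\<Sum>i\<in>I. \<Sum>j\<in>I. b i j * c i * c j) \<ge> 0" for c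
    using restrict insert.prems(3) by blast
  have akk: "a k k \<ge> 0"
  proof -
    define c where "c = (\<lambda>i. if i = k then 1 else (0::real))"
    have 1: "(\<Sum>i\<in>I. a k i * c k * c i + a i k * c i * c k) = 0"
      using insert.hyps by (intro sum.neutral) (auto simp: c_def)
    have 2: "(\<Sum>i\<in>I. \<Sum>j\<in>I. a i j * c i * c j) = 0"
      using insert.hyps by (intro sum.neutral ballI) (auto simp: c_def)
    show ?thesis
      using insert.prems(2)[of c] unfolding split 1 2 by (simp add: c_def)
  qed
  show ?case
  proof (cases "a k k = 0")
    case True
    have z: "a k l = 0" if l: "l \<in> I" for l
    proof -
      have lk: "l \<noteq> k" using l insert.hyps by blast
      \<comment> \<open>With a zero pivot the form, evaluated with entry \<open>t\<close> at
        \<open>k\<close> and 1 at \<open>l\<close>, is affine in \<open>t\<close>; being nonnegative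
        for every \<open>t\<close>, it has slope zero.\<close>
      have nn: "a l l + 2 * t * a k l \<ge> 0" for t
      proof -
        define c where "c = (\<lambda>i. if i = k then t else if i = l then 1 else 0)"
        have 1: "(\<Sum>i\<in>I. a k i * c k * c i + a i k * c i * c k) = (\<Sum>i\<in>{l}. a k i * c k * c i + a i k * c i * c k)"
          using insert.hyps l by (intro sum.mono_neutral_right) (auto simp: c_def)
        have 2: "(\<Sum>i\<in>I. \<Sum>j\<in>I. a i j * c i * c j) = (\<Sum>i\<in>{l}. \<Sum>j\<in>I. a i j * c i * c j)"
          using insert.hyps l by (intro sum.mono_neutral_right) (auto simp: c_def intro!: sum.neutral)
        have 3: "(\<Sum>j\<in>I. a l j * c l * c j) = (\<Sum>j\<in>{l}. a l j * c l * c j)"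
          using insert.hyps l by (intro sum.mono_neutral_right) (auto simp: c_def)
        show ?thesis
          using insert.prems(2)[of c] sym[of l k] l True unfolding split 1 2
          by (simp add: 3) (simp add: c_def lk algebra_simps)
      qed
      show ?thesis
      proof (rule ccontr)
        assume n: "a k l \<noteq> 0"
        have "2 * (- (a l l + 1) / (2 * a k l)) * a k l = - (a l l + 1)" using n by (simp add: field_simps)
        then show False using nn[of "- (a l l + 1) / (2 * a k l)"] by linarith
      qed
    qed
    have "(\<Sum>i\<in>I. \<Sum>j\<in>I. a i j * b i j) \<ge> 0"
      using restrict[OF insert.prems(2)] b sym by (intro insert.IH) auto
    moreover have "a l k = 0" if "l \<in> I" for l using z[OF that] sym[of l k] that by simp
    ultimately show ?thesis unfolding split using True z by simp
  next
    case False
    then have pos: "a k k > 0" using akk by simp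
    define a' where "a' = (\<lambda>i j. a i j - a k i * a k j / a k k)"
    have "(\<Sum>i\<in>I. \<Sum>j\<in>I. a' i j * c i * c j) \<ge> 0" for c
    proof -
      define s where "s = (\<Sum>j\<in>I. a k j * c j)"
      \<comment> \<open>The entry at \<open>k\<close> that minimises the form for given entries on
        \<open>I\<close>; completing the square leaves the Schur complement.\<close>
      let ?c = "c(k := - s / a k k)"
      have "(\<Sum>i\<in>I. a k i * ?c k * ?c i + a i k * ?c i * ?c k) = (\<Sum>i\<in>I. 2 * ?c k * (a k i * c i))"
        using insert.hyps sym by (intro sum.cong) auto
      also have "\<dots> = 2 * ?c k * s" by (simp add: s_def sum_distrib_left)
      finally have 1: "(\<Sum>i\<in>I. a k i * ?c k * ?c i + a i k * ?c i * ?c k) = 2 * ?c k * s" .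
      have 2: "(\<Sum>i\<in>I. \<Sum>j\<in>I. a i j * ?c i * ?c j) = (\<Sum>i\<in>I. \<Sum>j\<in>I. a i j * c i * c j)"
        using insert.hyps by (intro sum.cong) auto
      have "s * s / a k k = (\<Sum>i\<in>I. \<Sum>j\<in>I. a k i * a k j / a k k * c i * c j)"
        unfolding s_def sum_product sum_divide_distrib by (intro sum.cong) auto
      then have "(\<Sum>i\<in>I. \<Sum>j\<in>I. a' i j * c i * c j) = (\<Sum>i\<in>I. \<Sum>j\<in>I. a i j * c i * c j) - s * s / a k k"
        unfolding a'_def by (simp add: left_diff_distrib sum_subtractf)
      also have "\<dots> = (\<Sum>i\<in>insert k I. \<Sum>j\<in>insert k I. a i j * ?c i * ?c j)"
        unfolding split 1 2 using pos by (simp add: field_simps)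
      also have "\<dots> \<ge> 0" by (rule insert.prems(2))
      finally show ?thesis .
    qed
    moreover have "a' i j = a' j i" if "i \<in> I" "j \<in> I" for i j
      using sym that by (simp add: a'_def)
    ultimately have 1: "(\<Sum>i\<in>I. \<Sum>j\<in>I. a' i j * b i j) \<ge> 0"
      using b by (intro insert.IH) auto
    have "(\<Sum>i\<in>insert k I. \<Sum>j\<in>insert k I. a k i * a k j / a k k * b i j) =
      (\<Sum>i\<in>insert k I. \<Sum>j\<in>insert k I. b i j * a k i * a k j) / a k k"
      unfolding sum_divide_distrib by (intro sum.cong) auto
    also have "\<dots> \<ge> 0" using insert.prems(3) pos by simp
    finally have 2: "(\<Sum>i\<in>insert k I. \<Sum>j\<in>insert k I. a k i * a k j / a k k * b i j) \<ge> 0" .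
    have "(\<Sum>i\<in>insert k I. \<Sum>j\<in>insert k I. a i j * b i j) =
      (\<Sum>i\<in>insert k I. \<Sum>j\<in>insert k I. a k i * a k j / a k k * b i j + a' i j * b i j)"
      by (simp only: a'_def) (simp add: algebra_simps)
    also have "\<dots> = (\<Sum>i\<in>insert k I. \<Sum>j\<in>insert k I. a k i * a k j / a k k * b i j) +
        (\<Sum>i\<in>insert k I. \<Sum>j\<in>insert k I. a' i j * b i j)"
      by (simp only: sum.distrib)
    also have "(\<Sum>i\<in>insert k I. \<Sum>j\<in>insert k I. a' i j * b i j) = (\<Sum>i\<in>I. \<Sum>j\<in>I. a' i j * b i j)"
    proof -
      have "a' k i = 0" "a' i k = 0" if "i \<in> insert k I" for i
        using pos sym that by (auto simp: a'_def)
      then show ?thesis unfolding split by simp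
    qed
    finally show ?thesis using 1 2 by simp
  qed
qed simp

lemma second_derivative_at_minimum:
  fixes g :: "'a::real_normed_vector \<Rightarrow> real"
  assumes "open S" "x \<in> S" and g: "\<And>y. y \<in> S \<Longrightarrow> (g has_derivative g' y) (at y)"
    and g'': "((\<lambda>y. g' y v) has_derivative g'') (at x)" and min: "\<And>y. y \<in> S \<Longrightarrow> g x \<le> g y"
  shows "g'' v \<ge> 0"
proof (rule ccontr)
  assume neg: "\<not> g'' v \<ge> 0"
  have "g' x = (\<lambda>v. 0)"
    using differential_zero_maxmin[OF assms(2,1) g[OF assms(2)]] min by blast
  then have 0: "g' (x + 0 *\<^sub>R v) v = 0" by simp
  have line: "((\<lambda>t. x + t *\<^sub>R v) has_derivative (\<lambda>t. t *\<^sub>R v)) (at t)" for t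
    by (auto intro!: derivative_eq_intros)
  have "((\<lambda>t. g' (x + t *\<^sub>R v) v) has_derivative (\<lambda>t. g'' (t *\<^sub>R v))) (at 0)"
    using has_derivative_compose[OF line[of 0], of "\<lambda>y. g' y v" g''] g'' by simp
  then have "((\<lambda>t. g' (x + t *\<^sub>R v) v) has_real_derivative g'' v) (at 0)"
    using has_derivative_linear[OF g''] by (simp add: has_field_derivative_def linear_cmul mult_commute_abs)
  from DERIV_neg_dec_right[OF this] neg 0 obtain d where d: "d > 0"
    "\<And>h. 0 < h \<Longrightarrow> h < d \<Longrightarrow> g' (x + h *\<^sub>R v) v < 0" by auto
  have "open ((\<lambda>t. x + t *\<^sub>R v) -` S)"
    by (intro open_vimage assms continuous_intros)
  then obtain e where e: "e > 0" "ball 0 e \<subseteq> (\<lambda>t. x + t *\<^sub>R v) -` S"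
    using assms(2) open_contains_ball[of "(\<lambda>t. x + t *\<^sub>R v) -` S"] by force
  define h where "h = min d e / 2"
  have h: "0 < h" "h < d" "h < e" using d e by (auto simp: h_def)
  have inS: "x + t *\<^sub>R v \<in> S" if "0 \<le> t" "t \<le> h" for t
    using e(2) that h by (auto simp: subset_iff dist_real_def)
  have D: "((\<lambda>t. g (x + t *\<^sub>R v)) has_real_derivative g' (x + t *\<^sub>R v) v) (at t)" if "0 \<le> t" "t \<le> h" for t
    using has_derivative_compose[OF line[of t] g[OF inS[OF that]]] has_derivative_linear[OF g[OF inS[OF that]]]
    by (simp add: has_field_derivative_def linear_cmul mult_commute_abs)
  have "\<exists>t. 0 < t \<and> t < h \<and> g (x + h *\<^sub>R v) - g (x + 0 *\<^sub>R v) = (h - 0) * g' (x + t *\<^sub>R v) v"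
    using h D by (intro MVT2) auto
  then obtain t where t: "0 < t" "t < h" "g (x + h *\<^sub>R v) - g x = h * g' (x + t *\<^sub>R v) v" by auto
  moreover have "h * g' (x + t *\<^sub>R v) v < 0" using d(2)[of t] t h by (simp add: mult_pos_neg)
  ultimately show False using min[OF inS[of h]] h by simp
qed

lemma inner_linear_expand:
  fixes A :: "'a::euclidean_space \<Rightarrow> 'a"
  assumes "linear A"
  shows "d \<bullet> A d = (\<Sum>i\<in>Basis. \<Sum>j\<in>Basis. (i \<bullet> A j) * (d \<bullet> i) * (d \<bullet> j))"
proof -
  have "A d = A (\<Sum>j\<in>Basis. (d \<bullet> j) *\<^sub>R j)" by (simp add: euclidean_representation)
  also have "\<dots> = (\<Sum>j\<in>Basis. (d \<bullet> j) *\<^sub>R A j)"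
    using linear_sum[OF assms, of "\<lambda>j. (d \<bullet> j) *\<^sub>R j" Basis] linear_cmul[OF assms] by simp
  finally have *: "A d = (\<Sum>j\<in>Basis. (d \<bullet> j) *\<^sub>R A j)" .
  have "d \<bullet> A d = (\<Sum>i\<in>Basis. (d \<bullet> i) * (A d \<bullet> i))" by (rule euclidean_inner)
  also have "\<dots> = (\<Sum>i\<in>Basis. \<Sum>j\<in>Basis. (i \<bullet> A j) * (d \<bullet> i) * (d \<bullet> j))"
    unfolding * inner_sum_left sum_distrib_left
    by (intro sum.cong) (simp_all add: inner_commute algebra_simps)
  finally show ?thesis .
qed

abbreviation second_derivative :: "('a::real_normed_vector \<Rightarrow> real) \<Rightarrow> 'a \<Rightarrow> 'a \<Rightarrow> 'a \<Rightarrow> real" where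
  "second_derivative u x v w \<equiv> frechet_derivative (\<lambda>y. frechet_derivative u (at y) v) (at x) w"

lemma second_derivative_bilinear:
  fixes u :: "'a::euclidean_space \<Rightarrow> real"
  assumes S: "open S" "x \<in> S" and u: "smooth_on S u"
  shows "second_derivative u x v v =
    (\<Sum>i\<in>Basis. \<Sum>j\<in>Basis. second_derivative u x i j * (v \<bullet> i) * (v \<bullet> j))"
proof -
  let ?D = "\<lambda>v. second_derivative u x v"
  have D: "((\<lambda>y. frechet_derivative u (at y) v) has_derivative ?D v) (at x)" for v
    using smooth_on_has_derivative[OF smooth_on_frechet_derivative[OF u] S(2)] .
  have "((\<lambda>y. \<Sum>i\<in>Basis. (v \<bullet> i) * frechet_derivative u (at y) i) has_derivative
      (\<lambda>w. \<Sum>i\<in>Basis. (v \<bullet> i) * ?D i w)) (at x)"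
    by (intro has_derivative_sum has_derivative_mult_right D)
  then have "((\<lambda>y. frechet_derivative u (at y) v) has_derivative (\<lambda>w. \<Sum>i\<in>Basis. (v \<bullet> i) * ?D i w)) (at x)"
  proof (rule has_derivative_transform_within_open[OF _ S])
    fix y assume "y \<in> S"
    then have l: "linear (frechet_derivative u (at y))" using u smooth_on_linear_frechet by blast
    have "frechet_derivative u (at y) v = frechet_derivative u (at y) (\<Sum>i\<in>Basis. (v \<bullet> i) *\<^sub>R i)"
      by (simp add: euclidean_representation)
    then show "(\<Sum>i\<in>Basis. (v \<bullet> i) * frechet_derivative u (at y) i) = frechet_derivative u (at y) v"
      using linear_sum[OF l, of "\<lambda>i. (v \<bullet> i) *\<^sub>R i" Basis] linear_cmul[OF l] by simp
  qed
  from fun_cong[OF frechet_derivative_at[OF this], of v, symmetric]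
  have "?D v v = (\<Sum>i\<in>Basis. (v \<bullet> i) * ?D i v)" .
  moreover have "?D i v = (\<Sum>j\<in>Basis. ?D i j * (v \<bullet> j))" for i
  proof -
    have l: "linear (?D i)" using D has_derivative_linear by blast
    have "?D i v = ?D i (\<Sum>j\<in>Basis. (v \<bullet> j) *\<^sub>R j)" by (simp add: euclidean_representation)
    also have "\<dots> = (\<Sum>j\<in>Basis. ?D i j * (v \<bullet> j))"
      using linear_sum[OF l, of "\<lambda>j. (v \<bullet> j) *\<^sub>R j" Basis] linear_cmul[OF l] by (simp add: mult.commute)
    finally show ?thesis .
  qed
  ultimately show ?thesis by (simp add: sum_distrib_left mult_ac)
qed

lemma double_sum_diff:
  fixes f g :: "'i \<Rightarrow> 'j \<Rightarrow> real"
  shows "(\<Sum>i\<in>I. \<Sum>j\<in>J. c * f i j - d * g i j) = c * (\<Sum>i\<in>I. \<Sum>j\<in>J. f i j) - d * (\<Sum>i\<in>I. \<Sum>j\<in>J. g i j)"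
  by (simp add: sum_subtractf sum_distrib_left)

text \<open>Hopf's barrier argument; since the minimum value is zero, the sign of the zeroth-order
  coefficient is irrelevant.\<close>

lemma hopf_normal_degenerate:
  fixes u :: "'a::euclidean_space \<Rightarrow> real" and A :: "'a \<Rightarrow> 'a \<Rightarrow> 'a"
  assumes S: "open S" and u: "smooth_on S u" and u0: "\<And>x. x \<in> S \<Longrightarrow> u x \<ge> 0"
    and A: "\<And>x. x \<in> S \<Longrightarrow> linear (A x)" "\<And>x v w. x \<in> S \<Longrightarrow> v \<bullet> A x w = w \<bullet> A x v"
      "\<And>x v. x \<in> S \<Longrightarrow> v \<bullet> A x v \<ge> 0" "\<And>v. continuous_on S (\<lambda>x. A x v)"
    and C: "C \<ge> 0"
    and L: "\<And>x. x \<in> S \<Longrightarrow> (\<Sum>i\<in>Basis. \<Sum>j\<in>Basis. (i \<bullet> A x j) * second_derivative u x i j)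
      \<le> C * ((\<Sum>i\<in>Basis. \<bar>frechet_derivative u (at x) i\<bar>) + u x)"
    and F: "\<And>x. x \<in> S \<Longrightarrow> u x = 0 \<Longrightarrow> x \<in> F"
    and z: "z \<in> S" "u z = 0" and \<nu>: "ball (z + \<nu>) (norm \<nu>) \<inter> F = {}"
  shows "\<nu> \<bullet> A z \<nu> = 0"
proof (rule ccontr)
  assume neq: "\<nu> \<bullet> A z \<nu> \<noteq> 0"
  \<comment> \<open>The ball about \<open>y\<close> of radius \<open>R\<close> has half the radius
    of the exterior ball and touches it from inside at \<open>z\<close>; hence \<open>z\<close> is
    the only point of \<open>cball y R\<close> that \<open>F\<close> can contain.\<close>
  define y where "y = z + (1 / 2) *\<^sub>R \<nu>"
  define R where "R = norm \<nu> / 2"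
  define q where "q = (\<lambda>x. (x - y) \<bullet> A x (x - y))"
  define T where "T = (\<lambda>x. \<Sum>i\<in>Basis. i \<bullet> A x i)"
  have pos: "q z > 0"
    using neq A(3)[OF z(1), of \<nu>] linear_cmul[OF A(1)[OF z(1)], of "-(1/2)" \<nu>]
    by (simp add: q_def y_def)
  have qexp: "q x = (\<Sum>i\<in>Basis. \<Sum>j\<in>Basis. (i \<bullet> A x j) * ((x - y) \<bullet> i) * ((x - y) \<bullet> j))" if "x \<in> S" for x
    unfolding q_def by (rule inner_linear_expand[OF A(1)[OF that]])
  have "continuous_on S (\<lambda>x. \<Sum>i\<in>Basis. \<Sum>j\<in>Basis. (i \<bullet> A x j) * ((x - y) \<bullet> i) * ((x - y) \<bullet> j))"
    by (intro continuous_intros A(4))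
  then have "continuous_on S q" using qexp by (simp cong: continuous_on_cong)
  then have "isCont q z" using S z(1) continuous_on_eq_continuous_at by blast
  then have "\<forall>\<^sub>F x in at z. q x > q z / 2"
    using pos by (intro order_tendstoD(1)[of q "q z"]) (auto simp: isCont_def)
  then obtain r1 where r1: "r1 > 0" "\<And>x. x \<noteq> z \<Longrightarrow> dist x z < r1 \<Longrightarrow> q x > q z / 2"
    unfolding eventually_at by auto
  obtain r2 where r2: "r2 > 0" "cball z r2 \<subseteq> S" using S z(1) open_contains_cball by blast
  define \<delta> where "\<delta> = q z / 2"
  define r where "r = min (r1 / 2) r2"
  have r: "r > 0" "cball z r \<subseteq> S" using r1 r2 by (auto simp: r_def)
  have \<delta>: "\<delta> > 0" "\<And>x. x \<in> cball z r \<Longrightarrow> q x \<ge> \<delta>"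
  proof -
    show "\<delta> > 0" using pos by (simp add: \<delta>_def)
    show "q x \<ge> \<delta>" if "x \<in> cball z r" for x
      using r1 that pos by (cases "x = z") (force simp: \<delta>_def r_def dist_commute)+
  qed
  have "continuous_on (cball z r) T"
    unfolding T_def by (intro continuous_intros continuous_on_subset[OF A(4) r(2)])
  then have "bounded (T ` cball z r)"
    using compact_continuous_image compact_imp_bounded compact_cball by blast
  then obtain T0' where T0': "\<forall>t\<in>T ` cball z r. norm t \<le> T0'" unfolding bounded_iff by (rule exE)
  define T0 where "T0 = max T0' 0"
  have T0: "T0 \<ge> 0" "\<And>x. x \<in> cball z r \<Longrightarrow> T x \<le> T0" using T0' by (auto simp: T0_def intro!: max.coboundedI1 dest: abs_le_D1)
  define Y where "Y = real DIM('a) * (R + r)"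
  have Y: "Y \<ge> 0" using r by (simp add: Y_def R_def)
  \<comment> \<open>Collects the lower-order contributions in units of \<alpha>:
    \<open>2 * T0\<close> from the trace term of the barrier, \<open>2 * C * Y\<close> from the
    gradient, \<open>C\<close> from the value of \<open>u\<close>. Against the leading term
    \<open>4 * \<alpha>\<^sup>2 * \<delta>\<close> they lose once \<alpha> is large.\<close>
  define K where "K = 2 * T0 + 2 * C * Y + C"
  have K: "K \<ge> 0" unfolding K_def using T0 C Y by simp
  define \<alpha> where "\<alpha> = max 1 ((K + 1) / (4 * \<delta>))"
  have \<alpha>: "\<alpha> \<ge> 1" "4 * \<alpha> * \<delta> > K"
  proof -
    have "(K + 1) / (4 * \<delta>) \<le> \<alpha>" by (simp add: \<alpha>_def)
    then have "K + 1 \<le> \<alpha> * (4 * \<delta>)" using \<delta>(1) by (simp add: pos_divide_le_eq)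
    then show "4 * \<alpha> * \<delta> > K" by (simp add: algebra_simps)
  qed (simp add: \<alpha>_def)
  define E where "E = (\<lambda>x. exp (- \<alpha> * ((x - y) \<bullet> (x - y))))"
  define w where "w = (\<lambda>x. E x - exp (- \<alpha> * R\<^sup>2))"
  define w1 where "w1 = (\<lambda>x v. - 2 * \<alpha> * ((x - y) \<bullet> v) * E x)"
  define w2 where "w2 = (\<lambda>x v h. (4 * \<alpha>\<^sup>2 * ((x - y) \<bullet> v) * ((x - y) \<bullet> h) - 2 * \<alpha> * (v \<bullet> h)) * E x)"
  have E': "(E has_derivative w1 x) (at x)" for x
    unfolding E_def w1_def
    by (rule has_derivative_eq_rhs, (rule derivative_intros)+) (auto simp: inner_commute algebra_simps fun_eq_iff)
  then have w': "(w has_derivative w1 x) (at x)" for x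
    unfolding w_def using has_derivative_diff[OF E' has_derivative_const] by simp
  have w'': "((\<lambda>x. w1 x v) has_derivative w2 x v) (at x)" for x v
    unfolding w1_def
    by (rule has_derivative_eq_rhs, (rule derivative_intros E')+)
      (auto simp: w1_def w2_def inner_commute power2_eq_square algebra_simps fun_eq_iff)
  have E1: "0 < E x" "E x \<le> 1" for x using \<alpha> by (simp_all add: E_def)
  have wE: "w x < E x" for x by (simp add: w_def)
  have wcont: "continuous_on X w" for X
    by (intro continuous_at_imp_continuous_on ballI has_derivative_continuous[OF w'])
  have inside: "x \<in> ball (z + \<nu>) (norm \<nu>)" if "x \<in> cball y R" "x \<noteq> z" for x
  proof -
    define d where "d = x - z"
    have "norm (d - (1 / 2) *\<^sub>R \<nu>) \<le> norm \<nu> / 2"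
      using that(1) by (simp add: d_def y_def R_def dist_norm norm_minus_commute algebra_simps)
    then have "(norm (d - (1 / 2) *\<^sub>R \<nu>))\<^sup>2 \<le> (norm \<nu> / 2)\<^sup>2" by (intro power_mono) auto
    then have "d \<bullet> d \<le> d \<bullet> \<nu>"
      by (simp add: power2_norm_eq_inner power_divide inner_diff_left inner_diff_right inner_commute)
    moreover have "d \<bullet> d > 0" using that(2) by (simp add: d_def)
    ultimately have "d \<bullet> d < 2 * (d \<bullet> \<nu>)" by linarith
    then have "(norm (d - \<nu>))\<^sup>2 < (norm \<nu>)\<^sup>2"
      by (simp add: power2_norm_eq_inner inner_diff_left inner_diff_right inner_commute)
    then have "norm (d - \<nu>) < norm \<nu>" by (rule power_less_imp_less_base) simp
    then show ?thesis by (simp add: d_def dist_norm norm_minus_commute algebra_simps)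
  qed
  have outside: "w x < 0" if "x \<notin> cball y R" for x
  proof -
    have "R < norm (x - y)" using that by (simp add: dist_norm norm_minus_commute)
    then have "R\<^sup>2 < (norm (x - y))\<^sup>2" by (intro power_strict_mono) (auto simp: R_def)
    then show ?thesis using \<alpha>(1) by (simp add: w_def E_def power2_norm_eq_inner)
  qed
  have ucont: "continuous_on (cball z r) u"
    using smooth_on_continuous[OF u] r(2) continuous_on_subset by blast
  \<comment> \<open>On the sphere outside \<open>cball y R\<close> the barrier is negative and
    \<open>u \<ge> 0\<close> suffices. On the rest, \<open>u\<close> has a positive lower bound by
    compactness, and this fixes the size of \<epsilon>.\<close>
  obtain \<mu> where \<mu>: "\<mu> > 0" "\<And>x. x \<in> sphere z r \<inter> cball y R \<Longrightarrow> u x \<ge> \<mu>"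
  proof (cases "sphere z r \<inter> cball y R = {}")
    case True
    then show ?thesis using that[of 1] by auto
  next
    case False
    have "compact (sphere z r \<inter> cball y R)" by (intro compact_Int_closed) auto
    moreover have "continuous_on (sphere z r \<inter> cball y R) u"
      by (rule continuous_on_subset[OF ucont]) auto
    ultimately obtain x where x: "x \<in> sphere z r \<inter> cball y R" "\<And>x'. x' \<in> sphere z r \<inter> cball y R \<Longrightarrow> u x \<le> u x'"
      using continuous_attains_inf False by metis
    have "x \<noteq> z" "x \<in> S" using x(1) r by auto
    then have "u x \<noteq> 0" using inside[of x] x(1) \<nu> F[of x] by auto
    then have "u x > 0" using u0[OF \<open>x \<in> S\<close>] by simp
    then show ?thesis using that x(2) by blast
  qed
  define \<epsilon> where "\<epsilon> = \<mu> / 2"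
  have \<epsilon>: "\<epsilon> > 0" "\<epsilon> < \<mu>" using \<mu> by (auto simp: \<epsilon>_def)
  \<comment> \<open>\<open>g\<close> vanishes at \<open>z\<close> and is positive on the sphere, so
    its minimum over the closed ball is attained inside, at some \<open>x\<close> with
    \<open>g x \<le> 0\<close>. The first- and second-order conditions at \<open>x\<close> compare
    the derivatives of \<open>u\<close> with those of the barrier.\<close>
  define g where "g = (\<lambda>x. u x - \<epsilon> * w x)"
  have sphere: "g x > 0" if x: "x \<in> sphere z r" for x
  proof (cases "x \<in> cball y R")
    case True
    have "\<epsilon> * w x \<le> \<epsilon> * 1" using \<epsilon> wE[of x] E1[of x] by (intro mult_left_mono) auto
    moreover have "\<mu> \<le> u x" using \<mu>(2)[of x] True x by blast
    ultimately show ?thesis unfolding g_def using \<epsilon> by linarith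
  next
    case False
    then have "\<epsilon> * w x < 0" using outside \<epsilon> by (simp add: mult_pos_neg)
    moreover have "u x \<ge> 0" using u0 r x by auto
    ultimately show ?thesis by (simp add: g_def)
  qed
  have gz: "g z = 0" using z by (simp add: g_def w_def E_def y_def R_def power2_norm_eq_inner power_divide power2_eq_square flip: power2_norm_eq_inner)
  have "continuous_on (cball z r) g" unfolding g_def by (intro continuous_intros ucont wcont)
  then obtain x where x: "x \<in> cball z r" and xmin: "\<And>x'. x' \<in> cball z r \<Longrightarrow> g x \<le> g x'"
    using continuous_attains_inf[OF compact_cball, of z r g] r by fastforce
  have gx: "g x \<le> 0" using xmin[of z] gz r by simp
  have "x \<notin> sphere z r" using sphere gx by force
  then have xb: "x \<in> ball z r" using x by (simp add: less_le)
  have xS: "x \<in> S" using x r by blast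
  have bS: "ball z r \<subseteq> S" using r(2) ball_subset_cball by blast
  note u' = smooth_on_has_derivative[OF u]
  have g': "(g has_derivative (\<lambda>v. frechet_derivative u (at x) v - \<epsilon> * w1 x v)) (at x)" if "x \<in> ball z r" for x
    unfolding g_def using that bS by (intro has_derivative_diff has_derivative_mult_right u' w') auto
  have g'': "((\<lambda>x. frechet_derivative u (at x) v - \<epsilon> * w1 x v) has_derivative
      (\<lambda>h. second_derivative u x v h - \<epsilon> * w2 x v h)) (at x)" for v
    using xS by (intro has_derivative_diff has_derivative_mult_right w'' smooth_on_has_derivative[OF smooth_on_frechet_derivative[OF u]])
  have bmin: "\<And>y. y \<in> ball z r \<Longrightarrow> g x \<le> g y" using xmin by simp
  have first: "frechet_derivative u (at x) v = \<epsilon> * w1 x v" for v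
    using differential_zero_maxmin[OF xb open_ball g'[OF xb]] bmin by (metis eq_iff_diff_eq_0)
  define b where "b = (\<lambda>i j. second_derivative u x i j - \<epsilon> * w2 x i j)"
  have second: "(\<Sum>i\<in>Basis. \<Sum>j\<in>Basis. b i j * c i * c j) \<ge> 0" for c
  proof -
    define v where "v = (\<Sum>i\<in>Basis. c i *\<^sub>R (i::'a))"
    have vi: "v \<bullet> i = c i" if "i \<in> Basis" for i using that by (simp add: v_def)
    have "w2 x v v = (\<Sum>i\<in>Basis. \<Sum>j\<in>Basis. w2 x i j * (v \<bullet> i) * (v \<bullet> j))"
    proof -
      have a: "(\<Sum>i\<in>Basis. \<Sum>j\<in>Basis. (((x - y) \<bullet> i) * (v \<bullet> i)) * (((x - y) \<bullet> j) * (v \<bullet> j))) = ((x - y) \<bullet> v) * ((x - y) \<bullet> v)"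
        unfolding sum_product[symmetric] by (simp flip: euclidean_inner)
      have b: "(\<Sum>i\<in>Basis. \<Sum>j\<in>Basis. (i \<bullet> j) * (v \<bullet> i) * (v \<bullet> j)) = v \<bullet> v"
        using inner_linear_expand[OF linear_id[unfolded id_def], of v] by simp
      have c: "w2 x i j * (v \<bullet> i) * (v \<bullet> j) = (4 * \<alpha>\<^sup>2 * E x) * ((((x - y) \<bullet> i) * (v \<bullet> i)) * (((x - y) \<bullet> j) * (v \<bullet> j)))
          - (2 * \<alpha> * E x) * ((i \<bullet> j) * (v \<bullet> i) * (v \<bullet> j))" for i j
        by (simp add: w2_def algebra_simps)
      show ?thesis
        unfolding c double_sum_diff a b by (simp add: w2_def algebra_simps)
    qed
    then have "second_derivative u x v v - \<epsilon> * w2 x v v = (\<Sum>i\<in>Basis. \<Sum>j\<in>Basis. b i j * (v \<bullet> i) * (v \<bullet> j))"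
      unfolding second_derivative_bilinear[OF S xS u, of v] b_def
      by (simp add: sum_subtractf sum_distrib_left left_diff_distrib mult.assoc)
    also have "\<dots> = (\<Sum>i\<in>Basis. \<Sum>j\<in>Basis. b i j * c i * c j)"
      using vi by (intro sum.cong) auto
    finally show ?thesis
      using second_derivative_at_minimum[OF open_ball xb g' g'' bmin, of v] by simp
  qed
  have "(\<Sum>i\<in>Basis. \<Sum>j\<in>Basis. (i \<bullet> A x j) * b i j) \<ge> 0"
  proof (rule trace_mult_psd_nonneg[OF finite_Basis _ _ second])
    fix c :: "'a \<Rightarrow> real"
    define v where "v = (\<Sum>i\<in>Basis. c i *\<^sub>R (i::'a))"
    have "(\<Sum>i\<in>Basis. \<Sum>j\<in>Basis. (i \<bullet> A x j) * c i * c j) = v \<bullet> A x v"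
      unfolding inner_linear_expand[OF A(1)[OF xS]] by (intro sum.cong) (auto simp: v_def)
    then show "(\<Sum>i\<in>Basis. \<Sum>j\<in>Basis. (i \<bullet> A x j) * c i * c j) \<ge> 0" using A(3)[OF xS] by simp
  qed (rule A(2)[OF xS])
  then have 1: "\<epsilon> * (\<Sum>i\<in>Basis. \<Sum>j\<in>Basis. (i \<bullet> A x j) * w2 x i j)
      \<le> (\<Sum>i\<in>Basis. \<Sum>j\<in>Basis. (i \<bullet> A x j) * second_derivative u x i j)"
    by (simp add: b_def right_diff_distrib sum_subtractf sum_distrib_left mult.left_commute)
  have "(\<Sum>i\<in>Basis. \<Sum>j\<in>Basis. (i \<bullet> A x j) * (i \<bullet> j)) = T x"
    unfolding T_def
  proof (intro sum.cong refl)
    fix i :: 'a assume i: "i \<in> Basis"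
    have "(\<Sum>j\<in>Basis. (i \<bullet> A x j) * (i \<bullet> j)) = (\<Sum>j\<in>{i}. (i \<bullet> A x j) * (i \<bullet> j))"
      using i by (intro sum.mono_neutral_right) (auto simp: inner_Basis)
    then show "(\<Sum>j\<in>Basis. (i \<bullet> A x j) * (i \<bullet> j)) = i \<bullet> A x i" using i by simp
  qed
  moreover have "(i \<bullet> A x j) * w2 x i j = (4 * \<alpha>\<^sup>2 * E x) * ((i \<bullet> A x j) * ((x - y) \<bullet> i) * ((x - y) \<bullet> j))
      - (2 * \<alpha> * E x) * ((i \<bullet> A x j) * (i \<bullet> j))" for i j
    by (simp add: w2_def algebra_simps)
  ultimately have tr: "(\<Sum>i\<in>Basis. \<Sum>j\<in>Basis. (i \<bullet> A x j) * w2 x i j) = 4 * \<alpha>\<^sup>2 * E x * q x - 2 * \<alpha> * E x * T x"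
    unfolding qexp[OF xS] by (simp only: double_sum_diff)
  have 2: "\<epsilon> * (4 * \<alpha>\<^sup>2 * E x * q x - 2 * \<alpha> * E x * T x)
      \<le> C * ((\<Sum>i\<in>Basis. \<bar>frechet_derivative u (at x) i\<bar>) + u x)"
    using order_trans[OF 1 L[OF xS]] unfolding tr .
  have "norm (x - y) \<le> R + r"
    using x norm_triangle_ineq[of "x - z" "z - y"] by (simp add: y_def R_def dist_norm norm_minus_commute diff_diff_eq)
  then have "\<bar>(x - y) \<bullet> i\<bar> \<le> R + r" if "i \<in> Basis" for i using Basis_le_norm[OF that, of "x - y"] by simp
  then have "(\<Sum>i\<in>Basis. \<bar>(x - y) \<bullet> i\<bar>) \<le> Y"
    unfolding Y_def by (intro sum_bounded_above)
  moreover have "(\<Sum>i\<in>Basis. \<bar>frechet_derivative u (at x) i\<bar>) = \<epsilon> * (2 * \<alpha> * E x) * (\<Sum>i\<in>Basis. \<bar>(x - y) \<bullet> i\<bar>)"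
    unfolding first w1_def sum_distrib_left using \<epsilon> \<alpha> E1[of x] by (intro sum.cong) (auto simp: abs_mult)
  ultimately have "(\<Sum>i\<in>Basis. \<bar>frechet_derivative u (at x) i\<bar>) \<le> \<epsilon> * (2 * \<alpha> * E x) * Y"
    using \<epsilon> \<alpha> E1[of x] by (simp add: mult_left_mono)
  \<comment> \<open>From \<open>g x \<le> 0\<close> and \<open>w x < E x\<close>: the zeroth-order
    term receives the factor \<open>\<epsilon> * E x\<close> that all other terms carry and that is
    divided out next.\<close>
  moreover have "u x \<le> \<epsilon> * E x"
    using gx wE[of x] \<epsilon> unfolding g_def by (smt (verit) mult_left_mono)
  ultimately have "C * ((\<Sum>i\<in>Basis. \<bar>frechet_derivative u (at x) i\<bar>) + u x)
      \<le> C * (\<epsilon> * (2 * \<alpha> * E x) * Y + \<epsilon> * E x)"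
    using C by (intro mult_left_mono add_mono)
  with 2 have "(\<epsilon> * E x) * (4 * \<alpha>\<^sup>2 * q x - 2 * \<alpha> * T x) \<le> (\<epsilon> * E x) * (C * (2 * \<alpha> * Y + 1))"
    by (simp add: algebra_simps)
  then have "4 * \<alpha>\<^sup>2 * q x - 2 * \<alpha> * T x \<le> C * (2 * \<alpha> * Y + 1)"
    using \<epsilon> E1[of x] by (simp add: mult_le_cancel_left_pos)
  moreover have "4 * \<alpha>\<^sup>2 * \<delta> \<le> 4 * \<alpha>\<^sup>2 * q x" using \<delta>(2)[OF x] by (intro mult_left_mono) auto
  moreover have "2 * \<alpha> * T x \<le> 2 * \<alpha> * T0" using T0(2)[OF x] \<alpha> by (intro mult_left_mono) auto
  moreover have "C \<le> \<alpha> * C" using \<alpha> C by (simp add: mult_le_cancel_right1)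
  ultimately have "\<alpha> * (4 * \<alpha> * \<delta>) \<le> \<alpha> * K"
    by (simp add: K_def power2_eq_square algebra_simps)
  then show False using \<alpha> by (simp add: mult_le_cancel_left_pos)
qed


subsection \<open>The linearised inequality\<close>

lemma smooth_on_divide:
  fixes f g :: "'a::real_normed_vector \<Rightarrow> real"
  assumes "open S" "smooth_on S f" "smooth_on S g" "\<And>x. x \<in> S \<Longrightarrow> g x \<noteq> 0"
  shows "smooth_on S (\<lambda>x. f x / g x)"
proof -
  have pos: "g x * g x > 0" if "x \<in> S" for x
    using assms(4)[OF that] not_real_square_gt_zero by blast
  \<comment> \<open>The reciprocal is written as \<open>g\<close> times a power of its positive
    square, because \<open>smooth_on_powr\<close> asks for a positive base and the sign of
    \<open>g\<close> must be kept.\<close>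
  have "smooth_on S (\<lambda>x. f x * (g x * (g x * g x) powr (-1)))"
    using assms pos by (intro smooth_on_mult smooth_on_powr) auto
  then show ?thesis
  proof (rule smooth_on_cong[OF assms(1), rotated])
    fix x assume "x \<in> S"
    from pos[OF this] show "f x * (g x * (g x * g x) powr (-1)) = f x / g x"
      using assms(4)[OF \<open>x \<in> S\<close>] by (simp add: powr_minus field_simps)
  qed
qed

lemma bounded_bilinear_matrix_vector: "bounded_bilinear ((*v) :: real^'n::finite^'m::finite \<Rightarrow> real^'n \<Rightarrow> real^'m)"
  unfolding bilinear_conv_bounded_bilinear[symmetric] bilinear_def
  by (auto intro!: linearI simp: algebra_simps scaleR_matrix_vector_assoc)

lemmas smooth_on_matrix_vector = smooth_on_bilinear[OF bounded_bilinear_matrix_vector]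

section \<open>Differentials and the flux map\<close>

lemma differential_inner:
  fixes f :: "real^'n::finite \<Rightarrow> real"
  assumes "linear (frechet_derivative f (at x))"
  shows "differential f x \<bullet> v = frechet_derivative f (at x) v"
proof -
  have "frechet_derivative f (at x) v = frechet_derivative f (at x) (\<Sum>i\<in>UNIV. (v $ i) *\<^sub>R axis i 1)"
    by (simp add: basis_expansion flip: scalar_mult_eq_scaleR)
  also have "\<dots> = (\<Sum>i\<in>UNIV. v $ i * frechet_derivative f (at x) (axis i 1))"
    using linear_sum[OF assms, of "\<lambda>i. (v $ i) *\<^sub>R axis i 1" UNIV] linear_cmul[OF assms] by simp
  finally show ?thesis by (simp add: differential_def inner_vec_def mult.commute)
qed

lemma smooth_on_differential_inner:
  fixes f :: "real^'n::finite \<Rightarrow> real"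
  shows "smooth_on S f \<Longrightarrow> x \<in> S \<Longrightarrow> differential f x \<bullet> v = frechet_derivative f (at x) v"
  by (intro differential_inner smooth_on_linear_frechet)

lemma differential_eq_sum:
  fixes f :: "real^'n::finite \<Rightarrow> real"
  assumes "smooth_on S f" "x \<in> S"
  shows "differential f x = (\<Sum>b\<in>Basis. frechet_derivative f (at x) b *\<^sub>R b)"
  using euclidean_representation[of "differential f x"] smooth_on_differential_inner[OF assms] by simp

lemma smooth_on_differential:
  fixes f :: "real^'n::finite \<Rightarrow> real"
  assumes S: "open S" and f: "smooth_on S f"
  shows "smooth_on S (differential f)"
proof (rule smooth_on_cong[OF S])
  show "smooth_on S (\<lambda>x. \<Sum>b\<in>Basis. frechet_derivative f (at x) b *\<^sub>R b)"
    by (intro smooth_on_sum smooth_on_scaleR smooth_on_const S smooth_on_frechet_derivative f)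
qed (simp add: differential_eq_sum[OF f])

lemma differential_has_derivative:
  fixes f :: "real^'n::finite \<Rightarrow> real"
  assumes S: "open S" "x \<in> S" and f: "smooth_on S f"
  shows "(differential f has_derivative (\<lambda>v. \<Sum>b\<in>Basis. second_derivative f x b v *\<^sub>R b)) (at x)"
proof (rule has_derivative_transform_within_open[OF _ S])
  show "((\<lambda>y. \<Sum>b\<in>Basis. frechet_derivative f (at y) b *\<^sub>R b) has_derivative
      (\<lambda>v. \<Sum>b\<in>Basis. second_derivative f x b v *\<^sub>R b)) (at x)"
    by (intro has_derivative_sum has_derivative_scaleR_left
        smooth_on_has_derivative[OF smooth_on_frechet_derivative[OF f] S(2)])
qed (simp add: differential_eq_sum[OF f])

text \<open>The vector \<omega> raised by \<open>G\<close>, scaled by the norm of \<omega> to the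
  power p - 1; \<open>coinner\<close> is the squared norm, hence the halved exponent. Point and
  covector are independent variables, so that the derivative in the second one is the principal part
  of the mean curvature.\<close>

definition flux :: "real \<Rightarrow> (real^'n::finite \<Rightarrow> real^'n^'n) \<Rightarrow> (real^'n) \<times> (real^'n) \<Rightarrow> real^'n" where
  "flux p G = (\<lambda>(x, \<omega>). coinner (G x) \<omega> \<omega> powr ((p - 1) / 2) *\<^sub>R sharp (G x) \<omega>)"

lemma flux_eq:
  assumes "coinner G \<omega> \<omega> > 0"
  shows "(1 / conorm G \<omega> powr (1 - p)) *\<^sub>R sharp G \<omega> = coinner G \<omega> \<omega> powr ((p - 1) / 2) *\<^sub>R sharp G \<omega>"
proof -
  have "1 / conorm G \<omega> powr (1 - p) = conorm G \<omega> powr (p - 1)"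
    using powr_minus_divide[of "conorm G \<omega>" "1 - p"] by simp
  also have "\<dots> = coinner G \<omega> \<omega> powr ((p - 1) / 2)"
    unfolding conorm_def using assms by (simp add: powr_powr flip: powr_half_sqrt)
  finally show ?thesis by simp
qed

lemma smooth_on_flux:
  fixes G :: "real^'n::finite \<Rightarrow> real^'n^'n"
  assumes G: "open S" "smooth_on S G" and T: "open T" "T \<subseteq> S \<times> UNIV"
    and pos: "\<And>x \<omega>. (x, \<omega>) \<in> T \<Longrightarrow> coinner (G x) \<omega> \<omega> > 0"
  shows "smooth_on T (flux p G)"
proof -
  have Gf: "smooth_on T (\<lambda>y. G (fst y))"
    using T by (intro smooth_on_compose_linear[OF bounded_linear_fst T(1) G(1) _ G(2)]) auto
  have s: "smooth_on T (\<lambda>y :: (real^'n) \<times> (real^'n). snd y)"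
    by (intro smooth_on_bounded_linear[OF bounded_linear_snd] smooth_on_ident T)
  have "smooth_on T (\<lambda>y. (snd y \<bullet> (G (fst y) *v snd y)) powr ((p - 1) / 2) *\<^sub>R (G (fst y) *v snd y))"
    using pos by (intro smooth_on_scaleR smooth_on_powr smooth_on_inner smooth_on_matrix_vector T Gf s)
      (auto simp: coinner_def)
  then show ?thesis unfolding flux_def coinner_def sharp_def case_prod_unfold .
qed

section \<open>The quadratic form of the principal part\<close>

lemma psd_cauchy_schwarz:
  fixes G :: "real^'n::finite^'n"
  assumes sym: "transpose G = G" and psd: "\<And>v. v \<bullet> (G *v v) \<ge> 0"
    and N: "\<omega> \<bullet> (G *v \<omega>) > 0"
  shows "(\<omega> \<bullet> (G *v w))\<^sup>2 \<le> (\<omega> \<bullet> (G *v \<omega>)) * (w \<bullet> (G *v w))"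
proof -
  let ?N = "\<omega> \<bullet> (G *v \<omega>)" and ?c = "\<omega> \<bullet> (G *v w)"
  have s: "w \<bullet> (G *v \<omega>) = ?c" using dot_lmul_matrix[of w G \<omega>] sym
    by (metis inner_commute vector_transpose_matrix)
  have "0 \<le> (w - (?c / ?N) *\<^sub>R \<omega>) \<bullet> (G *v (w - (?c / ?N) *\<^sub>R \<omega>))" by (rule psd)
  also have "\<dots> = w \<bullet> (G *v w) - ?c\<^sup>2 / ?N"
    using N s by (simp add: matrix_vector_mult_diff_distrib matrix_vector_mult_scaleR inner_diff_left
        inner_diff_right power2_eq_square field_simps)
  finally show ?thesis using N by (simp add: field_simps)
qed

lemma symmetric_inner: "transpose G = G \<Longrightarrow> v \<bullet> (G *v w) = w \<bullet> (G *v v)" for G :: "real^'n::finite^'n"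
  by (metis dot_lmul_matrix inner_commute vector_transpose_matrix)

text \<open>If \<open>G *v v\<close> were nonzero, going a small way from \<open>v\<close> against
  it would take the form from zero to a negative value; \<open>t\<close> is chosen so that the
  quadratic term cannot compensate the linear one.\<close>

lemma psd_kernel:
  fixes G :: "real^'n::finite^'n"
  assumes sym: "transpose G = G" and psd: "\<And>v. v \<bullet> (G *v v) \<ge> 0" and 0: "v \<bullet> (G *v v) = 0"
  shows "G *v v = 0"
proof (rule ccontr)
  assume n: "G *v v \<noteq> 0"
  let ?h = "G *v v"
  define c where "c = ?h \<bullet> (G *v ?h)"
  have c: "c \<ge> 0" unfolding c_def by (rule psd)
  have h: "?h \<bullet> ?h > 0" using n by simp
  define t where "t = (?h \<bullet> ?h) / (c + 1)"
  have t: "t > 0" using h c by (simp add: t_def)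
  have "0 \<le> (v - t *\<^sub>R ?h) \<bullet> (G *v (v - t *\<^sub>R ?h))" by (rule psd)
  also have "\<dots> = t * (t * c - 2 * (?h \<bullet> ?h))"
    using symmetric_inner[OF sym, of v ?h] 0
    by (simp add: c_def matrix_vector_mult_diff_distrib matrix_vector_mult_scaleR inner_diff_left
        inner_diff_right algebra_simps)
  finally have "2 * (?h \<bullet> ?h) \<le> t * c" using t by (simp add: zero_le_mult_iff)
  also have "\<dots> \<le> t * (c + 1)" using t by simp
  also have "\<dots> = ?h \<bullet> ?h" using c by (simp add: t_def)
  finally show False using h by simp
qed

text \<open>The power pulled out in front is positive, so sign and kernel of the principal part are
  decided by the factor behind it.\<close>

lemma flux_derivative:
  fixes G :: "real^'n::finite \<Rightarrow> real^'n^'n"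
  assumes T: "(x, \<omega>) \<in> T" "smooth_on T (flux p G)"
    and sym: "transpose (G x) = G x" and N: "coinner (G x) \<omega> \<omega> > 0"
  shows "frechet_derivative (flux p G) (at (x, \<omega>)) (0, w) =
    coinner (G x) \<omega> \<omega> powr ((p - 1) / 2 - 1) *\<^sub>R
      (coinner (G x) \<omega> \<omega> *\<^sub>R (G x *v w) + ((p - 1) * (\<omega> \<bullet> (G x *v w))) *\<^sub>R (G x *v \<omega>))"
proof -
  let ?N = "\<lambda>\<omega>. coinner (G x) \<omega> \<omega>" and ?q = "(p - 1) / 2"
  note lin = bounded_linear.has_derivative[OF matrix_vector_mul_bounded_linear[of "G x"] has_derivative_ident]
  have N': "(?N has_derivative (\<lambda>w. 2 * (\<omega> \<bullet> (G x *v w)))) (at \<omega>)"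
    unfolding coinner_def
    by (rule has_derivative_eq_rhs[OF has_derivative_inner[OF has_derivative_ident lin]])
      (simp add: fun_eq_iff symmetric_inner[OF sym, of _ \<omega>])
  have d1: "((\<lambda>\<omega>. flux p G (x, \<omega>)) has_derivative (\<lambda>w. ?N \<omega> powr ?q *\<^sub>R (G x *v w) +
      (?N \<omega> powr ?q * (0 * ln (?N \<omega>) + (2 * (\<omega> \<bullet> (G x *v w))) * ?q / ?N \<omega>)) *\<^sub>R (G x *v \<omega>))) (at \<omega>)"
    unfolding flux_def sharp_def prod.case
    by (intro has_derivative_scaleR lin has_derivative_powr[OF N' has_derivative_const]) (use N in auto)
  have d2: "((\<lambda>\<omega>. flux p G (x, \<omega>)) has_derivative
      (\<lambda>w. frechet_derivative (flux p G) (at (x, \<omega>)) (0, w))) (at \<omega>)"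
    by (rule has_derivative_compose[OF has_derivative_Pair[OF has_derivative_const has_derivative_ident]
          smooth_on_has_derivative[OF T(2,1)]])
  have pw: "?N \<omega> powr ?q = ?N \<omega> powr (?q - 1) * ?N \<omega>"
    using N by (simp add: powr_diff)
  have "?N \<omega> powr ?q * (0 * ln (?N \<omega>) + (2 * c) * ?q / ?N \<omega>) = ?N \<omega> powr (?q - 1) * ((p - 1) * c)" for c
    unfolding pw using N by simp
  then show ?thesis
    using fun_cong[OF has_derivative_unique[OF d2 d1], of w] pw by (simp add: scaleR_add_right)
qed

text \<open>\<open>q\<close> is the Cauchy-Schwarz defect plus \<open>p\<close> times a square. When
  both vanish, equality in Cauchy-Schwarz makes \<open>w\<close> a multiple of
  \<open>\<omega>\<close> modulo the kernel of \<open>G\<close>; for positive \<open>p\<close> the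
  multiple is zero.\<close>

lemma flux_quadratic_form:
  fixes G :: "real^'n::finite^'n" and w :: "real^'n"
  assumes sym: "transpose G = G" and psd: "\<And>v. v \<bullet> (G *v v) \<ge> 0"
    and N: "\<omega> \<bullet> (G *v \<omega>) > 0" and p: "p \<ge> 0"
  defines "q \<equiv> (\<omega> \<bullet> (G *v \<omega>)) * (w \<bullet> (G *v w)) + (p - 1) * (\<omega> \<bullet> (G *v w))\<^sup>2"
  shows "q \<ge> 0" and "q = 0 \<Longrightarrow> (\<omega> \<bullet> (G *v \<omega>)) *\<^sub>R (G *v w) = (\<omega> \<bullet> (G *v w)) *\<^sub>R (G *v \<omega>)"
    and "q = 0 \<Longrightarrow> p > 0 \<Longrightarrow> G *v w = 0"
proof -
  let ?N = "\<omega> \<bullet> (G *v \<omega>)" and ?c = "\<omega> \<bullet> (G *v w)"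
  note cs = psd_cauchy_schwarz[OF sym psd N, of w]
  have split: "q = (?N * (w \<bullet> (G *v w)) - ?c\<^sup>2) + p * ?c\<^sup>2" by (simp add: q_def algebra_simps)
  show "q \<ge> 0" unfolding split using cs p by simp
  assume 0: "q = 0"
  have pc: "p * ?c\<^sup>2 \<ge> 0" using p by simp
  have eq: "?N * (w \<bullet> (G *v w)) = ?c\<^sup>2" and pc0: "p * ?c\<^sup>2 = 0" using cs 0 pc unfolding split by linarith+
  have "(w - (?c / ?N) *\<^sub>R \<omega>) \<bullet> (G *v (w - (?c / ?N) *\<^sub>R \<omega>)) = w \<bullet> (G *v w) - ?c\<^sup>2 / ?N"
    using N symmetric_inner[OF sym, of w \<omega>]
    by (simp add: matrix_vector_mult_diff_distrib matrix_vector_mult_scaleR inner_diff_left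
        inner_diff_right power2_eq_square field_simps)
  also have "\<dots> = 0" using eq N by (simp add: field_simps)
  finally have "G *v (w - (?c / ?N) *\<^sub>R \<omega>) = 0" by (rule psd_kernel[OF sym psd])
  then have Gw: "G *v w = (?c / ?N) *\<^sub>R (G *v \<omega>)"
    by (simp add: matrix_vector_mult_diff_distrib matrix_vector_mult_scaleR)
  show "?N *\<^sub>R (G *v w) = ?c *\<^sub>R (G *v \<omega>)" by (subst Gw) (use N in simp)
  show "G *v w = 0" if "p > 0" using Gw pc0 that by simp
qed

text \<open>Product and chain rule for the weighted divergence. The first sum depends on
  \<open>f\<close> only through \<open>differential f x\<close>; the second is linear in the second
  derivatives, with coefficients again depending on \<open>differential f x\<close>. This separation
  allows two functions to be compared term by term.\<close>

lemma mean_curvature_expand: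
  fixes dv :: "real^'n::finite \<Rightarrow> (real^'n) list \<Rightarrow> real"
  assumes S: "open S" "x \<in> S" and alt: "\<And>y. y \<in> S \<Longrightarrow> alternating_form CARD('n) (dv y)"
    and dv: "\<And>vs. smooth_on S (\<lambda>y. dv y vs)" and e: "distinct e" "set e = Basis" "dv x e \<noteq> 0"
    and G: "smooth_on S G" and f: "smooth_on S f"
    and T: "smooth_on T (flux p G)" "(x, differential f x) \<in> T"
    and pos: "\<And>y. y \<in> S \<Longrightarrow> coinner (G y) (differential f y) (differential f y) > 0"
  defines "D \<equiv> frechet_derivative (flux p G) (at (x, differential f x))"
  shows "mean_curvature G dv p f x =
    (\<Sum>b\<in>Basis. frechet_derivative (\<lambda>y. dv y e) (at x) b / dv x e * (flux p G (x, differential f x) \<bullet> b) + D (b, 0) \<bullet> b) +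
    (\<Sum>b\<in>Basis. \<Sum>j\<in>Basis. (b \<bullet> D (0, j)) * second_derivative f x j b)"
proof -
  let ?F = "\<lambda>y. (1 / conorm (G y) (differential f y) powr (1 - p)) *\<^sub>R sharp (G y) (differential f y)"
  let ?\<Phi> = "flux p G" and ?D2 = "\<lambda>v. \<Sum>j\<in>Basis. second_derivative f x j v *\<^sub>R j"
  have F: "?\<Phi> (y, differential f y) = ?F y" if "y \<in> S" for y
    unfolding flux_eq[OF pos[OF that], of p] by (simp add: flux_def)
  note df = smooth_on_differential[OF S(1) f]
  have "smooth_on S (\<lambda>y. coinner (G y) (differential f y) (differential f y) powr ((p - 1) / 2) *\<^sub>R
      sharp (G y) (differential f y))"
    unfolding coinner_def sharp_def using pos
    by (intro smooth_on_scaleR smooth_on_powr smooth_on_inner smooth_on_matrix_vector S G df) (simp add: coinner_def)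
  then have smF: "smooth_on S ?F"
    by (rule smooth_on_cong[OF S(1), rotated]) (simp add: F[symmetric] flux_def)
  have "((\<lambda>y. (y, differential f y)) has_derivative (\<lambda>v. (v, ?D2 v))) (at x)"
    by (intro has_derivative_Pair has_derivative_ident differential_has_derivative[OF S f])
  from has_derivative_compose[OF this smooth_on_has_derivative[OF T]]
  have "((\<lambda>y. ?\<Phi> (y, differential f y)) has_derivative (\<lambda>v. D (v, ?D2 v))) (at x)"
    unfolding D_def .
  then have F': "(?F has_derivative (\<lambda>v. D (v, ?D2 v))) (at x)"
    by (rule has_derivative_transform_within_open[OF _ S]) (rule F)
  have lin: "linear D" unfolding D_def by (rule smooth_on_linear_frechet[OF T])
  have D2: "D (v, ?D2 v) = D (v, 0) + (\<Sum>j\<in>Basis. second_derivative f x j v *\<^sub>R D (0, j))" for v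
  proof -
    have "(v, ?D2 v) = (v, 0) + (\<Sum>j\<in>Basis. second_derivative f x j v *\<^sub>R (0, j))"
      by (simp add: prod_eq_iff fst_sum snd_sum)
    then show ?thesis
      using linear_sum[OF lin, of "\<lambda>j. second_derivative f x j v *\<^sub>R (0, j)" Basis]
      by (simp only: linear_add[OF lin] linear_cmul[OF lin])
  qed
  have summand: "frechet_derivative (\<lambda>y. dv y e * (?F y \<bullet> b)) (at x) b / dv x e =
      (frechet_derivative (\<lambda>y. dv y e) (at x) b / dv x e * (?\<Phi> (x, differential f x) \<bullet> b) + D (b, 0) \<bullet> b) +
      (\<Sum>j\<in>Basis. (b \<bullet> D (0, j)) * second_derivative f x j b)" for b
  proof -
    have "((\<lambda>y. dv y e * (?F y \<bullet> b)) has_derivative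
        (\<lambda>v. dv x e * (D (v, ?D2 v) \<bullet> b) + frechet_derivative (\<lambda>y. dv y e) (at x) v * (?F x \<bullet> b))) (at x)"
      by (intro has_derivative_mult has_derivative_inner_left smooth_on_has_derivative[OF dv S(2)] F')
    from fun_cong[OF frechet_derivative_at[OF this], of b, symmetric]
    have "frechet_derivative (\<lambda>y. dv y e * (?F y \<bullet> b)) (at x) b =
      dv x e * (D (b, ?D2 b) \<bullet> b) + frechet_derivative (\<lambda>y. dv y e) (at x) b * (?\<Phi> (x, differential f x) \<bullet> b)"
      unfolding F[OF S(2)] .
    moreover have "D (b, ?D2 b) \<bullet> b = D (b, 0) \<bullet> b + (\<Sum>j\<in>Basis. (b \<bullet> D (0, j)) * second_derivative f x j b)"
      unfolding D2 by (simp add: inner_add_left inner_sum_left inner_commute[of b] mult.commute)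
    ultimately show ?thesis using e(3) by (simp add: field_simps)
  qed
  have "mean_curvature G dv p f x = (\<Sum>b\<in>Basis. frechet_derivative (\<lambda>y. dv y e * (?F y \<bullet> b)) (at x) b) / dv x e"
    by (rule mean_curvature_eq[OF S alt dv smF e])
  also have "\<dots> = (\<Sum>b\<in>Basis. (frechet_derivative (\<lambda>y. dv y e) (at x) b / dv x e * (?\<Phi> (x, differential f x) \<bullet> b) + D (b, 0) \<bullet> b) +
      (\<Sum>j\<in>Basis. (b \<bullet> D (0, j)) * second_derivative f x j b))"
    unfolding sum_divide_distrib summand ..
  finally show ?thesis by (simp only: sum.distrib)
qed

section \<open>Comparison of two functions\<close>

lemma smooth_on_compose_fst:
  assumes "open S" "smooth_on S f" "open T" "T \<subseteq> S \<times> UNIV"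
  shows "smooth_on T (\<lambda>y. f (fst y))"
  using assms by (intro smooth_on_compose_linear[OF bounded_linear_fst]) auto

lemma compact_continuous_bound:
  fixes f :: "'a::topological_space \<Rightarrow> real"
  assumes "compact K" "continuous_on K f"
  obtains B where "B \<ge> 0" "\<And>x. x \<in> K \<Longrightarrow> \<bar>f x\<bar> \<le> B"
proof -
  have "bounded (f ` K)" using assms compact_continuous_image compact_imp_bounded by blast
  then obtain B where "\<forall>t\<in>f ` K. norm t \<le> B" unfolding bounded_iff by (rule exE)
  then have "\<bar>f x\<bar> \<le> max B 0" if "x \<in> K" for x
    using that by (auto intro: max.coboundedI1)
  then show ?thesis using that[of "max B 0"] by simp
qed

text \<open>The principal part at \<open>differential f\<close> applied to \<open>h - f\<close> is
  the difference of the mean curvatures, plus a difference of first-order parts, plus a difference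
  of coefficients paired with second derivatives of \<open>h\<close>. On products of closed balls,
  which are compact and convex, all these coefficients are Lipschitz.\<close>

lemma linearized_inequality:
  fixes dv :: "real^'n::finite \<Rightarrow> (real^'n) list \<Rightarrow> real" and f h :: "real^'n \<Rightarrow> real"
  assumes S: "open S" "cball x0 r \<subseteq> S" and alt: "\<And>y. y \<in> S \<Longrightarrow> alternating_form CARD('n) (dv y)"
    and dv: "\<And>vs. smooth_on S (\<lambda>y. dv y vs)"
    and e: "distinct e" "set e = Basis" "\<And>x. x \<in> S \<Longrightarrow> dv x e \<noteq> 0"
    and G: "smooth_on S G" "\<And>x. x \<in> S \<Longrightarrow> transpose (G x) = G x"
    and f: "smooth_on S f" and h: "smooth_on S h"
    and T: "open T" "T \<subseteq> S \<times> UNIV" "cball x0 r \<times> cball \<omega>0 s \<subseteq> T"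
      "\<And>x \<omega>. (x, \<omega>) \<in> T \<Longrightarrow> coinner (G x) \<omega> \<omega> > 0"
    and df: "\<And>x. x \<in> cball x0 r \<Longrightarrow> differential f x \<in> cball \<omega>0 s \<and> differential h x \<in> cball \<omega>0 s"
    and bd: "\<And>x. x \<in> cball x0 r \<Longrightarrow> \<bar>f x\<bar> \<le> 1 \<and> \<bar>h x\<bar> \<le> 1"
    and b: "smooth_on Tb (\<lambda>(x, z, \<xi>). b x z \<xi>)" "cball x0 r \<times> cball 0 1 \<times> cball \<omega>0 s \<subseteq> Tb"
    and le: "\<And>x. x \<in> ball x0 r \<Longrightarrow> f x \<le> h x"
    and ineq: "\<And>x. x \<in> ball x0 r \<Longrightarrow> mean_curvature G dv p h x + b x (h x) (differential h x)
      \<le> mean_curvature G dv p f x + b x (f x) (differential f x)"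
  obtains C where "C \<ge> 0" "\<And>x. x \<in> ball x0 r \<Longrightarrow> (\<Sum>i\<in>Basis. \<Sum>j\<in>Basis.
        (i \<bullet> frechet_derivative (flux p G) (at (x, differential f x)) (0, j)) *
          second_derivative (\<lambda>y. h y - f y) x i j)
      \<le> C * ((\<Sum>i\<in>Basis. \<bar>frechet_derivative (\<lambda>y. h y - f y) (at x) i\<bar>) + (h x - f x))"
proof -
  let ?\<Phi> = "flux p G" and ?K = "cball x0 r \<times> cball \<omega>0 s" and ?B = "Basis :: (real^'n) set"
  define D where "D = (\<lambda>y. frechet_derivative ?\<Phi> (at y))"
  define a where "a = (\<lambda>b j y. b \<bullet> D y (0, j))"
  define \<l> where "\<l> = (\<lambda>y. \<Sum>b\<in>?B. frechet_derivative (\<lambda>y. dv y e) (at (fst y)) b / dv (fst y) e * (?\<Phi> y \<bullet> b) + D y (b, 0) \<bullet> b)"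
  have K: "compact ?K" "convex ?K" by (simp_all add: compact_Times convex_Times)
  have sm\<Phi>: "smooth_on T ?\<Phi>" using smooth_on_flux[OF S(1) G(1) T(1,2,4)] .
  have sma: "smooth_on T (a i j)" for i j
    unfolding a_def D_def
    by (intro smooth_on_inner smooth_on_const T(1) smooth_on_frechet_derivative[OF sm\<Phi>])
  have "smooth_on S (\<lambda>y. frechet_derivative (\<lambda>y. dv y e) (at y) b / dv y e)" for b
    by (intro smooth_on_divide smooth_on_frechet_derivative dv S(1) e(3))
  from smooth_on_compose_fst[OF S(1) this T(1,2)]
  have sm\<l>: "smooth_on T \<l>"
    unfolding \<l>_def D_def
    by (intro smooth_on_sum smooth_on_add smooth_on_mult smooth_on_inner smooth_on_const T(1) sm\<Phi>
        smooth_on_frechet_derivative[OF sm\<Phi>])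
  obtain L\<l> where L\<l>: "L\<l> \<ge> 0" "\<And>x y. x \<in> ?K \<Longrightarrow> y \<in> ?K \<Longrightarrow> norm (\<l> x - \<l> y) \<le> L\<l> * norm (x - y)"
    using smooth_on_lipschitz[OF sm\<l> K T(3)] by blast
  have "\<exists>L\<ge>0. \<forall>x\<in>?K. \<forall>y\<in>?K. norm (a i j x - a i j y) \<le> L * norm (x - y)" for i j
    using smooth_on_lipschitz[OF sma K T(3), of i j] by metis
  then obtain La where La: "\<And>i j. La i j \<ge> 0"
    "\<And>i j x y. x \<in> ?K \<Longrightarrow> y \<in> ?K \<Longrightarrow> norm (a i j x - a i j y) \<le> La i j * norm (x - y)"
    by metis
  have "\<exists>M\<ge>0. \<forall>x\<in>cball x0 r. \<bar>second_derivative h x j i\<bar> \<le> M" for i j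
    using compact_continuous_bound[OF compact_cball continuous_on_subset[OF smooth_on_continuous[OF
          smooth_on_frechet_derivative[OF smooth_on_frechet_derivative[OF h]]] S(2)], of j i] by metis
  then obtain M where M: "\<And>i j. M i j \<ge> 0" "\<And>i j x. x \<in> cball x0 r \<Longrightarrow> \<bar>second_derivative h x j i\<bar> \<le> M i j"
    by metis
  obtain Lb where Lb: "Lb \<ge> 0" "\<And>x y. x \<in> cball x0 r \<times> cball 0 1 \<times> cball \<omega>0 s \<Longrightarrow>
      y \<in> cball x0 r \<times> cball 0 1 \<times> cball \<omega>0 s \<Longrightarrow>
      norm ((\<lambda>(x, z, \<xi>). b x z \<xi>) x - (\<lambda>(x, z, \<xi>). b x z \<xi>) y) \<le> Lb * norm (x - y)"
    using smooth_on_lipschitz[OF b(1) _ _ b(2)] compact_Times convex_Times compact_cball convex_cball by metis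
  \<comment> \<open>The Lipschitz constants of \<open>b\<close> and of \<open>\<l>\<close>, and
    those of the coefficients weighted by bounds for the second derivatives of
    \<open>h\<close>.\<close>
  define C where "C = Lb + L\<l> + (\<Sum>i\<in>?B. \<Sum>j\<in>?B. La i j * M i j)"
  have "C \<ge> 0" unfolding C_def using Lb L\<l> La M by (intro add_nonneg_nonneg sum_nonneg mult_nonneg_nonneg) auto
  moreover have "(\<Sum>i\<in>?B. \<Sum>j\<in>?B. a i j (x, differential f x) * second_derivative (\<lambda>y. h y - f y) x i j)
      \<le> C * ((\<Sum>i\<in>?B. \<bar>frechet_derivative (\<lambda>y. h y - f y) (at x) i\<bar>) + (h x - f x))"
    if x: "x \<in> ball x0 r" for x
  proof -
    have xc: "x \<in> cball x0 r" and xS: "x \<in> S" using x S(2) by auto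
    have u': "frechet_derivative (\<lambda>y. h y - f y) (at y) i = frechet_derivative h (at y) i - frechet_derivative f (at y) i"
      if "y \<in> S" for y i
      using fun_cong[OF frechet_derivative_at[OF has_derivative_diff[OF smooth_on_has_derivative[OF h that]
              smooth_on_has_derivative[OF f that]]], of i] by simp
    have u'': "second_derivative (\<lambda>y. h y - f y) x i j = second_derivative h x i j - second_derivative f x i j" for i j
    proof -
      have "((\<lambda>y. frechet_derivative h (at y) i - frechet_derivative f (at y) i) has_derivative
          (\<lambda>v. second_derivative h x i v - second_derivative f x i v)) (at x)"
        by (intro has_derivative_diff smooth_on_has_derivative[OF smooth_on_frechet_derivative[OF h] xS]
            smooth_on_has_derivative[OF smooth_on_frechet_derivative[OF f] xS])
      then have "((\<lambda>y. frechet_derivative (\<lambda>y. h y - f y) (at y) i) has_derivative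
          (\<lambda>v. second_derivative h x i v - second_derivative f x i v)) (at x)"
        by (rule has_derivative_transform_within_open[OF _ S(1) xS]) (simp add: u')
      from fun_cong[OF frechet_derivative_at[OF this], of j] show ?thesis by simp
    qed
    define \<delta> where "\<delta> = (\<Sum>i\<in>?B. \<bar>frechet_derivative (\<lambda>y. h y - f y) (at x) i\<bar>)"
    let ?f = "(x, differential f x)" and ?h = "(x, differential h x)"
    have "norm (differential f x - differential h x) \<le> (\<Sum>i\<in>?B. \<bar>(differential f x - differential h x) \<bullet> i\<bar>)"
      by (rule norm_le_l1)
    also have "\<dots> = \<delta>"
      unfolding \<delta>_def u'[OF xS] inner_diff_left smooth_on_differential_inner[OF f xS] smooth_on_differential_inner[OF h xS]
      by (simp add: abs_minus_commute)
    finally have nd: "norm (differential f x - differential h x) \<le> \<delta>" .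
    then have n: "norm (?f - ?h) \<le> \<delta>" by simp
    have fK: "?f \<in> ?K" and hK: "?h \<in> ?K" using df[OF xc] xc by auto
    have T': "?f \<in> T" "?h \<in> T" using fK hK T(3) by blast+
    have u: "h x - f x \<ge> 0" using le[OF x] by simp
    have bS: "ball x0 r \<subseteq> S" using S(2) ball_subset_cball by blast
    have expand: "mean_curvature G dv p g x = \<l> (x, differential g x) +
        (\<Sum>b\<in>?B. \<Sum>j\<in>?B. a b j (x, differential g x) * second_derivative g x j b)"
      if g: "smooth_on S g" "\<And>y. y \<in> ball x0 r \<Longrightarrow> (y, differential g y) \<in> T" for g
      unfolding a_def \<l>_def D_def fst_conv
    proof (rule mean_curvature_expand[where dv = dv, OF open_ball x _ _ e(1,2) e(3)[OF xS] smooth_on_subset[OF G(1) bS]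
          smooth_on_subset[OF g(1) bS] sm\<Phi> g(2)[OF x]])
      show "alternating_form CARD('n) (dv y)" if "y \<in> ball x0 r" for y
        using that bS alt by blast
      show "smooth_on (ball x0 r) (\<lambda>y. dv y vs)" for vs
        using dv bS by (rule smooth_on_subset)
    qed (rule T(4)[OF g(2)])
    have gT: "(y, differential f y) \<in> T" "(y, differential h y) \<in> T" if "y \<in> ball x0 r" for y
      using df[of y] that T(3) by auto
    \<comment> \<open>The chain rule produces second derivatives with their indices in reverse
      order; symmetry of the coefficients allows the double sum to be transposed.\<close>
    have sym: "a i j ?f = a j i ?f" for i j
      using symmetric_inner[OF G(2)[OF xS], of i j]
      unfolding a_def D_def flux_derivative[OF T'(1) sm\<Phi> G(2)[OF xS] T(4)[OF T'(1)]]
      by (simp add: inner_add_right symmetric_inner[OF G(2)[OF xS], of _ "differential f x"])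
    have "(\<Sum>i\<in>?B. \<Sum>j\<in>?B. a i j ?f * second_derivative (\<lambda>y. h y - f y) x i j) =
        (\<Sum>i\<in>?B. \<Sum>j\<in>?B. a i j ?f * (second_derivative h x j i - second_derivative f x j i))"
      by (subst sum.swap) (simp add: u'' sym)
    also have "\<dots> = (\<Sum>i\<in>?B. \<Sum>j\<in>?B. a i j ?f * second_derivative h x j i) - (\<Sum>i\<in>?B. \<Sum>j\<in>?B. a i j ?f * second_derivative f x j i)"
      by (simp add: right_diff_distrib sum_subtractf)
    also have "\<dots> = (mean_curvature G dv p h x - mean_curvature G dv p f x) + (\<l> ?f - \<l> ?h) +
        ((\<Sum>i\<in>?B. \<Sum>j\<in>?B. a i j ?f * second_derivative h x j i) - (\<Sum>i\<in>?B. \<Sum>j\<in>?B. a i j ?h * second_derivative h x j i))"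
      using expand[OF f gT(1)] expand[OF h gT(2)] by simp
    also have "(\<Sum>i\<in>?B. \<Sum>j\<in>?B. a i j ?f * second_derivative h x j i) - (\<Sum>i\<in>?B. \<Sum>j\<in>?B. a i j ?h * second_derivative h x j i)
        = (\<Sum>i\<in>?B. \<Sum>j\<in>?B. (a i j ?f - a i j ?h) * second_derivative h x j i)"
      by (simp add: left_diff_distrib sum_subtractf)
    finally have 0: "(\<Sum>i\<in>?B. \<Sum>j\<in>?B. a i j ?f * second_derivative (\<lambda>y. h y - f y) x i j) =
      (mean_curvature G dv p h x - mean_curvature G dv p f x) + (\<l> ?f - \<l> ?h) +
      (\<Sum>i\<in>?B. \<Sum>j\<in>?B. (a i j ?f - a i j ?h) * second_derivative h x j i)" .
    have "(\<Sum>i\<in>?B. \<Sum>j\<in>?B. (a i j ?f - a i j ?h) * second_derivative h x j i) \<le> (\<Sum>i\<in>?B. \<Sum>j\<in>?B. (La i j * M i j) * \<delta>)"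
    proof (intro sum_mono)
      fix i j
      have "(a i j ?f - a i j ?h) * second_derivative h x j i \<le> \<bar>a i j ?f - a i j ?h\<bar> * \<bar>second_derivative h x j i\<bar>"
        by (simp only: abs_mult[symmetric] abs_ge_self)
      also have "\<dots> \<le> (La i j * \<delta>) * M i j"
        using order_trans[OF La(2)[OF fK hK] mult_left_mono[OF n La(1)]] M(2)[OF xc] La(1)[of i j] n
        by (intro mult_mono) (auto intro: mult_nonneg_nonneg order_trans[OF norm_ge_zero])
      finally show "(a i j ?f - a i j ?h) * second_derivative h x j i \<le> (La i j * M i j) * \<delta>"
        by (simp add: mult_ac)
    qed
    also have "\<dots> = (\<Sum>i\<in>?B. \<Sum>j\<in>?B. La i j * M i j) * \<delta>" by (simp add: sum_distrib_right)
    finally have 1: "(\<Sum>i\<in>?B. \<Sum>j\<in>?B. a i j ?f * second_derivative (\<lambda>y. h y - f y) x i j)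
      \<le> (mean_curvature G dv p h x - mean_curvature G dv p f x) + (\<l> ?f - \<l> ?h) + (\<Sum>i\<in>?B. \<Sum>j\<in>?B. La i j * M i j) * \<delta>"
      unfolding 0 by simp
    have 2: "\<l> ?f - \<l> ?h \<le> L\<l> * \<delta>"
      using order_trans[OF L\<l>(2)[OF fK hK] mult_left_mono[OF n L\<l>(1)]] by simp
    have "norm ((x, f x, differential f x) - (x, h x, differential h x)) \<le> norm (f x - h x) + norm (differential f x - differential h x)"
      using norm_Pair_le[of "f x - h x" "differential f x - differential h x"] by simp
    also have "\<dots> \<le> (h x - f x) + \<delta>" using nd u by simp
    finally have "Lb * norm ((x, f x, differential f x) - (x, h x, differential h x)) \<le> Lb * ((h x - f x) + \<delta>)"
      using Lb(1) by (rule mult_left_mono)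
    with Lb(2)[of "(x, f x, differential f x)" "(x, h x, differential h x)"]
    have 3: "b x (f x) (differential f x) - b x (h x) (differential h x) \<le> Lb * ((h x - f x) + \<delta>)"
      using df[OF xc] bd[OF xc] xc by (simp add: dist_norm)
    have "(\<Sum>i\<in>?B. \<Sum>j\<in>?B. La i j * M i j) * (h x - f x) \<ge> 0" "L\<l> * (h x - f x) \<ge> 0"
      using u L\<l> La M by (auto intro!: mult_nonneg_nonneg sum_nonneg)
    then show ?thesis
      unfolding \<delta>_def[symmetric] C_def using 1 2 3 ineq[OF x] by (simp add: distrib_left distrib_right)
  qed
  ultimately show ?thesis using that[of C] by (simp add: a_def D_def)
qed


subsection \<open>Normals and level sets\<close>

lemma nearest_point_normal:
  assumes "z \<in> F" "dist y z = infdist y F"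
  shows "ball (z + (y - z)) (norm (y - z)) \<inter> F = {}"
  using assms infdist_le[of _ F y] by (force simp: dist_norm)

text \<open>A point \<open>z\<close> of \<open>F\<close> nearest to \<open>y\<close> has
  \<open>y - z\<close> as exterior normal. It is no farther from \<open>y\<close> than
  \<open>x0\<close> is, so halving the radius keeps \<open>z\<close> in the ball where normals
  vanish.\<close>

lemma subset_if_no_normals:
  fixes F :: "'a::euclidean_space set"
  assumes F: "closed F" "x0 \<in> F"
    and no: "\<And>z \<nu>. z \<in> F \<Longrightarrow> z \<in> ball x0 \<rho> \<Longrightarrow> ball (z + \<nu>) (norm \<nu>) \<inter> F = {} \<Longrightarrow> \<nu> = 0"
  shows "ball x0 (\<rho> / 2) \<subseteq> F"
proof
  fix y assume y: "y \<in> ball x0 (\<rho> / 2)"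
  obtain z where z: "z \<in> F" "dist y z = infdist y F"
    using infdist_attains_inf[of F y] F by (metis empty_iff)
  have "dist y z \<le> dist y x0" using z(2) infdist_le[OF F(2), of y] by simp
  then have "z \<in> ball x0 \<rho>" using y dist_triangle[of x0 z y] by (simp add: dist_commute)
  then have "y - z = 0" using no[OF z(1) _ nearest_point_normal[OF z]] by blast
  then show "y \<in> F" using z(1) by simp
qed

lemma mean_value_segment:
  fixes f :: "'a::real_normed_vector \<Rightarrow> real"
  assumes f: "\<And>x. x \<in> S \<Longrightarrow> (f has_derivative f' x) (at x)" and S: "closed_segment z y \<subseteq> S"
  obtains \<xi> where "\<xi> \<in> closed_segment z y" "f y - f z = f' \<xi> (y - z)"
proof -
  have inS: "z + t *\<^sub>R (y - z) \<in> closed_segment z y" if "0 \<le> t" "t \<le> 1" for t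
    unfolding closed_segment_def using that by (auto intro!: exI[of _ t] simp: algebra_simps)
  have line: "((\<lambda>t. z + t *\<^sub>R (y - z)) has_derivative (\<lambda>t. t *\<^sub>R (y - z))) (at t)" for t
    by (auto intro!: derivative_eq_intros)
  have D: "((\<lambda>t. f (z + t *\<^sub>R (y - z))) has_real_derivative f' (z + t *\<^sub>R (y - z)) (y - z)) (at t)"
    if "0 \<le> t" "t \<le> 1" for t
  proof -
    note * = f[OF subsetD[OF S inS[OF that]]]
    show ?thesis
      using has_derivative_compose[OF line[of t] *] has_derivative_linear[OF *]
      by (simp add: has_field_derivative_def linear_cmul mult_commute_abs)
  qed
  have "\<exists>t. 0 < t \<and> t < 1 \<and> f (z + 1 *\<^sub>R (y - z)) - f (z + 0 *\<^sub>R (y - z)) = (1 - 0) * f' (z + t *\<^sub>R (y - z)) (y - z)"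
    by (rule MVT2) (use D in auto)
  then obtain t where "0 < t" "t < 1" "f y - f z = f' (z + t *\<^sub>R (y - z)) (y - z)" by auto
  then show ?thesis using that[OF inS[of t]] by simp
qed

text \<open>Near \<open>z\<close> the exterior ball misses the level set, so by connectedness
  \<open>f\<close> stays on one side of \<open>f z\<close> there. Hence \<open>f'\<close> has one
  sign on the half-space of directions with positive component along \<open>\<nu>\<close> and
  vanishes on its boundary, that is, \<open>f'\<close> is a nonzero multiple of the pairing with
  \<open>\<nu>\<close>.\<close>

lemma level_set_normal_orthogonal:
  fixes f :: "'a::euclidean_space \<Rightarrow> real"
  assumes f: "(f has_derivative f') (at z)" and cont: "continuous_on (ball z \<rho>) f" and \<rho>: "\<rho> > 0"
    and \<nu>: "\<And>x. x \<in> ball z \<rho> \<Longrightarrow> x \<in> ball (z + \<nu>) (norm \<nu>) \<Longrightarrow> f x \<noteq> f z"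
    and w: "f' w \<noteq> 0" and X: "f' X = 0"
  shows "X \<bullet> \<nu> = 0"
proof (cases "\<nu> = 0")
  case False
  have lin: "linear f'" using f has_derivative_linear by blast
  let ?B = "ball z \<rho> \<inter> ball (z + \<nu>) (norm \<nu>)"
  have "connected (f ` ?B)"
    by (intro connected_continuous_image continuous_on_subset[OF cont] convex_connected convex_Int convex_ball) auto
  have "\<not> (f x < f z \<and> f z < f y)" if "x \<in> ?B" "y \<in> ?B" for x y
  proof
    assume "f x < f z \<and> f z < f y"
    moreover have "{f x..f y} \<subseteq> f ` ?B"
      using \<open>connected (f ` ?B)\<close> that by (intro connected_contains_Icc) auto
    ultimately have "f z \<in> f ` ?B" by auto
    then show False using \<nu> by force
  qed
  then have "(\<forall>x\<in>?B. 1 * (f x - f z) > 0) \<or> (\<forall>x\<in>?B. (-1) * (f x - f z) > 0)"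
    using \<nu> by (smt (verit) IntE)
  then obtain s :: real where s: "\<And>x. x \<in> ?B \<Longrightarrow> s * (f x - f z) > 0" "s = 1 \<or> s = -1" by blast
  have half: "s * f' u \<ge> 0" if u: "u \<bullet> \<nu> > 0" for u
  proof (rule ccontr)
    assume neg: "\<not> s * f' u \<ge> 0"
    have line: "((\<lambda>t. z + t *\<^sub>R u) has_derivative (\<lambda>t. t *\<^sub>R u)) (at 0)"
      by (auto intro!: derivative_eq_intros)
    have "((\<lambda>t. f (z + t *\<^sub>R u)) has_derivative (\<lambda>t. f' (t *\<^sub>R u))) (at 0)"
      using has_derivative_compose[OF line, of f f'] f by simp
    then have "((\<lambda>t. f (z + t *\<^sub>R u)) has_real_derivative f' u) (at 0)"
      using lin by (simp add: has_field_derivative_def linear_cmul mult_commute_abs)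
    then have "((\<lambda>t. s * f (z + t *\<^sub>R u)) has_real_derivative s * f' u) (at 0)"
      by (rule DERIV_cmult)
    from DERIV_neg_dec_right[OF this] neg obtain d where d: "d > 0"
      "\<And>h. 0 < h \<Longrightarrow> h < d \<Longrightarrow> s * f (z + h *\<^sub>R u) < s * f z" by auto
    have u0: "u \<noteq> 0" using u by auto
    have "\<rho> / (2 * norm u) > 0" "(u \<bullet> \<nu>) / (u \<bullet> u) > 0" "d / 2 > 0"
      using d \<rho> u u0 by (auto intro!: divide_pos_pos)
    then obtain h where h: "0 < h" "h \<le> d / 2" "h \<le> \<rho> / (2 * norm u)" "h \<le> (u \<bullet> \<nu>) / (u \<bullet> u)"
      using that[of "min (d / 2) (min (\<rho> / (2 * norm u)) ((u \<bullet> \<nu>) / (u \<bullet> u)))"]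
      by (meson min.cobounded1 min.cobounded2 min_less_iff_conj order_trans)
    have hd: "h < d" using h d by linarith
    have "h * norm u \<le> \<rho> / 2" using h(3) u0 by (simp add: field_simps)
    then have 1: "z + h *\<^sub>R u \<in> ball z \<rho>" using h(1) \<rho> by (simp add: dist_norm)
    have "h * (u \<bullet> u) \<le> u \<bullet> \<nu>" using h(4) u0 by (simp add: pos_le_divide_eq)
    then have "h * (u \<bullet> u) < 2 * (u \<bullet> \<nu>)" using u by linarith
    then have "h * (h * (u \<bullet> u)) < h * (2 * (u \<bullet> \<nu>))" using h(1) by (rule mult_strict_left_mono)
    then have "(norm (h *\<^sub>R u - \<nu>))\<^sup>2 < (norm \<nu>)\<^sup>2"
      by (simp add: power2_norm_eq_inner inner_diff_left inner_diff_right inner_commute)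
    then have "norm (h *\<^sub>R u - \<nu>) < norm \<nu>" by (rule power_less_imp_less_base) simp
    then have 2: "z + h *\<^sub>R u \<in> ball (z + \<nu>) (norm \<nu>)" by (simp add: dist_norm norm_minus_commute)
    show False using s(1)[of "z + h *\<^sub>R u"] 1 2 d(2)[OF h(1) hd] by (simp add: right_diff_distrib)
  qed
  have tangential: "s * f' v \<ge> 0" if v: "v \<bullet> \<nu> = 0" for v
  proof (rule ccontr)
    assume neg: "\<not> s * f' v \<ge> 0"
    \<comment> \<open>Small enough that tilting \<open>v\<close> by
      \<open>\<epsilon> *\<^sub>R \<nu>\<close> into the half-space raises the negative value by at
      most half of its size.\<close>
    define \<epsilon> where "\<epsilon> = - (s * f' v) / (2 * (\<bar>s * f' \<nu>\<bar> + 1))"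
    have \<epsilon>: "\<epsilon> > 0" unfolding \<epsilon>_def using neg by (intro divide_pos_pos) auto
    have "(v + \<epsilon> *\<^sub>R \<nu>) \<bullet> \<nu> > 0" using v \<epsilon> False by (simp add: inner_add_left)
    from half[OF this] have "s * f' v + \<epsilon> * (s * f' \<nu>) \<ge> 0"
      by (simp add: linear_add[OF lin] linear_cmul[OF lin] algebra_simps)
    moreover have "\<epsilon> * (s * f' \<nu>) \<le> \<epsilon> * (\<bar>s * f' \<nu>\<bar> + 1)" using \<epsilon> by (intro mult_left_mono) auto
    moreover have "\<epsilon> * (\<bar>s * f' \<nu>\<bar> + 1) = - (s * f' v) / 2" by (simp add: \<epsilon>_def field_simps)
    ultimately show False using neg by linarith
  qed
  have zero: "f' v = 0" if "v \<bullet> \<nu> = 0" for v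
    using tangential[OF that] tangential[of "- v"] that s(2) by (auto simp: linear_neg[OF lin])
  have split: "f' v = (v \<bullet> \<nu>) / (\<nu> \<bullet> \<nu>) * f' \<nu>" for v
  proof -
    have "f' (v - ((v \<bullet> \<nu>) / (\<nu> \<bullet> \<nu>)) *\<^sub>R \<nu>) = 0"
      using False by (intro zero) (simp add: inner_diff_left)
    then show ?thesis by (simp add: linear_diff[OF lin] linear_cmul[OF lin])
  qed
  have "f' \<nu> \<noteq> 0" using w split[of w] by auto
  then show ?thesis using X split[of X] False by simp
qed simp

text \<open>By Taylor's formula a displacement \<open>d\<close> within the level set satisfies
  \<open>\<bar>differential f z \<bullet> d\<bar> \<le> Q * (d \<bullet> d)\<close>, and
  \<open>2 * s * Q \<le> 1\<close> then keeps it out of the ball. A positive multiple of the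
  gradient is thus an exterior normal of the level set.\<close>

lemma level_set_has_normal:
  fixes f :: "real^'n::finite \<Rightarrow> real"
  assumes f: "smooth_on S f" and r: "cball x0 r \<subseteq> S" and z: "z \<in> ball x0 r"
  obtains s where "s > 0" "\<And>x. x \<in> cball x0 r \<Longrightarrow> f x = f z \<Longrightarrow>
    x \<notin> ball (z + s *\<^sub>R differential f z) (norm (s *\<^sub>R differential f z))"
proof -
  have zc: "z \<in> cball x0 r" using z by simp
  obtain Q where Q: "Q \<ge> 0" "\<And>y. y \<in> cball x0 r \<Longrightarrow>
      norm (f y - f z - frechet_derivative f (at z) (y - z)) \<le> Q * (norm (y - z))\<^sup>2"
    using smooth_on_taylor2[OF f compact_cball convex_cball r zc] by blast
  define s where "s = 1 / (2 * (Q + 1))"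
  have s: "s > 0" using Q by (simp add: s_def)
  have "x \<notin> ball (z + s *\<^sub>R differential f z) (norm (s *\<^sub>R differential f z))"
    if x: "x \<in> cball x0 r" "f x = f z" for x
  proof
    assume "x \<in> ball (z + s *\<^sub>R differential f z) (norm (s *\<^sub>R differential f z))"
    define d where "d = x - z"
    define e where "e = s *\<^sub>R differential f z"
    have "norm (d - e) < norm e"
      using \<open>x \<in> ball _ _\<close> by (simp add: d_def e_def dist_norm norm_minus_commute diff_diff_eq)
    then have "(norm (d - e))\<^sup>2 < (norm e)\<^sup>2"
      by (intro power_strict_mono) auto
    then have "d \<bullet> d < 2 * (e \<bullet> d)"
      by (simp add: power2_norm_eq_inner inner_diff_left inner_diff_right inner_commute)
    then have 1: "d \<bullet> d < 2 * s * (differential f z \<bullet> d)" by (simp add: e_def)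
    have "\<bar>differential f z \<bullet> d\<bar> \<le> Q * (d \<bullet> d)"
      using Q(2)[OF x(1)] x(2) smooth_on_differential_inner[OF f, of z d] r zc
      by (auto simp: d_def power2_norm_eq_inner)
    then have "2 * s * (differential f z \<bullet> d) \<le> 2 * s * (Q * (d \<bullet> d))" using s by (intro mult_left_mono) auto
    also have "\<dots> = (2 * s * Q) * (d \<bullet> d)" by simp
    also have "\<dots> \<le> 1 * (d \<bullet> d)" using Q by (intro mult_right_mono) (auto simp: s_def field_simps)
    finally show False using 1 by simp
  qed
  then show ?thesis using that s by blast
qed

text \<open>If all exterior normals of \<open>F\<close> are normal to the level sets of \<open>f\<close>, then \<open>F\<close> contains the
  level set through each of its points: minimise \<open>(norm (z - y))\<^sup>2 + k * (f z)\<^sup>2\<close> over \<open>z \<in> F\<close> and let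
  \<open>k\<close> tend to infinity.\<close>

lemma level_set_subset:
  fixes f :: "real^'n::finite \<Rightarrow> real"
  assumes f: "smooth_on S f" and r: "cball x0 r \<subseteq> S" "\<rho> \<le> r" and F: "closed F" "F \<subseteq> cball x0 r"
    and x0: "x0 \<in> F" "f x0 = 0"
    and \<kappa>: "\<kappa> > 0" "\<And>\<xi> z. \<xi> \<in> ball x0 \<rho> \<Longrightarrow> z \<in> ball x0 \<rho> \<Longrightarrow>
      \<kappa> * norm (differential f z) \<le> differential f \<xi> \<bullet> differential f z"
    and normal: "\<And>z \<nu>. z \<in> F \<Longrightarrow> z \<in> ball x0 \<rho> \<Longrightarrow> ball (z + \<nu>) (norm \<nu>) \<inter> F = {} \<Longrightarrow>
      \<exists>c. \<nu> = c *\<^sub>R differential f z"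
    and y: "y \<in> ball x0 (\<rho> / 2)" "f y = 0"
  shows "y \<in> F"
proof -
  have cF: "compact F" using F by (meson bounded_cball bounded_subset compact_eq_bounded_closed)
  have fc: "continuous_on F f" using smooth_on_continuous[OF f] F(2) r(1) continuous_on_subset by blast
  define a where "a = norm (x0 - y)"
  have a: "a < \<rho> / 2" using y(1) by (simp add: a_def dist_norm)
  \<comment> \<open>For every weight \<open>k\<close> the squared distance of \<open>y\<close> from
    \<open>F\<close> is bounded by a fixed number divided by \<open>k\<close>, so it is
    zero.\<close>
  have main: "(infdist y F)\<^sup>2 * (\<kappa>\<^sup>2 * k) \<le> a\<^sup>2" if k: "k > 0" for k
  proof -
    define J where "J = (\<lambda>x. (norm (x - y))\<^sup>2 + k * (f x)\<^sup>2)"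
    have "continuous_on F J" unfolding J_def by (intro continuous_intros fc)
    then obtain z where z: "z \<in> F" "\<And>x. x \<in> F \<Longrightarrow> J z \<le> J x"
      using continuous_attains_inf[OF cF, of J] x0 by blast
    have J: "(norm (z - y))\<^sup>2 + k * (f z)\<^sup>2 \<le> a\<^sup>2"
      using z(2)[OF x0(1)] x0(2) by (simp add: J_def a_def)
    moreover have "k * (f z)\<^sup>2 \<ge> 0" using k by simp
    ultimately have "(norm (z - y))\<^sup>2 \<le> a\<^sup>2" by linarith
    then have za: "norm (z - y) \<le> a" by (rule power2_le_imp_le) (simp add: a_def)
    have zb: "z \<in> ball x0 \<rho>"
      using norm_triangle_ineq[of "x0 - y" "y - z"] za a by (simp add: dist_norm a_def norm_minus_commute)
    have yb: "y \<in> ball x0 \<rho>" using a norm_ge_zero[of "x0 - y"] unfolding a_def mem_ball dist_norm by linarith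
    have zc: "z \<in> cball x0 r" using F z by blast
    have zS: "z \<in> S" using zc r by blast
    define \<omega> where "\<omega> = differential f z"
    have \<omega>: "frechet_derivative f (at z) v = \<omega> \<bullet> v" for v
      unfolding \<omega>_def using smooth_on_differential_inner[OF f zS] by simp
    obtain Q where Q: "Q \<ge> 0" "\<And>x. x \<in> cball x0 r \<Longrightarrow> norm (f x - f z - \<omega> \<bullet> (x - z)) \<le> Q * (norm (x - z))\<^sup>2"
      using smooth_on_taylor2[OF f compact_cball convex_cball r(1) zc] unfolding \<omega> by blast
    obtain L where L: "L \<ge> 0" "\<And>x. x \<in> cball x0 r \<Longrightarrow> norm (f x - f z) \<le> L * norm (x - z)"
      using smooth_on_lipschitz[OF f compact_cball convex_cball r(1)] zc by metis
    define C where "C = L\<^sup>2 + 2 * \<bar>f z\<bar> * Q"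
    have C: "C \<ge> 0" using Q by (simp add: C_def)
    \<comment> \<open>Expanding \<open>J x \<ge> J z\<close> in \<open>d = x - z\<close> gives
      \<open>2 * (d \<bullet> v) \<le> (1 + k * C) * (d \<bullet> d)\<close> with
      \<open>v = y - z - (k * f z) *\<^sub>R \<omega>\<close>; this says that \<open>v\<close>
      divided by \<open>1 + k * C\<close> is an exterior normal at \<open>z\<close>.\<close>
    define \<nu> where "\<nu> = (1 / (1 + k * C)) *\<^sub>R (y - z - (k * f z) *\<^sub>R \<omega>)"
    have kC: "1 + k * C > 0" using k C by (simp add: add_pos_nonneg)
    have "x \<notin> ball (z + \<nu>) (norm \<nu>)" if x: "x \<in> F" for x
    proof -
      define d where "d = x - z"
      have xc: "x \<in> cball x0 r" using x F by blast
      have "(f x - f z)\<^sup>2 \<le> (L * norm d)\<^sup>2"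
        using power_mono[OF L(2)[OF xc] norm_ge_zero, of 2] by (simp add: d_def)
      then have 1: "(f x - f z)\<^sup>2 \<le> L\<^sup>2 * (d \<bullet> d)" by (simp add: power_mult_distrib power2_norm_eq_inner)
      have "2 * f z * (f x - f z - \<omega> \<bullet> d) \<le> \<bar>2 * f z * (f x - f z - \<omega> \<bullet> d)\<bar>" by (rule abs_ge_self)
      also have "\<dots> = 2 * \<bar>f z\<bar> * \<bar>f x - f z - \<omega> \<bullet> d\<bar>" by (simp add: abs_mult)
      also have "\<dots> \<le> 2 * \<bar>f z\<bar> * (Q * (d \<bullet> d))"
        using Q(2)[OF xc] by (intro mult_left_mono) (auto simp: d_def power2_norm_eq_inner)
      finally have 2: "2 * f z * (f x - f z - \<omega> \<bullet> d) \<le> 2 * \<bar>f z\<bar> * Q * (d \<bullet> d)" by simp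
      have "(f x)\<^sup>2 - (f z)\<^sup>2 = (f x - f z)\<^sup>2 + 2 * f z * (f x - f z - \<omega> \<bullet> d) + 2 * f z * (\<omega> \<bullet> d)"
        by (simp add: power2_eq_square algebra_simps)
      then have "(f x)\<^sup>2 - (f z)\<^sup>2 \<le> C * (d \<bullet> d) + 2 * f z * (\<omega> \<bullet> d)"
        using 1 2 by (simp add: C_def distrib_right)
      then have 3: "k * ((f x)\<^sup>2 - (f z)\<^sup>2) \<le> k * (C * (d \<bullet> d) + 2 * f z * (\<omega> \<bullet> d))"
        using k by (intro mult_left_mono) auto
      have "J x - J z = d \<bullet> d - 2 * (d \<bullet> (y - z)) + k * ((f x)\<^sup>2 - (f z)\<^sup>2)"
        by (simp add: J_def d_def power2_norm_eq_inner inner_diff_left inner_diff_right inner_commute right_diff_distrib)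
      moreover have "J x - J z \<ge> 0" using z(2)[OF x] by simp
      ultimately have "0 \<le> (1 + k * C) * (d \<bullet> d) - 2 * (d \<bullet> (y - z - (k * f z) *\<^sub>R \<omega>))"
        using 3 by (simp add: inner_diff_right inner_commute[of d \<omega>] algebra_simps)
      also have "y - z - (k * f z) *\<^sub>R \<omega> = (1 + k * C) *\<^sub>R \<nu>" using kC by (simp add: \<nu>_def)
      finally have "0 \<le> (1 + k * C) * (d \<bullet> d - 2 * (d \<bullet> \<nu>))" by (simp add: algebra_simps)
      then have "0 \<le> d \<bullet> d - 2 * (d \<bullet> \<nu>)" using kC by (simp add: zero_le_mult_iff)
      then have "(norm \<nu>)\<^sup>2 \<le> (norm (d - \<nu>))\<^sup>2"
        by (simp add: power2_norm_eq_inner inner_diff_left inner_diff_right inner_commute)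
      then have "norm \<nu> \<le> norm (d - \<nu>)" by (rule power2_le_imp_le) simp
      then show ?thesis by (simp add: d_def dist_norm norm_minus_commute diff_diff_eq)
    qed
    then have "ball (z + \<nu>) (norm \<nu>) \<inter> F = {}" by blast
    then obtain c where c: "\<nu> = c *\<^sub>R \<omega>" using normal[OF z(1) zb] unfolding \<omega>_def by blast
    have "(1 + k * C) *\<^sub>R \<nu> = y - z - (k * f z) *\<^sub>R \<omega>" using kC by (simp add: \<nu>_def)
    then have "y - z = (1 + k * C) *\<^sub>R (c *\<^sub>R \<omega>) + (k * f z) *\<^sub>R \<omega>" using c by simp
    also have "\<dots> = ((1 + k * C) * c + k * f z) *\<^sub>R \<omega>" by (simp only: scaleR_scaleR scaleR_add_left)
    finally have "y - z = ((1 + k * C) * c + k * f z) *\<^sub>R \<omega>" .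
    then obtain c' where c': "y - z = c' *\<^sub>R \<omega>" by blast
    \<comment> \<open>As \<open>y - z\<close> is parallel to the gradient at \<open>z\<close>,
      \<open>f\<close> changes along the segment at a rate of at least \<kappa>. With
      \<open>f y = 0\<close> the distance is controlled by \<open>\<bar>f z\<bar>\<close>, which the
      penalty term makes small.\<close>
    have seg: "closed_segment z y \<subseteq> ball x0 \<rho>" using zb yb by (intro closed_segment_subset) auto
    moreover have "ball x0 \<rho> \<subseteq> S" using r by force
    ultimately obtain \<xi> where \<xi>: "\<xi> \<in> closed_segment z y" "f y - f z = frechet_derivative f (at \<xi>) (y - z)"
      using mean_value_segment[of S f "\<lambda>x. frechet_derivative f (at x)" z y] smooth_on_has_derivative[OF f] by blast
    have \<xi>b: "\<xi> \<in> ball x0 \<rho>" "\<xi> \<in> S" using \<xi>(1) seg \<open>ball x0 \<rho> \<subseteq> S\<close> by blast+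
    have "- f z = c' * (differential f \<xi> \<bullet> \<omega>)"
      using \<xi>(2) y(2) smooth_on_differential_inner[OF f \<xi>b(2), of "y - z"] c' by simp
    then have fz: "\<bar>f z\<bar> = \<bar>c'\<bar> * \<bar>differential f \<xi> \<bullet> \<omega>\<bar>" by (metis abs_minus_cancel abs_mult)
    have "\<kappa> * norm (y - z) = \<bar>c'\<bar> * (\<kappa> * norm \<omega>)" by (simp add: c')
    also have "\<dots> \<le> \<bar>c'\<bar> * \<bar>differential f \<xi> \<bullet> \<omega>\<bar>"
      using \<kappa>(2)[OF \<xi>b(1) zb] unfolding \<omega>_def by (intro mult_left_mono) auto
    finally have "\<kappa> * norm (y - z) \<le> \<bar>f z\<bar>" using fz by simp
    moreover have "infdist y F \<le> norm (y - z)" using infdist_le[OF z(1), of y] by (simp add: dist_norm)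
    ultimately have "\<kappa> * infdist y F \<le> \<bar>f z\<bar>" using \<kappa>(1) by (meson mult_left_mono less_imp_le order_trans)
    then have "(\<kappa> * infdist y F)\<^sup>2 \<le> (f z)\<^sup>2"
      using \<kappa>(1) infdist_nonneg[of y F] power_mono[of "\<kappa> * infdist y F" "\<bar>f z\<bar>" 2] by simp
    then have "k * (\<kappa> * infdist y F)\<^sup>2 \<le> k * (f z)\<^sup>2" using k by (intro mult_left_mono) auto
    also have "\<dots> \<le> a\<^sup>2" using J by (smt (verit) zero_le_power2)
    finally show ?thesis by (simp add: power_mult_distrib mult_ac)
  qed
  have "infdist y F = 0"
  proof (rule ccontr)
    assume "infdist y F \<noteq> 0"
    then have pos: "(infdist y F)\<^sup>2 * \<kappa>\<^sup>2 > 0" using \<kappa>(1) by simp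
    have "(a\<^sup>2 + 1) / ((infdist y F)\<^sup>2 * \<kappa>\<^sup>2) > 0" using pos by (intro divide_pos_pos) (auto simp: add_nonneg_pos)
    from main[OF this] show False using pos by (simp add: field_simps)
  qed
  then show "y \<in> F" using F(1) x0(1) in_closed_iff_infdist_zero[of F y] by blast
qed

text \<open>Diagonal dominance: pair a vanishing combination with \<open>v j\<close> for the largest
  \<open>\<bar>c j\<bar>\<close>; the \<open>r\<close> perturbations together reach at most the
  fraction \<open>r / (r + 1)\<close> of the main term.\<close>

lemma independent_near_orthonormal:
  fixes w v :: "nat \<Rightarrow> 'a::euclidean_space"
  assumes N: "N > 0"
    and near: "\<And>j k. j < r \<Longrightarrow> k < r \<Longrightarrow> \<bar>v j \<bullet> w k - (if j = k then N else 0)\<bar> < N / (r + 1)"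
  shows "inj_on w {..<r} \<and> independent (w ` {..<r})"
proof -
  have key: "c k = 0" if c: "(\<Sum>k<r. c k *\<^sub>R w k) = 0" and k: "k < r" for c k
  proof -
    have ne: "(\<lambda>k. \<bar>c k\<bar>) ` {..<r} \<noteq> {}" using k by auto
    obtain j where j: "j < r" "\<bar>c j\<bar> = Max ((\<lambda>k. \<bar>c k\<bar>) ` {..<r})"
      using Max_in[OF _ ne] by auto
    have max: "\<bar>c k\<bar> \<le> \<bar>c j\<bar>" if "k < r" for k using that j(2) by (auto intro: Max_ge)
    have "0 = v j \<bullet> (\<Sum>k<r. c k *\<^sub>R w k)" using c by simp
    also have "\<dots> = (\<Sum>k<r. c k * (v j \<bullet> w k - (if j = k then N else 0)) + (if j = k then c k * N else 0))"
      unfolding inner_sum_right by (intro sum.cong) (auto simp: algebra_simps)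
    also have "\<dots> = (\<Sum>k<r. c k * (v j \<bullet> w k - (if j = k then N else 0))) + c j * N"
      using j(1) by (simp add: sum.distrib)
    finally have "c j * N = - (\<Sum>k<r. c k * (v j \<bullet> w k - (if j = k then N else 0)))" by simp
    then have "\<bar>c j\<bar> * N = \<bar>\<Sum>k<r. c k * (v j \<bullet> w k - (if j = k then N else 0))\<bar>"
      using N by (metis abs_minus_cancel abs_mult abs_of_pos)
    also have "\<dots> \<le> (\<Sum>k<r. \<bar>c k * (v j \<bullet> w k - (if j = k then N else 0))\<bar>)" by (rule sum_abs)
    also have "\<dots> \<le> (\<Sum>k<r. \<bar>c j\<bar> * (N / (r + 1)))"
    proof (rule sum_mono)
      fix k assume "k \<in> {..<r}"
      then show "\<bar>c k * (v j \<bullet> w k - (if j = k then N else 0))\<bar> \<le> \<bar>c j\<bar> * (N / (r + 1))"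
        unfolding abs_mult by (intro mult_mono max less_imp_le[OF near[OF j(1)]]) auto
    qed
    also have "\<dots> = \<bar>c j\<bar> * N * (r / (r + 1))" by simp
    finally have "\<bar>c j\<bar> * N * (1 - r / (r + 1)) \<le> 0" by (simp add: right_diff_distrib)
    moreover have "1 - real r / (real r + 1) > 0" by (simp add: field_simps)
    ultimately have "\<bar>c j\<bar> * N \<le> 0" by (simp add: mult_le_0_iff add.commute)
    then have "c j = 0" using N by (simp add: mult_le_0_iff)
    then show ?thesis using max[OF k] by simp
  qed
  have inj: "inj_on w {..<r}"
  proof (rule inj_onI, rule ccontr)
    fix i j assume ij: "i \<in> {..<r}" "j \<in> {..<r}" "w i = w j" "i \<noteq> j"
    let ?c = "\<lambda>k. if k = i then 1 else if k = j then -1 else (0::real)"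
    have "(\<Sum>k<r. ?c k *\<^sub>R w k) = (\<Sum>k\<in>{i, j}. ?c k *\<^sub>R w k)"
      using ij by (intro sum.mono_neutral_right) auto
    also have "\<dots> = 0" using ij by simp
    finally show False using key[of ?c i] ij by simp
  qed
  have "independent (w ` {..<r})"
  proof (rule independent_if_scalars_zero)
    fix c x assume c: "(\<Sum>x\<in>w ` {..<r}. c x *\<^sub>R x) = 0" and x: "x \<in> w ` {..<r}"
    obtain k where k: "k < r" "x = w k" using x by auto
    have "(\<Sum>k<r. c (w k) *\<^sub>R w k) = 0" using c by (simp add: sum.reindex[OF inj])
    from key[OF this k(1)] show "c x = 0" using k by simp
  qed simp
  then show ?thesis using inj by blast
qed


subsection \<open>The strong maximum principle in coordinates\<close>

lemma eventually_in_open: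
  fixes g :: "'a::metric_space \<Rightarrow> 'b::topological_space"
  assumes "continuous_on S g" "open S" "x \<in> S" "open T" "g x \<in> T"
  shows "\<forall>\<^sub>F y in nhds x. g y \<in> T"
proof -
  have "isCont g x" using assms continuous_on_eq_continuous_at by blast
  then have "(g \<longlongrightarrow> g x) (nhds x)"
    by (simp add: isCont_def tendsto_at_iff_tendsto_nhds)
  then show ?thesis using assms(4,5) by (rule topological_tendstoD)
qed

text \<open>Shrinks to a ball on which all hypotheses hold and both differentials stay in a convex
  set of covectors inside the domain of the flux, then applies the barrier argument. The last claim
  is the kernel condition, decoded by \<open>flux_quadratic_form\<close>.\<close>

lemma max_principle_normals:
  fixes dv :: "real^'n::finite \<Rightarrow> (real^'n) list \<Rightarrow> real" and f h :: "real^'n \<Rightarrow> real"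
  assumes S: "open S" "x0 \<in> S" and alt: "\<And>y. y \<in> S \<Longrightarrow> alternating_form CARD('n) (dv y)"
    and dv: "\<And>vs. smooth_on S (\<lambda>y. dv y vs)" and nz: "\<And>y. y \<in> S \<Longrightarrow> \<exists>vs. dv y vs \<noteq> 0"
    and G: "smooth_on S G" "\<And>x. x \<in> S \<Longrightarrow> transpose (G x) = G x"
      "\<And>x \<omega>. x \<in> S \<Longrightarrow> 0 \<le> coinner (G x) \<omega> \<omega>"
    and f: "smooth_on S f" and h: "smooth_on S h" and zero: "f x0 = 0" "h x0 = 0"
    and N: "coinner (G x0) (differential f x0) (differential f x0) > 0" and p: "p \<ge> 0"
    and b: "open W" "x0 \<in> W" "smooth_on (W \<times> UNIV \<times> UNIV) (\<lambda>(x, z, \<xi>). b x z \<xi>)"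
    and ineq: "\<forall>\<^sub>F x in nhds x0. mean_curvature G dv p h x + b x (h x) (differential h x)
      \<le> mean_curvature G dv p f x + b x (f x) (differential f x)"
    and le: "\<forall>\<^sub>F x in nhds x0. f x \<le> h x"
  obtains r where "r > 0" "cball x0 r \<subseteq> S" "differential h x0 = differential f x0"
    "\<And>x. x \<in> cball x0 r \<Longrightarrow> coinner (G x) (differential f x) (differential f x) > 0"
    "\<And>z \<nu>. z \<in> ball x0 r \<Longrightarrow> h z = f z \<Longrightarrow> ball (z + \<nu>) (norm \<nu>) \<inter> {x \<in> cball x0 r. h x = f x} = {} \<Longrightarrow>
      coinner (G z) (differential f z) (differential f z) *\<^sub>R (G z *v \<nu>) =
        (differential f z \<bullet> (G z *v \<nu>)) *\<^sub>R (G z *v differential f z) \<and>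
      (p > 0 \<longrightarrow> G z *v \<nu> = 0)"
proof -
  obtain e where e: "distinct e" "set e = (Basis :: (real^'n) set)" using exists_basis_list by blast
  have nze: "dv y e \<noteq> 0" if "y \<in> S" for y
    using alternating_eq_0[OF alt[OF that] e] nz[OF that] by blast
  define \<omega>0 where "\<omega>0 = differential f x0"
  have "\<forall>\<^sub>F x in nhds x0. x \<in> S \<and> f x \<le> h x"
    using le S by (intro eventually_conj eventually_nhds_in_open) auto
  then obtain d where d: "d > 0" "\<And>x. dist x x0 < d \<Longrightarrow> x \<in> S \<and> f x \<le> h x"
    unfolding eventually_nhds_metric by auto
  \<comment> \<open>\<open>h - f\<close> has a local minimum at \<open>x0\<close>, so the
    differentials agree there and both stay close to the one covector
    \<open>\<omega>0\<close>.\<close>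
  have "(\<lambda>v. frechet_derivative h (at x0) v - frechet_derivative f (at x0) v) = (\<lambda>v. 0)"
  proof (rule differential_zero_maxmin[of x0 "ball x0 d" "\<lambda>x. h x - f x"])
    show "((\<lambda>x. h x - f x) has_derivative (\<lambda>v. frechet_derivative h (at x0) v - frechet_derivative f (at x0) v)) (at x0)"
      by (intro has_derivative_diff smooth_on_has_derivative[OF h S(2)] smooth_on_has_derivative[OF f S(2)])
  qed (use d zero in \<open>auto simp: dist_commute\<close>)
  then have "frechet_derivative h (at x0) = frechet_derivative f (at x0)" by (metis (no_types, lifting) eq_iff_diff_eq_0 ext)
  then have h0: "differential h x0 = \<omega>0" by (simp add: differential_def \<omega>0_def)
  let ?\<Phi> = "flux p G"
  define T where "T = (S \<times> UNIV) \<inter> (\<lambda>y. coinner (G (fst y)) (snd y) (snd y)) -` {0<..}"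
  have oSU: "open (S \<times> (UNIV :: (real^'n) set))" using S by (intro open_Times) auto
  have "smooth_on (S \<times> UNIV) (\<lambda>y :: (real^'n) \<times> (real^'n). coinner (G (fst y)) (snd y) (snd y))"
    unfolding coinner_def
    by (intro smooth_on_inner smooth_on_matrix_vector oSU smooth_on_compose_fst[OF S(1) G(1) oSU order_refl]
        smooth_on_bounded_linear[OF bounded_linear_snd] smooth_on_ident)
  then have oT: "open T"
    unfolding T_def by (intro continuous_open_preimage smooth_on_continuous oSU) auto
  have TS: "T \<subseteq> S \<times> UNIV" by (auto simp: T_def)
  have Tpos: "coinner (G x) \<omega> \<omega> > 0" if "(x, \<omega>) \<in> T" for x \<omega> using that by (simp add: T_def)
  have "(x0, \<omega>0) \<in> T" using N S by (simp add: T_def \<omega>0_def)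
  then obtain A B where AB: "open A" "open B" "(x0, \<omega>0) \<in> A \<times> B" "A \<times> B \<subseteq> T"
    by (rule open_prod_elim[OF oT])
  obtain s where s: "s > 0" "cball \<omega>0 s \<subseteq> B" using AB open_contains_cball[of B] by auto
  note cdf = smooth_on_continuous[OF smooth_on_differential[OF S(1) f]]
    and cdh = smooth_on_continuous[OF smooth_on_differential[OF S(1) h]]
  let ?near = "\<lambda>x. x \<in> S \<and> x \<in> A \<and> x \<in> W \<and> differential f x \<in> ball \<omega>0 s \<and> differential h x \<in> ball \<omega>0 s
      \<and> f x \<in> ball 0 1 \<and> h x \<in> ball 0 1 \<and> f x \<le> h x \<and>
      mean_curvature G dv p h x + b x (h x) (differential h x) \<le> mean_curvature G dv p f x + b x (f x) (differential f x)"
  have "\<forall>\<^sub>F x in nhds x0. ?near x"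
    using AB b S s zero h0 \<omega>0_def
    by (intro eventually_conj eventually_nhds_in_open ineq le eventually_in_open[OF cdf] eventually_in_open[OF cdh]
        eventually_in_open[OF smooth_on_continuous[OF f]] eventually_in_open[OF smooth_on_continuous[OF h]]) auto
  then obtain d where d: "d > 0" "\<And>x. dist x x0 < d \<Longrightarrow> ?near x"
    unfolding eventually_nhds_metric by blast
  define r where "r = d / 2"
  have r: "r > 0" using d by (simp add: r_def)
  have near: "?near x"
    if "x \<in> cball x0 r" for x
    using that r by (intro d(2)) (auto simp: r_def dist_commute)
  have rS: "cball x0 r \<subseteq> S" using near by blast
  have Tfx: "(x, differential f x) \<in> T" if "x \<in> cball x0 r" for x
  proof -
    have "differential f x \<in> B" using near[OF that] s ball_subset_cball by blast
    then show ?thesis using near[OF that] AB by blast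
  qed
  define A' where "A' = (\<lambda>x w. frechet_derivative ?\<Phi> (at (x, differential f x)) (0, w))"
  have sm: "smooth_on T ?\<Phi>" using smooth_on_flux[OF S(1) G(1) oT TS Tpos] .
  have T3: "cball x0 r \<times> cball \<omega>0 s \<subseteq> T" using near s AB by blast
  obtain C where C: "C \<ge> 0" "\<And>x. x \<in> ball x0 r \<Longrightarrow> (\<Sum>i\<in>Basis. \<Sum>j\<in>Basis.
        (i \<bullet> A' x j) * second_derivative (\<lambda>y. h y - f y) x i j)
      \<le> C * ((\<Sum>i\<in>Basis. \<bar>frechet_derivative (\<lambda>y. h y - f y) (at x) i\<bar>) + (h x - f x))"
    unfolding A'_def
  proof (rule linearized_inequality[of S x0 r dv e G f h T \<omega>0 s "W \<times> UNIV \<times> UNIV" b p])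
    show "cball x0 r \<times> cball 0 1 \<times> cball \<omega>0 s \<subseteq> W \<times> UNIV \<times> UNIV" using near by blast
    show "differential f x \<in> cball \<omega>0 s \<and> differential h x \<in> cball \<omega>0 s" if "x \<in> cball x0 r" for x
      using near[OF that] by (meson ball_subset_cball subsetD)
    show "\<bar>f x\<bar> \<le> 1 \<and> \<bar>h x\<bar> \<le> 1" if "x \<in> cball x0 r" for x
      using near[OF that] by simp
    have bc: "x \<in> cball x0 r" if "x \<in> ball x0 r" for x using that by simp
    show "f x \<le> h x" if "x \<in> ball x0 r" for x using near[OF bc[OF that]] by blast
    show "mean_curvature G dv p h x + b x (h x) (differential h x) \<le> mean_curvature G dv p f x + b x (f x) (differential f x)"
      if "x \<in> ball x0 r" for x using near[OF bc[OF that]] by blast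
  qed ((rule S(1) rS alt dv e nze G(1,2) f h oT TS T3 Tpos b(3) | assumption)+, blast)
  have A'_eq: "A' x w = coinner (G x) \<omega> \<omega> powr ((p - 1) / 2 - 1) *\<^sub>R
      (coinner (G x) \<omega> \<omega> *\<^sub>R (G x *v w) + ((p - 1) * (\<omega> \<bullet> (G x *v w))) *\<^sub>R (G x *v \<omega>))"
    if "x \<in> ball x0 r" "\<omega> = differential f x" for x w \<omega>
    unfolding A'_def that(2) using that(1) rS
    by (intro flux_derivative[OF Tfx sm G(2) Tpos[OF Tfx]]) auto
  have psd: "v \<bullet> (G x *v v) \<ge> 0" if "x \<in> S" for x v using G(3)[OF that, of v] by (simp add: coinner_def)
  have quad: "w \<bullet> A' x w = coinner (G x) \<omega> \<omega> powr ((p - 1) / 2 - 1) *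
      ((\<omega> \<bullet> (G x *v \<omega>)) * (w \<bullet> (G x *v w)) + (p - 1) * (\<omega> \<bullet> (G x *v w))\<^sup>2)"
    if "x \<in> ball x0 r" "\<omega> = differential f x" for x w \<omega>
  proof -
    have "x \<in> S" using that rS by auto
    then show ?thesis
      unfolding A'_eq[OF that] using symmetric_inner[OF G(2), of x w \<omega>]
      by (simp add: inner_add_right coinner_def power2_eq_square)
  qed
  have pos: "\<omega> \<bullet> (G x *v \<omega>) > 0" if "x \<in> cball x0 r" "\<omega> = differential f x" for x \<omega>
    using Tpos[OF Tfx[OF that(1)]] that(2) by (simp add: coinner_def)
  have bc: "x \<in> cball x0 r" "x \<in> S" if "x \<in> ball x0 r" for x using that rS by auto
  have hopf: "\<nu> \<bullet> A' z \<nu> = 0"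
    if z: "z \<in> ball x0 r" "h z = f z" and \<nu>: "ball (z + \<nu>) (norm \<nu>) \<inter> {x \<in> cball x0 r. h x = f x} = {}" for z \<nu>
  proof (rule hopf_normal_degenerate[where S = "ball x0 r" and u = "\<lambda>x. h x - f x" and C = C and A = A'
        and F = "{x \<in> cball x0 r. h x = f x}" and z = z and \<nu> = \<nu>])
    show "smooth_on (ball x0 r) (\<lambda>x. h x - f x)"
      by (rule smooth_on_subset[OF smooth_on_diff[OF S(1) h f]]) (use bc in blast)
    show "linear (A' x)" if "x \<in> ball x0 r" for x
    proof -
      have l: "linear (frechet_derivative ?\<Phi> (at (x, differential f x)))"
        by (rule smooth_on_linear_frechet[OF sm Tfx[OF bc(1)[OF that]]])
      have "linear (\<lambda>w :: real^'n. (0 :: real^'n, w))" by (auto intro!: linearI)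
      from linear_compose[OF this l] show ?thesis by (simp add: A'_def o_def)
    qed
    show "v \<bullet> A' x w = w \<bullet> A' x v" if "x \<in> ball x0 r" for x v w
    proof -
      note sym = symmetric_inner[OF G(2)[OF bc(2)[OF that]]]
      show ?thesis
        unfolding A'_eq[OF that refl] inner_scaleR_right inner_add_right
          sym[of v w] sym[of v "differential f x"] sym[of w "differential f x"] by simp
    qed
    show "v \<bullet> A' x v \<ge> 0" if "x \<in> ball x0 r" for x v
      unfolding quad[OF that refl]
      by (intro mult_nonneg_nonneg flux_quadratic_form(1) G(2) psd pos p bc that) auto
    show "continuous_on (ball x0 r) (\<lambda>x. A' x v)" for v
    proof -
      have "continuous_on (ball x0 r) (\<lambda>x. (x, differential f x))"
        using bc by (intro continuous_intros continuous_on_subset[OF cdf]) blast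
      from continuous_on_compose2[OF smooth_on_continuous[OF smooth_on_frechet_derivative[OF sm]] this]
      show ?thesis unfolding A'_def using Tfx[OF bc(1)] by blast
    qed
    show "h x - f x \<ge> 0" if "x \<in> ball x0 r" for x using near[OF bc(1)[OF that]] by simp
    show "x \<in> {x \<in> cball x0 r. h x = f x}" if "x \<in> ball x0 r" "h x - f x = 0" for x using that by simp
  qed (use C z \<nu> in simp_all)
  show ?thesis
  proof (rule that[OF r rS])
    show "differential h x0 = differential f x0" using h0 by (simp add: \<omega>0_def)
    show "coinner (G x) (differential f x) (differential f x) > 0" if "x \<in> cball x0 r" for x
      using Tpos[OF Tfx[OF that]] .
    fix z \<nu> assume z: "z \<in> ball x0 r" "h z = f z" and \<nu>: "ball (z + \<nu>) (norm \<nu>) \<inter> {x \<in> cball x0 r. h x = f x} = {}"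
    have "coinner (G z) (differential f z) (differential f z) powr ((p - 1) / 2 - 1) > 0"
      using Tpos[OF Tfx[OF bc(1)[OF z(1)]]] by simp
    with hopf[OF z \<nu>] have q: "(differential f z \<bullet> (G z *v differential f z)) * (\<nu> \<bullet> (G z *v \<nu>)) +
        (p - 1) * (differential f z \<bullet> (G z *v \<nu>))\<^sup>2 = 0"
      unfolding quad[OF z(1) refl] by (metis less_irrefl mult_eq_0_iff)
    note facts = flux_quadratic_form(2,3)[OF G(2)[OF bc(2)[OF z(1)]] psd[OF bc(2)[OF z(1)]] pos[OF bc(1)[OF z(1)] refl] p q]
    show "coinner (G z) (differential f z) (differential f z) *\<^sub>R (G z *v \<nu>) =
        (differential f z \<bullet> (G z *v \<nu>)) *\<^sub>R (G z *v differential f z) \<and> (p > 0 \<longrightarrow> G z *v \<nu> = 0)"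
      unfolding coinner_def using facts by blast
  qed
qed

section \<open>Full rank and coincidence of the functions\<close>

lemma orthogonal_to_spanning_eq_0:
  fixes \<nu> :: "'a::euclidean_space"
  assumes "dim W = DIM('a)" "\<And>w. w \<in> W \<Longrightarrow> w \<bullet> \<nu> = 0"
  shows "\<nu> = 0"
proof -
  have "span W = UNIV" using assms(1) dim_eq_full by blast
  moreover have "span W \<subseteq> {w. \<nu> \<bullet> w = 0}"
    using assms(2) by (intro span_minimal subspace_hyperplane) (auto simp: inner_commute)
  ultimately have "\<nu> \<bullet> \<nu> = 0" by blast
  then show ?thesis by simp
qed

lemma closed_coincidence_set:
  fixes f h :: "'a::euclidean_space \<Rightarrow> real"
  assumes "cball x0 r \<subseteq> S" "continuous_on S f" "continuous_on S h"
  shows "closed {x \<in> cball x0 r. h x = f x}"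
proof -
  have "closed {x \<in> cball x0 r. h x - f x = 0}"
    using assms by (intro continuous_closed_preimage_constant continuous_on_diff) (auto intro: continuous_on_subset)
  then show ?thesis by simp
qed

lemma max_principle_full_rank:
  fixes f h :: "real^'n::finite \<Rightarrow> real"
  assumes r: "r > 0" "cball x0 r \<subseteq> S" and fh: "continuous_on S f" "continuous_on S h" "h x0 = f x0"
    and G: "\<And>x. x \<in> S \<Longrightarrow> transpose (G x) = G x"
    and normal: "\<And>z \<nu>. z \<in> ball x0 r \<Longrightarrow> h z = f z \<Longrightarrow>
      ball (z + \<nu>) (norm \<nu>) \<inter> {x \<in> cball x0 r. h x = f x} = {} \<Longrightarrow> G z *v \<nu> = 0"
    and V: "open V" "x0 \<in> V"
    and X: "\<And>i. i < k \<Longrightarrow> smooth_on V (X i)" "\<And>i x. i < k \<Longrightarrow> x \<in> V \<Longrightarrow> X i x \<in> horizontal (G x)"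
    and rank: "\<forall>\<^sub>F x in nhds x0. lie_rank V k X x = CARD('n)"
  shows "\<forall>\<^sub>F x in nhds x0. h x = f x"
proof -
  define F where "F = {x \<in> cball x0 r. h x = f x}"
  have cF: "closed F" unfolding F_def using r(2) fh(1,2) by (rule closed_coincidence_set)
  have x0F: "x0 \<in> F" using r fh by (simp add: F_def)
  let ?S = "ball x0 r \<inter> V"
  have oS: "open ?S" using V by auto
  have tan: "tangent_field F ?S (X i)" if i: "i < k" for i
    unfolding tangent_field_def
  proof (intro ballI allI impI)
    fix z \<nu> assume z: "z \<in> F \<inter> ?S" and \<nu>: "ball (z + \<nu>) (norm \<nu>) \<inter> F = {}"
    \<comment> \<open>Symmetry of \<open>G\<close> turns this kernel condition into orthogonality of
      \<open>\<nu>\<close> to every horizontal vector at \<open>z\<close>.\<close>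
    have G0: "G z *v \<nu> = 0" using normal[of z \<nu>] z \<nu> by (simp add: F_def)
    have "z \<in> S" using z r by (auto simp: F_def)
    obtain \<eta> where "X i z = G z *v \<eta>" using X(2)[OF i, of z] z by (auto simp: horizontal_def sharp_def)
    then show "X i z \<bullet> \<nu> = 0"
      using symmetric_inner[OF G[OF \<open>z \<in> S\<close>], of \<nu> \<eta>] G0 by (simp add: inner_commute)
  qed
  have "\<forall>\<^sub>F x in nhds x0. x \<in> ?S \<and> lie_rank V k X x = CARD('n)"
    using rank V r by (intro eventually_conj eventually_nhds_in_open[OF oS]) auto
  then obtain \<rho> where \<rho>: "\<rho> > 0" "\<And>x. dist x x0 < \<rho> \<Longrightarrow> x \<in> ?S \<and> lie_rank V k X x = CARD('n)"
    unfolding eventually_nhds_metric by blast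
  have "ball x0 (\<rho> / 2) \<subseteq> F"
  proof (rule subset_if_no_normals[OF cF x0F])
    fix z \<nu> assume z: "z \<in> F" "z \<in> ball x0 \<rho>" and \<nu>: "ball (z + \<nu>) (norm \<nu>) \<inter> F = {}"
    have z': "z \<in> ?S" "lie_rank V k X z = CARD('n)" using \<rho>(2)[of z] z by (auto simp: dist_commute)
    have W: "w \<bullet> \<nu> = 0" if w: "w \<in> {Z z |Z. Z \<in> lie_module V (X ` {..<k})}" for w
    proof -
      obtain Z where Z: "w = Z z" "Z \<in> lie_module V (X ` {..<k})" using w by blast
      have "tangent_field F ?S Z"
        using lie_module_tangent[OF cF V(1) oS _ _ Z(2)] X(1) tan by blast
      then show ?thesis using Z(1) z(1) z'(1) \<nu> unfolding tangent_field_def by blast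
    qed
    have "dim {Z z |Z. Z \<in> lie_module V (X ` {..<k})} = DIM(real^'n)"
      using z'(2) by (simp add: lie_rank_def)
    then show "\<nu> = 0" using W by (rule orthogonal_to_spanning_eq_0)
  qed
  then show ?thesis
    unfolding eventually_nhds_metric using \<rho>(1)
    by (intro exI[of _ "\<rho> / 2"]) (auto simp: F_def subset_iff dist_commute)
qed

section \<open>Sections in the kernel of the differential and level sets\<close>

lemma dim_inter_hyperplane:
  fixes U :: "'a::euclidean_space set"
  assumes U: "subspace U" and v: "v \<in> U" "\<omega> \<bullet> v \<noteq> 0"
  shows "dim U = dim {x \<in> U. \<omega> \<bullet> x = 0} + 1"
proof -
  let ?U0 = "{x \<in> U. \<omega> \<bullet> x = 0}"
  have s0: "subspace ?U0"
    using subspace_inter[OF U subspace_hyperplane[of \<omega>]] by (simp add: Int_def)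
  have "v \<notin> span ?U0" using v s0 by (simp add: span_eq_iff[THEN iffD2])
  moreover have "span (insert v ?U0) = U"
  proof
    show "span (insert v ?U0) \<subseteq> U" using U v by (intro span_minimal) auto
    show "U \<subseteq> span (insert v ?U0)"
    proof
      fix x assume x: "x \<in> U"
      define c where "c = (\<omega> \<bullet> x) / (\<omega> \<bullet> v)"
      have "x - c *\<^sub>R v \<in> ?U0"
        using x v U by (auto simp: c_def subspace_diff subspace_scale inner_diff_right)
      then have "x - c *\<^sub>R v + c *\<^sub>R v \<in> span (insert v ?U0)"
        by (intro span_add span_scale) (auto intro: span_base)
      then show "x \<in> span (insert v ?U0)" by simp
    qed
  qed
  ultimately show ?thesis using dim_insert[of v ?U0] dim_span[of "insert v ?U0"] by simp
qed

text \<open>\<open>W\<close> spans the hyperplane orthogonal to \<open>\<omega>\<close>. Without its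
  component along \<open>\<omega>\<close>, the vector \<open>\<nu>\<close> lies in that hyperplane
  and is orthogonal to it, hence zero.\<close>

lemma parallel_if_orthogonal:
  fixes \<omega> \<nu> :: "'a::euclidean_space"
  assumes W: "dim W \<ge> DIM('a) - 1" "\<And>w. w \<in> W \<Longrightarrow> w \<bullet> \<omega> = 0" "\<And>w. w \<in> W \<Longrightarrow> w \<bullet> \<nu> = 0"
    and \<omega>: "\<omega> \<noteq> 0"
  shows "\<exists>c. \<nu> = c *\<^sub>R \<omega>"
proof -
  define \<mu> where "\<mu> = \<nu> - ((\<omega> \<bullet> \<nu>) / (\<omega> \<bullet> \<omega>)) *\<^sub>R \<omega>"
  have \<mu>\<omega>: "\<omega> \<bullet> \<mu> = 0" using \<omega> by (simp add: \<mu>_def inner_diff_right)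
  have sub: "span W \<subseteq> {x. \<omega> \<bullet> x = 0}"
    using W(2) by (intro span_minimal subspace_hyperplane) (auto simp: inner_commute)
  have "span W = {x. \<omega> \<bullet> x = 0}"
    using W(1) dim_hyperplane[OF \<omega>]
    by (intro subspace_dim_equal sub subspace_hyperplane subspace_span) simp
  then have "\<mu> \<in> span W" using \<mu>\<omega> by simp
  moreover have "\<mu> \<bullet> w = 0" if "w \<in> W" for w
    using W(2,3)[OF that] by (simp add: \<mu>_def inner_diff_right inner_commute[of _ w])
  then have "span W \<subseteq> {x. \<mu> \<bullet> x = 0}"
    by (intro span_minimal subspace_hyperplane) auto
  ultimately have "\<mu> \<bullet> \<mu> = 0" by blast
  then show ?thesis by (auto simp: \<mu>_def)
qed

text \<open>The formula projects \<open>G x *v \<eta>\<close> along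
  \<open>G x *v differential f x\<close> into the kernel of the differential, multiplied by the
  squared norm to stay free of division. Constant covectors that represent an orthonormal basis at
  \<open>x0\<close> yield fields that remain independent nearby.\<close>

lemma tangential_sections:
  fixes f :: "real^'n::finite \<Rightarrow> real"
  assumes S: "open S" "x0 \<in> S" and G: "smooth_on S G" and f: "smooth_on S f"
    and N: "coinner (G x0) (differential f x0) (differential f x0) > 0"
    and dim: "dim (horizontal (G x0)) = k + 1"
  obtains \<rho> X where "\<rho> > 0" "ball x0 \<rho> \<subseteq> S" "independent_sections G (ball x0 \<rho>) k X"
    "\<And>i x. \<exists>\<eta>. X i x = coinner (G x) (differential f x) (differential f x) *\<^sub>R (G x *v \<eta>)
      - (differential f x \<bullet> (G x *v \<eta>)) *\<^sub>R (G x *v differential f x)"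
proof -
  define \<omega> where "\<omega> = differential f"
  let ?N = "\<lambda>x. \<omega> x \<bullet> (G x *v \<omega> x)"
  have N0: "?N x0 > 0" using N by (simp add: coinner_def \<omega>_def)
  define U where "U = {v \<in> horizontal (G x0). \<omega> x0 \<bullet> v = 0}"
  have sH: "subspace (horizontal (G x0))"
    unfolding horizontal_def sharp_def using linear_subspace_image[OF matrix_vector_mul_linear subspace_UNIV] .
  have sU: "subspace U"
    unfolding U_def using subspace_inter[OF sH subspace_hyperplane[of "\<omega> x0"]] by (simp add: Int_def)
  \<comment> \<open>The covector is nonzero on the horizontal vector
    \<open>G x0 *v \<omega> x0\<close>, so passing to its kernel costs exactly one
    dimension.\<close>
  have dU: "dim U = k"
    using dim_inter_hyperplane[OF sH _ less_imp_neq[OF N0, symmetric]] dim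
    by (simp add: U_def horizontal_def sharp_def)
  obtain B where B: "B \<subseteq> U" "pairwise orthogonal B" "\<And>x. x \<in> B \<Longrightarrow> norm x = 1" "independent B" "card B = k"
    using orthonormal_basis_subspace[OF sU] dU by metis
  have "finite B" using B(4) independent_imp_finite by blast
  then obtain v where v: "bij_betw v {0..<k} B" using ex_bij_betw_nat_finite B(5) by blast
  have vB: "v i \<in> B" if "i < k" for i using v that by (auto simp: bij_betw_def)
  have vv: "v j \<bullet> v i = (if j = i then 1 else 0)" if "i < k" "j < k" for i j
  proof (cases "j = i")
    case True
    then show ?thesis using B(3)[OF vB[OF that(1)]] by (simp add: norm_eq_1)
  next
    case False
    then have "v j \<noteq> v i" using v that by (auto simp: bij_betw_def inj_on_def)
    then show ?thesis using False B(2) vB that by (auto simp: pairwise_def orthogonal_def)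
  qed
  have "\<exists>\<eta>. v i = G x0 *v \<eta>" if "i < k" for i
    using vB[OF that] B(1) by (auto simp: U_def horizontal_def sharp_def)
  then obtain \<eta> where \<eta>: "\<And>i. i < k \<Longrightarrow> v i = G x0 *v \<eta> i" by metis
  define X where "X = (\<lambda>i x. ?N x *\<^sub>R (G x *v \<eta> i) - (\<omega> x \<bullet> (G x *v \<eta> i)) *\<^sub>R (G x *v \<omega> x))"
  have sm\<omega>: "smooth_on S \<omega>" unfolding \<omega>_def by (rule smooth_on_differential[OF S(1) f])
  have smX: "smooth_on S (X i)" for i
    unfolding X_def
    by (intro smooth_on_diff smooth_on_scaleR smooth_on_inner smooth_on_matrix_vector smooth_on_const S(1) G sm\<omega>)
  have X0: "X i x0 = ?N x0 *\<^sub>R v i" if "i < k" for i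
    using vB[OF that] B(1) \<eta>[OF that] by (auto simp: X_def U_def)
  have "\<forall>\<^sub>F x in nhds x0. v j \<bullet> X i x \<in> ball (if j = i then ?N x0 else 0) (?N x0 / (k + 1))"
    if "i < k" "j < k" for i j
  proof (rule eventually_in_open[OF _ S])
    show "continuous_on S (\<lambda>x. v j \<bullet> X i x)"
      by (intro continuous_intros smooth_on_continuous smX)
    show "v j \<bullet> X i x0 \<in> ball (if j = i then ?N x0 else 0) (?N x0 / (k + 1))"
      using N0 by (simp add: X0[OF that(1)] vv[OF that])
  qed simp
  then have "\<forall>\<^sub>F x in nhds x0. \<forall>i\<in>{..<k}. \<forall>j\<in>{..<k}. v j \<bullet> X i x \<in> ball (if j = i then ?N x0 else 0) (?N x0 / (k + 1))"
    by (intro eventually_ball_finite ballI) auto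
  then have "\<forall>\<^sub>F x in nhds x0. x \<in> S \<and> (\<forall>i\<in>{..<k}. \<forall>j\<in>{..<k}. v j \<bullet> X i x \<in> ball (if j = i then ?N x0 else 0) (?N x0 / (k + 1)))"
    using S by (intro eventually_conj eventually_nhds_in_open)
  then obtain \<rho> where \<rho>: "\<rho> > 0" "\<And>x. dist x x0 < \<rho> \<Longrightarrow> x \<in> S \<and> (\<forall>i\<in>{..<k}. \<forall>j\<in>{..<k}. v j \<bullet> X i x \<in> ball (if j = i then ?N x0 else 0) (?N x0 / (k + 1)))"
    unfolding eventually_nhds_metric by blast
  have sub: "ball x0 \<rho> \<subseteq> S" using \<rho>(2) by (auto simp: dist_commute)
  have "inj_on (\<lambda>i. X i x) {..<k} \<and> independent ((\<lambda>i. X i x) ` {..<k})" if "x \<in> ball x0 \<rho>" for x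
  proof (rule independent_near_orthonormal[OF N0])
    show "\<bar>v j \<bullet> X i x - (if j = i then ?N x0 else 0)\<bar> < ?N x0 / real (k + 1)" if "j < k" "i < k" for i j
      using \<rho>(2)[of x] \<open>x \<in> ball x0 \<rho>\<close> that by (simp add: dist_commute dist_real_def abs_minus_commute)
  qed
  moreover have "X i x \<in> horizontal (G x)" for i x
  proof -
    have "X i x = G x *v (?N x *\<^sub>R \<eta> i - (\<omega> x \<bullet> (G x *v \<eta> i)) *\<^sub>R \<omega> x)"
      by (simp add: X_def matrix_vector_mult_diff_distrib matrix_vector_mult_scaleR)
    then show ?thesis by (auto simp: horizontal_def sharp_def)
  qed
  ultimately have "independent_sections G (ball x0 \<rho>) k X"
    unfolding independent_sections_def using smooth_on_subset[OF smX sub] by blast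
  then show ?thesis
    by (rule that[OF \<rho>(1) sub]) (auto simp: X_def \<omega>_def coinner_def)
qed

lemma max_principle_level_set:
  fixes f h :: "real^'n::finite \<Rightarrow> real"
  assumes S: "open S" and r: "r > 0" "cball x0 r \<subseteq> S"
    and f: "smooth_on S f" and h: "smooth_on S h" and zero: "f x0 = 0" "h x0 = 0"
    and G: "smooth_on S G" "\<And>x. x \<in> S \<Longrightarrow> transpose (G x) = G x"
    and N: "\<And>x. x \<in> cball x0 r \<Longrightarrow> coinner (G x) (differential f x) (differential f x) > 0"
    and normal: "\<And>z \<nu>. z \<in> ball x0 r \<Longrightarrow> h z = f z \<Longrightarrow>
      ball (z + \<nu>) (norm \<nu>) \<inter> {x \<in> cball x0 r. h x = f x} = {} \<Longrightarrow>
      coinner (G z) (differential f z) (differential f z) *\<^sub>R (G z *v \<nu>) =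
        (differential f z \<bullet> (G z *v \<nu>)) *\<^sub>R (G z *v differential f z)"
    and dim: "dim (horizontal (G x0)) = k + 1" "CARD('n) = m + 1"
    and rank: "\<forall>\<^sub>F x in nhds x0. \<forall>V X. open V \<and> V \<subseteq> S \<and> x \<in> V \<and> independent_sections G V k X
      \<longrightarrow> m \<le> lie_rank V k X x"
  shows "\<forall>\<^sub>F x in nhds x0. f x = 0 \<longrightarrow> h x = 0"
proof -
  define \<omega> where "\<omega> = differential f"
  have x0S: "x0 \<in> S" using r by auto
  obtain \<rho>1 X where X: "\<rho>1 > 0" "ball x0 \<rho>1 \<subseteq> S" "independent_sections G (ball x0 \<rho>1) k X"
    "\<And>i x. \<exists>\<eta>. X i x = coinner (G x) (\<omega> x) (\<omega> x) *\<^sub>R (G x *v \<eta>) - (\<omega> x \<bullet> (G x *v \<eta>)) *\<^sub>R (G x *v \<omega> x)"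
    unfolding \<omega>_def using tangential_sections[OF S x0S G(1) f N[of x0] dim(1)] r by auto
  let ?V = "ball x0 \<rho>1"
  define F where "F = {x \<in> cball x0 r. h x = f x}"
  have cF: "closed F"
    unfolding F_def by (rule closed_coincidence_set[OF r(2) smooth_on_continuous[OF f] smooth_on_continuous[OF h]])
  have x0F: "x0 \<in> F" using r zero by (simp add: F_def)
  define S' where "S' = ball x0 (min r \<rho>1)"
  have S': "open S'" "S' \<subseteq> ?V" "S' \<subseteq> ball x0 r" "S' \<subseteq> S"
    unfolding S'_def using r by auto
  have inner: "\<omega> x \<bullet> v = frechet_derivative f (at x) v" if "x \<in> S" for x v
    unfolding \<omega>_def by (rule smooth_on_differential_inner[OF f that])
  have smX: "smooth_on ?V (X i)" if "i < k" for i using X(3) that by (auto simp: independent_sections_def)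
  \<comment> \<open>Pairing the relation for \<open>\<nu>\<close> with the covector
    \<open>\<eta>\<close> that represents \<open>X i z\<close> gives
    \<open>X i z \<bullet> \<nu> = 0\<close>, by symmetry of \<open>G\<close>.\<close>
  have tanF: "tangent_field F S' (X i)" for i
    unfolding tangent_field_def
  proof (intro ballI allI impI)
    fix z \<nu> assume z: "z \<in> F \<inter> S'" and \<nu>: "ball (z + \<nu>) (norm \<nu>) \<inter> F = {}"
    have zS: "z \<in> S" and zb: "z \<in> ball x0 r" and "h z = f z" using z S' by (auto simp: F_def)
    note sym = symmetric_inner[OF G(2)[OF zS]]
    obtain \<eta> where \<eta>: "X i z = coinner (G z) (\<omega> z) (\<omega> z) *\<^sub>R (G z *v \<eta>) - (\<omega> z \<bullet> (G z *v \<eta>)) *\<^sub>R (G z *v \<omega> z)"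
      using X(4) by blast
    have "coinner (G z) (\<omega> z) (\<omega> z) *\<^sub>R (G z *v \<nu>) = (\<omega> z \<bullet> (G z *v \<nu>)) *\<^sub>R (G z *v \<omega> z)"
      unfolding \<omega>_def using normal[OF zb \<open>h z = f z\<close>] \<nu> by (simp add: F_def)
    then have "\<eta> \<bullet> (coinner (G z) (\<omega> z) (\<omega> z) *\<^sub>R (G z *v \<nu>)) = \<eta> \<bullet> ((\<omega> z \<bullet> (G z *v \<nu>)) *\<^sub>R (G z *v \<omega> z))"
      by simp
    then have "coinner (G z) (\<omega> z) (\<omega> z) * (\<eta> \<bullet> (G z *v \<nu>)) = (\<omega> z \<bullet> (G z *v \<nu>)) * (\<omega> z \<bullet> (G z *v \<eta>))"
      by (simp add: sym[of \<eta> "\<omega> z"])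
    then show "X i z \<bullet> \<nu> = 0"
      unfolding \<eta> inner_diff_left inner_scaleR_left inner_commute[of _ \<nu>] inner_diff_right inner_scaleR_right sym[of \<nu> \<eta>] sym[of \<nu> "\<omega> z"] by simp
  qed
  have orth: "X i x \<bullet> \<omega> x = 0" if "x \<in> S" for i x
  proof -
    obtain \<eta> where "X i x = coinner (G x) (\<omega> x) (\<omega> x) *\<^sub>R (G x *v \<eta>) - (\<omega> x \<bullet> (G x *v \<eta>)) *\<^sub>R (G x *v \<omega> x)"
      using X(4) by blast
    then show ?thesis by (simp add: inner_diff_right inner_commute[of _ "\<omega> x"] coinner_def)
  qed
  define L where "L = (\<lambda>t. {x \<in> cball x0 r. f x = t})"
  have cL: "closed (L t)" for t
    using closed_coincidence_set[OF r(2), of "\<lambda>x. t" f] smooth_on_continuous[OF f] unfolding L_def by simp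
  \<comment> \<open>Tangency to these closed sets is what keeps iterated brackets in the kernel of
    the differential.\<close>
  have tanL: "tangent_field (L t) S' (X i)" for t i
    unfolding tangent_field_def
  proof (intro ballI allI impI)
    fix z \<nu> assume z: "z \<in> L t \<inter> S'" and \<nu>: "ball (z + \<nu>) (norm \<nu>) \<inter> L t = {}"
    have zS: "z \<in> S" and zc: "z \<in> ball x0 r" using z S' by auto
    obtain \<rho> where \<rho>: "\<rho> > 0" "ball z \<rho> \<subseteq> ball x0 r" using zc openE[OF open_ball] by metis
    have bS: "ball z \<rho> \<subseteq> S" using \<rho> r by force
    show "X i z \<bullet> \<nu> = 0"
    proof (rule level_set_normal_orthogonal[OF smooth_on_has_derivative[OF f zS] _ \<rho>(1)])
      show "continuous_on (ball z \<rho>) f" using smooth_on_continuous[OF f] bS by (rule continuous_on_subset)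
      show "f x \<noteq> f z" if "x \<in> ball z \<rho>" "x \<in> ball (z + \<nu>) (norm \<nu>)" for x
      proof -
        have "x \<in> cball x0 r" using that(1) \<rho>(2) ball_subset_cball by blast
        then show ?thesis using that(2) \<nu> z by (auto simp: L_def)
      qed
      show "frechet_derivative f (at z) (G z *v \<omega> z) \<noteq> 0"
        unfolding inner[OF zS, symmetric] using N[of z] zc by (simp add: coinner_def \<omega>_def)
      show "frechet_derivative f (at z) (X i z) = 0"
        unfolding inner[OF zS, symmetric] using orth[OF zS, of i] by (simp add: inner_commute)
    qed
  qed
  have \<omega>0: "\<omega> x0 \<noteq> 0" using N[of x0] r by (auto simp: \<omega>_def coinner_def)
  \<comment> \<open>If both covectors are within \<kappa> of \<open>\<omega> x0\<close>, then
    \<open>norm (\<omega> z) \<ge> 3 * \<kappa>\<close> while \<open>\<omega> z\<close> and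
    \<open>\<omega> \<xi>\<close> differ by at most \<open>2 * \<kappa>\<close>; what remains is the
    lower bound required by \<open>level_set_subset\<close>.\<close>
  define \<kappa> where "\<kappa> = norm (\<omega> x0) / 4"
  have \<kappa>: "\<kappa> > 0" using \<omega>0 by (simp add: \<kappa>_def)
  have c\<omega>: "continuous_on S \<omega>" unfolding \<omega>_def by (rule smooth_on_continuous[OF smooth_on_differential[OF S f]])
  let ?near = "\<lambda>x. x \<in> S' \<and> \<omega> x \<in> ball (\<omega> x0) \<kappa> \<and>
      (\<forall>V X. open V \<and> V \<subseteq> S \<and> x \<in> V \<and> independent_sections G V k X \<longrightarrow> m \<le> lie_rank V k X x)"
  have "\<forall>\<^sub>F x in nhds x0. ?near x"
    using S' X(1) r \<kappa> S x0S
    by (intro eventually_conj rank eventually_nhds_in_open eventually_in_open[OF c\<omega>]) (auto simp: S'_def)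
  then obtain \<rho> where \<rho>: "\<rho> > 0" "\<And>x. dist x x0 < \<rho> \<Longrightarrow> ?near x"
    unfolding eventually_nhds_metric by blast
  have near: "x \<in> S'" "norm (\<omega> x0 - \<omega> x) < \<kappa>" "m \<le> lie_rank ?V k X x" if "x \<in> ball x0 \<rho>" for x
  proof -
    have *: "x \<in> S' \<and> \<omega> x \<in> ball (\<omega> x0) \<kappa> \<and>
        (\<forall>V X. open V \<and> V \<subseteq> S \<and> x \<in> V \<and> independent_sections G V k X \<longrightarrow> m \<le> lie_rank V k X x)"
      using that by (intro \<rho>(2)) (simp add: dist_commute)
    then show "x \<in> S'" "norm (\<omega> x0 - \<omega> x) < \<kappa>" by (simp_all add: dist_norm)
    have "x \<in> ?V" using * S'(2) by blast
    then show "m \<le> lie_rank ?V k X x" using * X(2,3) open_ball by blast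
  qed
  define \<rho>' where "\<rho>' = min \<rho> r"
  have "y \<in> F" if y: "y \<in> ball x0 (\<rho>' / 2)" "f y = 0" for y
  proof (rule level_set_subset[OF f r(2) _ cF _ x0F zero(1) \<kappa> _ _ y])
    show "\<rho>' \<le> r" by (simp add: \<rho>'_def)
    show "F \<subseteq> cball x0 r" by (auto simp: F_def)
  next
    fix \<xi> z assume "\<xi> \<in> ball x0 \<rho>'" "z \<in> ball x0 \<rho>'"
    then have d: "norm (\<omega> x0 - \<omega> \<xi>) < \<kappa>" "norm (\<omega> x0 - \<omega> z) < \<kappa>"
      using near(2)[of \<xi>] near(2)[of z] by (auto simp: \<rho>'_def)
    have z3: "norm (\<omega> z) \<ge> 3 * \<kappa>"
      using d(2) norm_triangle_ineq2[of "\<omega> x0" "\<omega> x0 - \<omega> z"] by (simp add: \<kappa>_def)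
    have "norm (\<omega> z - \<omega> \<xi>) \<le> 2 * \<kappa>"
      using norm_triangle_ineq[of "\<omega> x0 - \<omega> \<xi>" "\<omega> z - \<omega> x0"] d by (simp add: norm_minus_commute)
    then have "(\<omega> z - \<omega> \<xi>) \<bullet> \<omega> z \<le> 2 * \<kappa> * norm (\<omega> z)"
      by (meson mult_right_mono norm_cauchy_schwarz norm_ge_zero order_trans)
    moreover have "\<omega> z \<bullet> \<omega> z \<ge> 3 * \<kappa> * norm (\<omega> z)"
      using mult_right_mono[OF z3, of "norm (\<omega> z)"] by (simp add: dot_square_norm power2_eq_square)
    ultimately show "\<kappa> * norm (differential f z) \<le> differential f \<xi> \<bullet> differential f z"
      unfolding \<omega>_def[symmetric] by (simp add: inner_diff_left)
  next
    fix z \<nu> assume z: "z \<in> F" "z \<in> ball x0 \<rho>'" and \<nu>: "ball (z + \<nu>) (norm \<nu>) \<inter> F = {}"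
    have z': "z \<in> S'" "m \<le> lie_rank ?V k X z" using near[of z] z by (auto simp: \<rho>'_def)
    have zS: "z \<in> S" and zb: "z \<in> ball x0 r" using z'(1) S' by blast+
    have "\<omega> z \<noteq> 0" using N[of z] zb by (auto simp: \<omega>_def coinner_def)
    \<comment> \<open>A multiple of \<open>\<omega> z\<close> is an exterior normal of the level set
      through \<open>z\<close>, so fields tangent to that set are orthogonal to
      \<open>\<omega> z\<close>.\<close>
    obtain s where s: "s > 0" "\<And>x. x \<in> cball x0 r \<Longrightarrow> f x = f z \<Longrightarrow>
        x \<notin> ball (z + s *\<^sub>R \<omega> z) (norm (s *\<^sub>R \<omega> z))"
      unfolding \<omega>_def using level_set_has_normal[OF f r(2) zb] by blast
    have Ln: "ball (z + s *\<^sub>R \<omega> z) (norm (s *\<^sub>R \<omega> z)) \<inter> L (f z) = {}" using s(2) by (auto simp: L_def)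
    have zL: "z \<in> L (f z)" using zb by (simp add: L_def)
    let ?W = "{Z z |Z. Z \<in> lie_module ?V (X ` {..<k})}"
    have tangent: "tangent_field F S' Z" "tangent_field (L (f z)) S' Z" if "Z \<in> lie_module ?V (X ` {..<k})" for Z
      using lie_module_tangent[OF cF open_ball S'(1,2) _ that] lie_module_tangent[OF cL open_ball S'(1,2) _ that]
        smX tanF tanL by blast+
    have "\<exists>c. \<nu> = c *\<^sub>R \<omega> z"
    proof (rule parallel_if_orthogonal[of ?W, OF _ _ _ \<open>\<omega> z \<noteq> 0\<close>])
      show "DIM(real^'n) - 1 \<le> dim ?W" using z'(2) dim(2) by (simp add: lie_rank_def)
      show "w \<bullet> \<nu> = 0" if "w \<in> ?W" for w
        using that tangent(1) z(1) z'(1) \<nu> unfolding tangent_field_def by blast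
      show "w \<bullet> \<omega> z = 0" if "w \<in> ?W" for w
      proof -
        have "w \<bullet> (s *\<^sub>R \<omega> z) = 0"
          using that tangent(2) zL z'(1) Ln unfolding tangent_field_def by blast
        then show ?thesis using s(1) by simp
      qed
    qed
    then show "\<exists>c. \<nu> = c *\<^sub>R differential f z" unfolding \<omega>_def .
  qed
  then show ?thesis
    unfolding eventually_nhds_metric using \<rho>(1) r(1)
    by (intro exI[of _ "\<rho>' / 2"]) (auto simp: F_def \<rho>'_def dist_commute)
qed

section \<open>Coincidence of the two zero sets\<close>

lemma increasing_in_direction:
  fixes f :: "real^'n::finite \<Rightarrow> real"
  assumes f: "smooth_on S f" and S: "ball x0 \<rho> \<subseteq> S"
    and pos: "\<And>x. x \<in> ball x0 \<rho> \<Longrightarrow> differential f x \<bullet> v > 0"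
    and y: "y \<in> ball x0 \<rho>" "y + t *\<^sub>R v \<in> ball x0 \<rho>" and t: "t > 0"
  shows "f y < f (y + t *\<^sub>R v)"
proof -
  have seg: "closed_segment y (y + t *\<^sub>R v) \<subseteq> ball x0 \<rho>"
    using y by (intro closed_segment_subset) auto
  then obtain \<xi> where \<xi>: "\<xi> \<in> closed_segment y (y + t *\<^sub>R v)"
    "f (y + t *\<^sub>R v) - f y = frechet_derivative f (at \<xi>) (y + t *\<^sub>R v - y)"
    using mean_value_segment[of S f "\<lambda>x. frechet_derivative f (at x)" y "y + t *\<^sub>R v"]
      smooth_on_has_derivative[OF f] S by (metis subset_trans)
  have "\<xi> \<in> ball x0 \<rho>" using \<xi>(1) seg by blast
  moreover from this have "\<xi> \<in> S" using S by blast
  moreover have "t * (differential f \<xi> \<bullet> v) > 0" using pos[OF \<open>\<xi> \<in> ball x0 \<rho>\<close>] t by simp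
  ultimately show ?thesis
    using \<xi>(2) smooth_on_differential_inner[OF f, of \<xi> "t *\<^sub>R v"] by simp
qed

text \<open>If \<open>h y = 0\<close> but \<open>f y < 0\<close>, move from \<open>y\<close> in the
  direction of the common gradient until \<open>f\<close> vanishes. There \<open>h\<close> vanishes
  too by \<open>fh\<close>, although it has strictly increased on the way.\<close>

lemma zero_sets_coincide:
  fixes f h :: "real^'n::finite \<Rightarrow> real"
  assumes S: "open S" "x0 \<in> S" and f: "smooth_on S f" and h: "smooth_on S h" and zero: "f x0 = 0"
    and d: "differential h x0 = differential f x0" "differential f x0 \<noteq> 0"
    and le: "\<forall>\<^sub>F x in nhds x0. f x \<le> h x" and fh: "\<forall>\<^sub>F x in nhds x0. f x = 0 \<longrightarrow> h x = 0"
  shows "\<forall>\<^sub>F x in nhds x0. h x = 0 \<longrightarrow> f x = 0"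
proof -
  define v where "v = differential f x0"
  let ?near = "\<lambda>x. x \<in> S \<and> f x \<le> h x \<and> (f x = 0 \<longrightarrow> h x = 0) \<and>
      differential f x \<bullet> v \<in> {0<..} \<and> differential h x \<bullet> v \<in> {0<..}"
  have "\<forall>\<^sub>F x in nhds x0. ?near x"
    using S d
    by (intro eventually_conj eventually_nhds_in_open le fh
        eventually_in_open[OF continuous_on_inner[OF smooth_on_continuous[OF smooth_on_differential[OF S(1) f]] continuous_on_const]]
        eventually_in_open[OF continuous_on_inner[OF smooth_on_continuous[OF smooth_on_differential[OF S(1) h]] continuous_on_const]])
      (auto simp: v_def)
  then obtain \<rho> where \<rho>: "\<rho> > 0" "\<And>x. dist x x0 < \<rho> \<Longrightarrow> ?near x"
    unfolding eventually_nhds_metric by blast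
  have near: "x \<in> S" "f x \<le> h x" "f x = 0 \<Longrightarrow> h x = 0" "differential f x \<bullet> v > 0" "differential h x \<bullet> v > 0"
    if "x \<in> ball x0 \<rho>" for x
    using \<rho>(2)[of x] that by (auto simp: dist_commute)
  have bS: "ball x0 \<rho> \<subseteq> S" using near(1) by blast
  \<comment> \<open>Moving for a time up to \<open>\<tau>\<close> shifts a point by at most
    \<open>\<rho> / 2\<close>, so starting points within \<open>\<rho> / 2\<close> of
    \<open>x0\<close> stay in the ball.\<close>
  define \<tau> where "\<tau> = \<rho> / (2 * norm v)"
  have v: "v \<noteq> 0" using d by (simp add: v_def)
  have \<tau>: "\<tau> > 0" using \<rho> v by (simp add: \<tau>_def)
  have \<tau>v: "norm (t *\<^sub>R v) \<le> \<rho> / 2" if "0 \<le> t" "t \<le> \<tau>" for t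
  proof -
    have "norm (t *\<^sub>R v) \<le> \<tau> * norm v" using that by (simp add: mult_right_mono)
    then show ?thesis using v by (simp add: \<tau>_def)
  qed
  have "x0 + \<tau> *\<^sub>R v \<in> ball x0 \<rho>" using \<tau>v[of \<tau>] \<tau> \<rho> by (simp add: dist_norm)
  then have ftop: "f (x0 + \<tau> *\<^sub>R v) > 0"
    using increasing_in_direction[OF f bS near(4), of x0 \<tau>] \<tau> \<rho> zero by simp
  \<comment> \<open>Continuity in the starting point carries the positive value at
    \<open>x0 + \<tau> *\<^sub>R v\<close> over to nearby \<open>y\<close>, which supplies the sign
    change for the intermediate value theorem.\<close>
  have "continuous_on (ball x0 (\<rho> / 2)) (\<lambda>y. f (y + \<tau> *\<^sub>R v))"
  proof (rule continuous_on_compose2[OF smooth_on_continuous[OF f]])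
    show "(\<lambda>y. y + \<tau> *\<^sub>R v) ` ball x0 (\<rho> / 2) \<subseteq> S"
    proof clarify
      fix y assume "y \<in> ball x0 (\<rho> / 2)"
      then have "dist x0 (y + \<tau> *\<^sub>R v) < \<rho>"
        using \<tau>v[of \<tau>] \<tau> dist_triangle[of x0 "y + \<tau> *\<^sub>R v" y] by (simp add: dist_norm)
      then show "y + \<tau> *\<^sub>R v \<in> S" using bS by auto
    qed
  qed (intro continuous_intros)
  from eventually_in_open[OF this open_ball _ open_greaterThan[of 0]] ftop \<rho>
  have "\<forall>\<^sub>F y in nhds x0. f (y + \<tau> *\<^sub>R v) > 0" by simp
  moreover have "\<forall>\<^sub>F y in nhds x0. y \<in> ball x0 (\<rho> / 2)"
    using \<rho> by (intro eventually_nhds_in_open) auto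
  ultimately show ?thesis
  proof eventually_elim
    case (elim y)
    have inb: "y + t *\<^sub>R v \<in> ball x0 \<rho>" if "0 \<le> t" "t \<le> \<tau>" for t
      using \<tau>v[OF that] elim(2) dist_triangle[of x0 "y + t *\<^sub>R v" y] by (simp add: dist_norm)
    have yb: "y \<in> ball x0 \<rho>" using inb[of 0] \<tau> by simp
    show ?case
    proof (rule impI, rule ccontr)
      assume hy: "h y = 0" and "f y \<noteq> 0"
      then have fy: "f y < 0" using near(2)[OF yb] by simp
      have "continuous_on {0..\<tau>} (\<lambda>t. f (y + t *\<^sub>R v))"
        using inb bS by (intro continuous_on_compose2[OF smooth_on_continuous[OF f]] continuous_intros) force
      then obtain t where t: "0 \<le> t" "t \<le> \<tau>" "f (y + t *\<^sub>R v) = 0"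
        using IVT'[of "\<lambda>t. f (y + t *\<^sub>R v)" 0 0 \<tau>] fy elim(1) \<tau> by auto
      have "t > 0" using t fy by (cases "t = 0") auto
      have "h y < h (y + t *\<^sub>R v)"
        by (rule increasing_in_direction[OF h bS near(5) yb inb[OF t(1,2)] \<open>t > 0\<close>])
      then show False using hy near(3)[OF inb[OF t(1,2)] t(3)] by simp
    qed
  qed
qed


subsection \<open>Passage to a chart\<close>

lemma chart_inv_coord:
  assumes "is_chart M c" "q \<in> chart_dom c"
  shows "chart_inv c (coord c q) = q"
proof -
  have "chart_dom c \<subseteq> topspace M" using assms(1) openin_subset by (auto simp: is_chart_def)
  then have "inj_on (coord c) (chart_dom c)"
    using assms(1) homeomorphic_imp_injective_map by (fastforce simp: is_chart_def Int_absorb1)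
  then show ?thesis using assms(2) by (simp add: chart_inv_def inv_into_f_f)
qed

lemma open_coord_image:
  assumes c: "is_chart M c" and U: "openin M U"
  shows "open (coord c ` (chart_dom c \<inter> U))"
proof -
  have dom: "openin M (chart_dom c)" "open (coord c ` chart_dom c)"
    and hom: "homeomorphic_map (subtopology M (chart_dom c)) (top_of_set (coord c ` chart_dom c)) (coord c)"
    using c by (auto simp: is_chart_def)
  have "openin (subtopology M (chart_dom c)) (chart_dom c \<inter> U)"
    using U by (auto simp: openin_subtopology)
  then have "openin (top_of_set (coord c ` chart_dom c)) (coord c ` (chart_dom c \<inter> U))"
    using homeomorphic_imp_open_map[OF hom] by (simp add: open_map_def)
  then show ?thesis using openin_open_trans dom(2) by blast
qed

text \<open>Values of \<open>chart_inv\<close> off the coordinate image carry no meaning, but that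
  image is an open neighbourhood of the coordinate point, so they do not affect the filter.\<close>

lemma eventually_nhdsin_chart:
  assumes c: "is_chart M c" and p: "p\<^sub>0 \<in> chart_dom c"
  shows "(\<forall>\<^sub>F q in nhdsin M p\<^sub>0. P q) \<longleftrightarrow> (\<forall>\<^sub>F x in nhds (coord c p\<^sub>0). P (chart_inv c x))"
proof -
  have dom: "openin M (chart_dom c)" "open (coord c ` chart_dom c)"
    and hom: "homeomorphic_map (subtopology M (chart_dom c)) (top_of_set (coord c ` chart_dom c)) (coord c)"
    using c by (auto simp: is_chart_def)
  have pM: "p\<^sub>0 \<in> topspace M" using dom p openin_subset by blast
  show ?thesis
  proof
    assume "\<forall>\<^sub>F q in nhdsin M p\<^sub>0. P q"
    then obtain U where U: "openin M U" "p\<^sub>0 \<in> U" "\<And>q. q \<in> U \<Longrightarrow> P q"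
      using pM by (auto simp: eventually_nhdsin)
    have "\<forall>x\<in>coord c ` (chart_dom c \<inter> U). P (chart_inv c x)"
      using U(3) chart_inv_coord[OF c] by auto
    then show "\<forall>\<^sub>F x in nhds (coord c p\<^sub>0). P (chart_inv c x)"
      unfolding eventually_nhds using open_coord_image[OF c U(1)] p U(2) by blast
  next
    assume "\<forall>\<^sub>F x in nhds (coord c p\<^sub>0). P (chart_inv c x)"
    then obtain V where V: "open V" "coord c p\<^sub>0 \<in> V" "\<And>x. x \<in> V \<Longrightarrow> P (chart_inv c x)"
      by (auto simp: eventually_nhds)
    let ?U = "{q \<in> chart_dom c. coord c q \<in> V}"
    have "openin (top_of_set (coord c ` chart_dom c)) (coord c ` chart_dom c \<inter> V)"
      using V(1) by (auto simp: openin_open)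
    then have "openin (subtopology M (chart_dom c)) {q \<in> topspace (subtopology M (chart_dom c)). coord c q \<in> coord c ` chart_dom c \<inter> V}"
      using homeomorphic_imp_continuous_map[OF hom] openin_continuous_map_preimage by blast
    moreover have "{q \<in> topspace (subtopology M (chart_dom c)). coord c q \<in> coord c ` chart_dom c \<inter> V} = ?U"
      using dom(1) openin_subset by fastforce
    ultimately have "openin M ?U" using openin_trans_full[OF _ dom(1)] by simp
    moreover have "P q" if "q \<in> ?U" for q using V(3)[of "coord c q"] that chart_inv_coord[OF c, of q] by auto
    ultimately show "\<forall>\<^sub>F q in nhdsin M p\<^sub>0. P q"
      using p V(2) by (auto simp: eventually_nhdsin)
  qed
qed

theorem theoremB:
  fixes M :: "'a topology"
    and A :: "('a, 'n::finite) chart set"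
    and g :: "('a, 'n) chart \<Rightarrow> real^'n \<Rightarrow> real^'n^'n"
    and dv :: "('a, 'n) chart \<Rightarrow> real^'n \<Rightarrow> (real^'n) list \<Rightarrow> real"
    and m l :: nat
    and U W :: "'a set"
    and \<phi> \<psi> :: "'a \<Rightarrow> real"
    and p\<^sub>0 :: 'a
    and c :: "('a, 'n) chart"
    and p :: real
    and b :: "real^'n \<Rightarrow> real \<Rightarrow> real^'n \<Rightarrow> real"
  assumes dimM: "CARD('n) = m + 1" "m \<ge> 1"
    and manifold: "smooth_manifold M A"
    and metric: "subriemannian_metric A g"
    and volume: "volume_form A dv"
    and U: "openin M U" "p\<^sub>0 \<in> U"
    and defining: "defining_function A U \<phi>" "defining_function A U \<psi>"
    and chart: "c \<in> A" "p\<^sub>0 \<in> chart_dom c"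
    and zero: "\<phi> p\<^sub>0 = 0" "\<psi> p\<^sub>0 = 0"
    and tangent: "hypersurface_tangent_space (in_chart c \<phi>) (coord c p\<^sub>0) = hypersurface_tangent_space (in_chart c \<psi>) (coord c p\<^sub>0)"
    and nonchar: "conorm (g c (coord c p\<^sub>0)) (differential (in_chart c \<phi>) (coord c p\<^sub>0)) \<noteq> 0"
                 "conorm (g c (coord c p\<^sub>0)) (differential (in_chart c \<psi>) (coord c p\<^sub>0)) \<noteq> 0"
    and dim_xi: "\<forall>\<^sub>F q in nhdsin M p\<^sub>0. dim (horizontal (g c (coord c q))) + l = m + 1"
    and p: "p \<ge> 0"
    and W: "openin M W" "p\<^sub>0 \<in> W" "W \<subseteq> chart_dom c"
    and b_smooth: "smooth_on (coord c ` W \<times> UNIV \<times> UNIV) (\<lambda>(x, z, \<xi>). b x z \<xi>)"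
    and b_mono: "\<forall>x\<in>coord c ` W. \<forall>z \<xi>. deriv (\<lambda>t. b x t \<xi>) z \<le> 0"
    and ineq: "\<forall>\<^sub>F q in nhdsin M p\<^sub>0. let x = coord c q in
        mean_curvature (g c) (dv c) p (in_chart c \<psi>) x + b x (\<psi> q) (differential (in_chart c \<psi>) x)
        \<le> mean_curvature (g c) (dv c) p (in_chart c \<phi>) x + b x (\<phi> q) (differential (in_chart c \<phi>) x)"
    and above: "\<forall>\<^sub>F q in nhdsin M p\<^sub>0. \<phi> q \<le> \<psi> q"
  shows
    "((\<forall>\<^sub>F q in nhdsin M p\<^sub>0. \<forall>V X.
         open V \<and> V \<subseteq> coord c ` chart_dom c \<and> coord c q \<in> V \<and>
         independent_sections (g c) V (m - l) X \<longrightarrow> lie_rank V (m - l) X (coord c q) \<ge> m)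
      \<longrightarrow> (\<forall>\<^sub>F q in nhdsin M p\<^sub>0. q \<in> hypersurface U \<phi> \<longrightarrow> \<psi> q = 0 \<and> \<phi> q = 0) \<and>
          (\<forall>\<^sub>F q in nhdsin M p\<^sub>0. q \<in> hypersurface U \<psi> \<longleftrightarrow> q \<in> hypersurface U \<phi>))
     \<and>
     (p > 0 \<and>
      (\<exists>V X. open V \<and> V \<subseteq> coord c ` chart_dom c \<and> coord c p\<^sub>0 \<in> V \<and>
         basis_sections (g c) V (m + 1 - l) X \<and>
         (\<forall>\<^sub>F q in nhdsin M p\<^sub>0. lie_rank V (m + 1 - l) X (coord c q) = m + 1))
      \<longrightarrow> (\<forall>\<^sub>F q in nhdsin M p\<^sub>0. \<psi> q = \<phi> q))"
proof -
  define x0 where "x0 = coord c p\<^sub>0"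
  define f where "f = in_chart c \<phi>"
  define h where "h = in_chart c \<psi>"
  define D where "D = coord c ` chart_dom c"
  define S where "S = coord c ` (chart_dom c \<inter> U)"
  have c: "is_chart M c" using manifold chart by (auto simp: smooth_manifold_def)
  note nhds = eventually_nhdsin_chart[OF c chart(2), folded x0_def]
  have inv: "chart_inv c (coord c q) = q" if "q \<in> chart_dom c" for q by (rule chart_inv_coord[OF c that])
  have S: "open S" "x0 \<in> S" "S \<subseteq> D"
    using open_coord_image[OF c U(1)] chart U by (auto simp: S_def x0_def D_def)
  have evS: "\<forall>\<^sub>F x in nhds x0. x \<in> S" using S by (intro eventually_nhds_in_open)
  have coord_inv: "coord c (chart_inv c x) = x" "chart_inv c x \<in> chart_dom c" "chart_inv c x \<in> U" if "x \<in> S" for x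
    using that inv by (auto simp: S_def)
  have \<phi>\<psi>: "\<phi> (chart_inv c x) = f x" "\<psi> (chart_inv c x) = h x" for x
    by (simp_all add: f_def h_def in_chart_def)
  have vol: "(\<forall>vs. smooth_on D (\<lambda>x. dv c x vs)) \<and>
      (\<forall>x\<in>D. alternating_form CARD('n) (dv c x) \<and> (\<exists>vs. dv c x vs \<noteq> 0))"
    unfolding D_def by (rule bspec[OF conjunct1[OF volume[unfolded volume_form_def]] chart(1)])
  then have dvD: "smooth_on D (\<lambda>y. dv c y vs)" for vs by blast
  have dvS: "smooth_on S (\<lambda>y. dv c y vs)" for vs
    by (rule smooth_on_subset[OF dvD S(3)])
  have dvx: "alternating_form CARD('n) (dv c y)" "\<exists>vs. dv c y vs \<noteq> 0" if "y \<in> S" for y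
    using vol S(3) that by blast+
  have met: "smooth_on D (g c) \<and> (\<forall>x\<in>D. transpose (g c x) = g c x \<and> (\<forall>\<omega>. 0 \<le> coinner (g c x) \<omega> \<omega>))"
    unfolding D_def by (rule bspec[OF conjunct1[OF metric[unfolded subriemannian_metric_def]] chart(1)])
  have G: "smooth_on S (g c)" "\<And>x. x \<in> S \<Longrightarrow> transpose (g c x) = g c x"
      "\<And>x \<omega>. x \<in> S \<Longrightarrow> 0 \<le> coinner (g c x) \<omega> \<omega>"
    using met S(3) smooth_on_subset[of D "g c" S] by blast+
  have fh: "smooth_on S f" "smooth_on S h"
    using defining chart(1) by (auto simp: defining_function_def smooth_function_def S_def f_def h_def)
  have zero': "f x0 = 0" "h x0 = 0"
    using zero inv[OF chart(2)] by (simp_all add: f_def h_def x0_def in_chart_def)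
  have df0: "differential f x0 \<noteq> 0"
    using defining(1) chart U(2) by (auto simp: defining_function_def f_def x0_def)
  have N: "coinner (g c x0) (differential f x0) (differential f x0) > 0"
    using nonchar(1) G(3)[OF S(2), of "differential f x0"] by (simp add: conorm_def x0_def f_def)
  have Wc: "open (coord c ` W)" "x0 \<in> coord c ` W"
    using open_coord_image[OF c W(1)] W(2,3) by (auto simp: Int_absorb1 x0_def)
  have "\<forall>\<^sub>F x in nhds x0. let x' = coord c (chart_inv c x) in
        mean_curvature (g c) (dv c) p h x' + b x' (\<psi> (chart_inv c x)) (differential h x')
        \<le> mean_curvature (g c) (dv c) p f x' + b x' (\<phi> (chart_inv c x)) (differential f x')"
    using ineq unfolding nhds f_def h_def .
  with evS have ineq': "\<forall>\<^sub>F x in nhds x0. mean_curvature (g c) (dv c) p h x + b x (h x) (differential h x)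
        \<le> mean_curvature (g c) (dv c) p f x + b x (f x) (differential f x)"
    by eventually_elim (simp add: coord_inv \<phi>\<psi>)
  have le: "\<forall>\<^sub>F x in nhds x0. f x \<le> h x" using above unfolding nhds \<phi>\<psi> .
  obtain r where r: "r > 0" "cball x0 r \<subseteq> S" "differential h x0 = differential f x0"
    "\<And>x. x \<in> cball x0 r \<Longrightarrow> coinner (g c x) (differential f x) (differential f x) > 0"
    "\<And>z \<nu>. z \<in> ball x0 r \<Longrightarrow> h z = f z \<Longrightarrow> ball (z + \<nu>) (norm \<nu>) \<inter> {x \<in> cball x0 r. h x = f x} = {} \<Longrightarrow>
      coinner (g c z) (differential f z) (differential f z) *\<^sub>R (g c z *v \<nu>) =
        (differential f z \<bullet> (g c z *v \<nu>)) *\<^sub>R (g c z *v differential f z) \<and>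
      (p > 0 \<longrightarrow> g c z *v \<nu> = 0)"
  proof (rule max_principle_normals[OF S(1,2) dvx(1) dvS dvx(2) G fh zero' N p Wc b_smooth ineq' le])
  qed (assumption+, (rule that; assumption))
  have dimx0: "dim (horizontal (g c x0)) + l = m + 1"
  proof -
    have "\<forall>\<^sub>F x in nhds x0. dim (horizontal (g c (coord c (chart_inv c x)))) + l = m + 1"
      using dim_xi unfolding nhds .
    then have "dim (horizontal (g c (coord c (chart_inv c x0)))) + l = m + 1" by (rule eventually_nhds_x_imp_x)
    then show ?thesis using coord_inv(1)[OF S(2)] by simp
  qed
  \<comment> \<open>A covector of nonzero norm makes the horizontal space nonzero. Hence
    \<open>l \<le> m\<close>, and the truncated difference \<open>m - l\<close> is one less than its
    dimension.\<close>
  have "g c x0 *v differential f x0 \<in> horizontal (g c x0)" by (simp add: horizontal_def sharp_def)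
  moreover have "g c x0 *v differential f x0 \<noteq> 0" using N by (auto simp: coinner_def)
  ultimately have nontrivial: "\<not> horizontal (g c x0) \<subseteq> {0}" by blast
  show ?thesis
  proof (intro conjI impI)
    assume rank: "\<forall>\<^sub>F q in nhdsin M p\<^sub>0. \<forall>V X.
         open V \<and> V \<subseteq> coord c ` chart_dom c \<and> coord c q \<in> V \<and>
         independent_sections (g c) V (m - l) X \<longrightarrow> lie_rank V (m - l) X (coord c q) \<ge> m"
    have "\<forall>\<^sub>F x in nhds x0. \<forall>V X. open V \<and> V \<subseteq> D \<and> coord c (chart_inv c x) \<in> V \<and>
         independent_sections (g c) V (m - l) X \<longrightarrow> lie_rank V (m - l) X (coord c (chart_inv c x)) \<ge> m"
      using rank unfolding nhds D_def .
    with evS have rank': "\<forall>\<^sub>F x in nhds x0. \<forall>V X. open V \<and> V \<subseteq> S \<and> x \<in> V \<and> independent_sections (g c) V (m - l) X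
        \<longrightarrow> m \<le> lie_rank V (m - l) X x"
    proof eventually_elim
      case (elim x)
      then show ?case using S(3) coord_inv(1)[OF elim(1)] by (metis order_trans)
    qed
    have "dim (horizontal (g c x0)) \<noteq> 0" using nontrivial by (simp add: dim_eq_0)
    then have dimk: "dim (horizontal (g c x0)) = (m - l) + 1" using dimx0 by arith
    have fz: "\<forall>\<^sub>F x in nhds x0. f x = 0 \<longrightarrow> h x = 0"
      by (rule max_principle_level_set[OF S(1) r(1,2) fh zero' G(1,2) r(4) conjunct1[OF r(5)] dimk dimM(1) rank'])
    \<comment> \<open>The maximum principle yields one inclusion of the zero sets; the other comes
      from \<open>f \<le> h\<close> and the common nonzero gradient.\<close>
    have hz: "\<forall>\<^sub>F x in nhds x0. h x = 0 \<longrightarrow> f x = 0"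
      by (rule zero_sets_coincide[OF S(1,2) fh zero'(1) r(3) df0 le fz])
    show "\<forall>\<^sub>F q in nhdsin M p\<^sub>0. q \<in> hypersurface U \<phi> \<longrightarrow> \<psi> q = 0 \<and> \<phi> q = 0"
      unfolding nhds using fz by eventually_elim (simp add: hypersurface_def \<phi>\<psi>)
    show "\<forall>\<^sub>F q in nhdsin M p\<^sub>0. q \<in> hypersurface U \<psi> \<longleftrightarrow> q \<in> hypersurface U \<phi>"
      unfolding nhds using fz hz by eventually_elim (auto simp: hypersurface_def \<phi>\<psi>)
  next
    assume *: "p > 0 \<and> (\<exists>V X. open V \<and> V \<subseteq> coord c ` chart_dom c \<and> coord c p\<^sub>0 \<in> V \<and>
         basis_sections (g c) V (m + 1 - l) X \<and>
         (\<forall>\<^sub>F q in nhdsin M p\<^sub>0. lie_rank V (m + 1 - l) X (coord c q) = m + 1))"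
    then obtain V X where V: "open V" "x0 \<in> V" and X: "basis_sections (g c) V (m + 1 - l) X"
      and rank: "\<forall>\<^sub>F q in nhdsin M p\<^sub>0. lie_rank V (m + 1 - l) X (coord c q) = m + 1"
      unfolding x0_def by blast
    have "\<forall>\<^sub>F x in nhds x0. lie_rank V (m + 1 - l) X (coord c (chart_inv c x)) = m + 1"
      using rank unfolding nhds .
    with evS have rank': "\<forall>\<^sub>F x in nhds x0. lie_rank V (m + 1 - l) X x = CARD('n)"
      by eventually_elim (simp add: coord_inv dimM)
    have "\<forall>\<^sub>F x in nhds x0. h x = f x"
    proof (rule max_principle_full_rank[OF r(1,2) smooth_on_continuous[OF fh(1)] smooth_on_continuous[OF fh(2)] _ G(2) _ V _ _ rank'])
      show "h x0 = f x0" using zero' by simp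
      show "g c z *v \<nu> = 0" if "z \<in> ball x0 r" "h z = f z"
        "ball (z + \<nu>) (norm \<nu>) \<inter> {x \<in> cball x0 r. h x = f x} = {}" for z \<nu>
        using r(5)[OF that] * by blast
    qed (use X in \<open>auto simp: basis_sections_def independent_sections_def\<close>)
    then show "\<forall>\<^sub>F q in nhdsin M p\<^sub>0. \<psi> q = \<phi> q" unfolding nhds \<phi>\<psi> .
  qed
qed

end
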